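(* $Q^{(1)}_{\rm ss}$ is additive: for arbitrary quantum channels $\mathcal{N}_1$ and $\mathcal{N}_2$, $$Q^{(1)}_{\rm ss}(\mathcal{N}_1\otimes\mathcal{N}_2) = Q^{(1)}_{\rm ss}(\mathcal{N}_1)+Q^{(1)}_{\rm ss}(\mathcal{N}_2).$$
   Context: All Hilbert spaces are finite-dimensional complex; logarithms are base 2. $\mathcal{B}(\mathcal{H})$ denotes the linear operators on $\mathcal{H}$. A state is a positive semidefinite trace-one operator; subscripts indicate the tensor factors on which it lives, and dropping subscripts means taking the partial trace. A pure state is a rank-one projector. A quantum channel is a completely positive trace-preserving linear map; $\mathrm{id}$ is the identity channel. Von Neumann entropy: $S(\rho)=-\mathrm{Tr}\,\rho\log\rho$. Coherent information of a state $\rho_{XY}$: $I(X\rangle Y)_{\rho}=S(\rho_Y)-S(\rho_{XY})$, where $X$, $Y$ may be composite systems. For a channel $\mathcal{N}:\mathcal{B}(\tilde A)\to\mathcal{B}(B)$ define $$Q^{(1)}_{\rm ss}(\mathcal{N})=\sup_{\phi_{A\tilde A\top\perp}} I(A\rangle B\top)_\omega,\qquad \omega_{AB\top\perp}=(\mathrm{id}_{A\top\perp}\otimes\mathcal{N})(\phi_{A\tilde A\top\perp}),$$ where the supremum is over all finite-dimensional systems $A$, all $\top\cong\perp\cong\mathbb{C}^d$ with $d$ arbitrary, and all pure states $\phi_{A\tilde A\top\perp}$ on $A\otimes\tilde A\otimes\top\otimes\perp$ that are invariant under conjugation by the unitary swapping $\top$ and $\perp$. *)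

theory Defs
  imports
    "Jordan_Normal_Form.Schur_Decomposition"
    "Jordan_Normal_Form.DL_Rank"
    "HOL-Library.Extended_Real"
begin

text \<open>
  A Hilbert space of dimension n is \<open>\<complex>\<^sup>n\<close>, and operators on it are the elements of
  \<open>carrier_mat n n\<close>. The basis of a tensor product of spaces of dimensions m and n
  is ordered lexicographically: the index pair (i, k) is encoded as i * n + k. This encoding is
  strictly associative, so iterated tensor products need no reindexing.
\<close>

definition kron :: "complex mat \<Rightarrow> complex mat \<Rightarrow> complex mat" where
  "kron A B = mat (dim_row A * dim_row B) (dim_col A * dim_col B)
     (\<lambda>(i, j). A $$ (i div dim_row B, j div dim_col B) * B $$ (i mod dim_row B, j mod dim_col B))"

definition mat_trace :: "complex mat \<Rightarrow> complex" where
  "mat_trace A = (\<Sum>i<dim_row A. A $$ (i, i))"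

definition unitary_mat :: "nat \<Rightarrow> complex mat \<Rightarrow> bool" where
  "unitary_mat n U \<longleftrightarrow> U \<in> carrier_mat n n \<and>
     U * mat_adjoint U = 1\<^sub>m n \<and> mat_adjoint U * U = 1\<^sub>m n"

text \<open>The order on \<^typ>\<open>complex\<close> is the partial one, so \<open>0 \<le> z\<close> says that z is
  real and nonnegative; in particular the condition below implies that A is Hermitian.\<close>

definition psd :: "nat \<Rightarrow> complex mat \<Rightarrow> bool" where
  "psd n A \<longleftrightarrow> A \<in> carrier_mat n n \<and> (\<forall>v \<in> carrier_vec n. 0 \<le> (A *\<^sub>v v) \<bullet>c v)"

definition pure_state :: "nat \<Rightarrow> complex mat \<Rightarrow> bool" where
  "pure_state n \<phi> \<longleftrightarrow> \<phi> \<in> carrier_mat n n \<and> mat_adjoint \<phi> = \<phi> \<and> \<phi> * \<phi> = \<phi> \<and>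
     vec_space.rank n \<phi> = 1"

definition ptrace_left :: "nat \<Rightarrow> nat \<Rightarrow> complex mat \<Rightarrow> complex mat" where
  "ptrace_left m n \<rho> = mat n n (\<lambda>(k, l). \<Sum>i<m. \<rho> $$ (i * n + k, i * n + l))"

definition ptrace_right :: "nat \<Rightarrow> nat \<Rightarrow> complex mat \<Rightarrow> complex mat" where
  "ptrace_right m n \<rho> = mat m m (\<lambda>(i, j). \<Sum>k<n. \<rho> $$ (i * n + k, j * n + k))"

text \<open>Functional calculus for Hermitian matrices: if \<open>A = U diag(e) U\<^sup>*\<close> with U unitary and e
  real, then \<open>f(A) = U diag(f \<circ> e) U\<^sup>*\<close>.\<close>

definition herm_fun :: "(real \<Rightarrow> real) \<Rightarrow> complex mat \<Rightarrow> complex mat" where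
  "herm_fun f A = (THE M. \<exists>U e. unitary_mat (dim_row A) U \<and>
     A = U * mat_diag (dim_row A) (\<lambda>i. of_real (e i)) * mat_adjoint U \<and>
     M = U * mat_diag (dim_row A) (\<lambda>i. of_real (f (e i))) * mat_adjoint U)"

text \<open>In \<open>\<rho> log \<rho>\<close> each eigenvalue x contributes \<open>x * log 2 x\<close>, which is 0 at x = 0, as usual.\<close>

definition entropy :: "complex mat \<Rightarrow> real" where
  "entropy \<rho> = - Re (mat_trace (\<rho> * herm_fun (log 2) \<rho>))"

text \<open>\<open>coherent_info x y \<rho>\<close> is \<open>I(X\<rangle>Y)\<close> for \<rho> on \<open>X \<otimes> Y\<close> with dimensions x and y.\<close>

definition coherent_info :: "nat \<Rightarrow> nat \<Rightarrow> complex mat \<Rightarrow> real" where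
  "coherent_info x y \<rho> = entropy (ptrace_left x y \<rho>) - entropy \<rho>"

definition linear_map :: "nat \<Rightarrow> nat \<Rightarrow> (complex mat \<Rightarrow> complex mat) \<Rightarrow> bool" where
  "linear_map a b N \<longleftrightarrow>
     (\<forall>X \<in> carrier_mat a a. N X \<in> carrier_mat b b) \<and>
     (\<forall>X \<in> carrier_mat a a. \<forall>Y \<in> carrier_mat a a. N (X + Y) = N X + N Y) \<and>
     (\<forall>c. \<forall>X \<in> carrier_mat a a. N (c \<cdot>\<^sub>m X) = c \<cdot>\<^sub>m N X)"

definition unit_mat :: "nat \<Rightarrow> nat \<Rightarrow> nat \<Rightarrow> complex mat" where
  "unit_mat n i j = mat n n (\<lambda>(p, q). if p = i \<and> q = j then 1 else 0)"

text \<open>The tensor product of linear maps \<open>N1\<close> (from a1 x a1 to b1 x b1 matrices) and \<open>N2\<close>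
  (from a2 x a2 to b2 x b2 matrices), obtained by expanding X in the basis
  \<open>E\<^sub>i\<^sub>j \<otimes> E\<^sub>k\<^sub>l\<close> and using \<open>(N1 \<otimes> N2)(E\<^sub>i\<^sub>j \<otimes> E\<^sub>k\<^sub>l) = N1 E\<^sub>i\<^sub>j \<otimes> N2 E\<^sub>k\<^sub>l\<close>;
  see \<open>tensor_map_kron\<close> below.\<close>

definition tensor_map ::
  "nat \<Rightarrow> nat \<Rightarrow> (complex mat \<Rightarrow> complex mat) \<Rightarrow>
   nat \<Rightarrow> nat \<Rightarrow> (complex mat \<Rightarrow> complex mat) \<Rightarrow> complex mat \<Rightarrow> complex mat" where
  "tensor_map a1 b1 N1 a2 b2 N2 X = mat (b1 * b2) (b1 * b2) (\<lambda>(p, q).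
     \<Sum>i<a1. \<Sum>j<a1. \<Sum>k<a2. \<Sum>l<a2. X $$ (i * a2 + k, j * a2 + l) *
       kron (N1 (unit_mat a1 i j)) (N2 (unit_mat a2 k l)) $$ (p, q))"

definition completely_positive :: "nat \<Rightarrow> nat \<Rightarrow> (complex mat \<Rightarrow> complex mat) \<Rightarrow> bool" where
  "completely_positive a b N \<longleftrightarrow>
     (\<forall>k X. psd (k * a) X \<longrightarrow> psd (k * b) (tensor_map k k id a b N X))"

definition trace_preserving :: "nat \<Rightarrow> (complex mat \<Rightarrow> complex mat) \<Rightarrow> bool" where
  "trace_preserving a N \<longleftrightarrow> (\<forall>X \<in> carrier_mat a a. mat_trace (N X) = mat_trace X)"

definition quantum_channel :: "nat \<Rightarrow> nat \<Rightarrow> (complex mat \<Rightarrow> complex mat) \<Rightarrow> bool" where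
  "quantum_channel a b N \<longleftrightarrow> 0 < a \<and> 0 < b \<and>
     linear_map a b N \<and> completely_positive a b N \<and> trace_preserving a N"

text \<open>The unitary on \<open>\<complex>\<^sup>d \<otimes> \<complex>\<^sup>d\<close> exchanging the two factors.\<close>

definition swap_mat :: "nat \<Rightarrow> complex mat" where
  "swap_mat d = mat (d * d) (d * d)
     (\<lambda>(i, j). if i div d = j mod d \<and> i mod d = j div d then 1 else 0)"

text \<open>\<open>sym_input a da d \<phi>\<close>: \<phi> is a pure state on \<open>A \<otimes> A~ \<otimes> \<top> \<otimes> \<bottom>\<close> (in this order),
  of dimensions a, da, d, d, invariant under exchanging \<open>\<top>\<close> and \<open>\<bottom>\<close>.\<close>

definition sym_input :: "nat \<Rightarrow> nat \<Rightarrow> nat \<Rightarrow> complex mat \<Rightarrow> bool" where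
  "sym_input a da d \<phi> \<longleftrightarrow> pure_state (a * da * (d * d)) \<phi> \<and>
     (let W = kron (1\<^sub>m (a * da)) (swap_mat d) in W * \<phi> * mat_adjoint W = \<phi>)"

text \<open>The state \<open>\<omega>\<close> on \<open>A \<otimes> B \<otimes> \<top> \<otimes> \<bottom>\<close>, with N applied to \<open>A~\<close>.\<close>

definition channel_output ::
  "nat \<Rightarrow> nat \<Rightarrow> nat \<Rightarrow> (complex mat \<Rightarrow> complex mat) \<Rightarrow> nat \<Rightarrow> complex mat \<Rightarrow> complex mat" where
  "channel_output a da db N d \<phi> =
     tensor_map (a * da) (a * db) (tensor_map a a id da db N) (d * d) (d * d) id \<phi>"

text \<open>The supremum is taken in the extended reals, where every set has its true supremum.\<close>

definition Q_ss :: "nat \<Rightarrow> nat \<Rightarrow> (complex mat \<Rightarrow> complex mat) \<Rightarrow> ereal" where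
  "Q_ss da db N = Sup {ereal (coherent_info a (db * d)
       (ptrace_right (a * db * d) d (channel_output a da db N d \<phi>))) | a d \<phi>.
     0 < a \<and> 0 < d \<and> sym_input a da d \<phi>}"

text \<open>The description in \<open>herm_fun\<close> determines the matrix uniquely (\<open>herm_fun_eq\<close>), and
  \<open>tensor_map\<close> acts as expected on product operators (\<open>tensor_map_kron\<close>).\<close>

lemma mat_adjoint_carrier [simp]: "A \<in> carrier_mat m n \<Longrightarrow> mat_adjoint A \<in> carrier_mat n m"
  unfolding mat_adjoint_def by auto

lemma herm_fun_unique:
  assumes U: "unitary_mat n U" and V: "unitary_mat n V"
    and eq: "U * mat_diag n (\<lambda>i. of_real (d i)) * mat_adjoint U =
             V * mat_diag n (\<lambda>i. of_real (e i)) * mat_adjoint V"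
  shows "U * mat_diag n (\<lambda>i. of_real (f (d i))) * mat_adjoint U =
         V * mat_diag n (\<lambda>i. of_real (f (e i))) * mat_adjoint V"
proof -
  let ?D = "\<lambda>g. mat_diag n (\<lambda>i. complex_of_real (g i))"
  let ?U = "mat_adjoint U" and ?V = "mat_adjoint V"
  define W where "W = ?V * U"
  have Uc [simp]: "U \<in> carrier_mat n n" "?U \<in> carrier_mat n n"
    and UU: "U * ?U = 1\<^sub>m n" "?U * U = 1\<^sub>m n"
    using U by (auto simp: unitary_mat_def)
  have Vc [simp]: "V \<in> carrier_mat n n" "?V \<in> carrier_mat n n"
    and VV: "V * ?V = 1\<^sub>m n" "?V * V = 1\<^sub>m n"
    using V by (auto simp: unitary_mat_def)
  have Dc [simp]: "?D g \<in> carrier_mat n n" for g by simp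
  have Wc [simp]: "W \<in> carrier_mat n n" unfolding W_def using Vc(2) Uc(1) by (rule mult_carrier_mat)
  note ac = assoc_mult_mat[where n\<^sub>1 = n and n\<^sub>2 = n and n\<^sub>3 = n and n\<^sub>4 = n] mult_carrier_mat[where nr = n and n = n and nc = n]
    left_mult_one_mat[where nr = n and nc = n] right_mult_one_mat[where nr = n and nc = n]
  have "W * ?D d = ?V * (U * ?D d * ?U) * U"
    by (simp add: W_def ac UU)
  also have "\<dots> = (?V * V) * (?D e * (?V * U))"
    unfolding eq by (simp add: ac)
  also have "\<dots> = ?D e * W" by (simp add: VV W_def[symmetric] ac)
  finally have comm: "W * ?D d = ?D e * W" .
  have entry: "W $$ (i, j) * of_real (f (d j)) = of_real (f (e i)) * W $$ (i, j)"
    if "i < n" "j < n" for i j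
  proof -
    have "(W * ?D d) $$ (i, j) = (?D e * W) $$ (i, j)" by (simp add: comm)
    then have "W $$ (i, j) * of_real (d j) = of_real (e i) * W $$ (i, j)"
      using that by (simp add: mat_diag_mult_left[of _ n n] mat_diag_mult_right[of _ n n])
    then show ?thesis by (cases "W $$ (i, j) = 0") auto
  qed
  have "W * ?D (\<lambda>i. f (d i)) = ?D (\<lambda>i. f (e i)) * W"
    by (rule eq_matI)
      (simp_all add: mat_diag_mult_left[of _ n n] mat_diag_mult_right[of _ n n] entry)
  then have "V * (W * ?D (\<lambda>i. f (d i))) * ?U = V * (?D (\<lambda>i. f (e i)) * W) * ?U" by simp
  moreover have "V * (W * ?D (\<lambda>i. f (d i))) * ?U = (V * ?V) * (U * (?D (\<lambda>i. f (d i)) * ?U))"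
    by (simp add: W_def ac)
  moreover have "V * (?D (\<lambda>i. f (e i)) * W) * ?U = V * ?D (\<lambda>i. f (e i)) * (?V * (U * ?U))"
    by (simp add: W_def ac)
  ultimately show ?thesis by (simp add: UU VV ac)
qed

lemma herm_fun_eq:
  assumes "unitary_mat n U"
  shows "herm_fun f (U * mat_diag n (\<lambda>i. of_real (e i)) * mat_adjoint U) =
    U * mat_diag n (\<lambda>i. of_real (f (e i))) * mat_adjoint U"
proof -
  have dim: "dim_row (U * mat_diag n (\<lambda>i. complex_of_real (e i)) * mat_adjoint U) = n"
    using assms by (auto simp: unitary_mat_def mat_adjoint_def)
  show ?thesis
    unfolding herm_fun_def dim
  proof (rule the_equality)
    show "\<exists>U' e'. unitary_mat n U' \<and>
       U * mat_diag n (\<lambda>i. complex_of_real (e i)) * mat_adjoint U =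
         U' * mat_diag n (\<lambda>i. complex_of_real (e' i)) * mat_adjoint U' \<and>
       U * mat_diag n (\<lambda>i. complex_of_real (f (e i))) * mat_adjoint U =
         U' * mat_diag n (\<lambda>i. complex_of_real (f (e' i))) * mat_adjoint U'"
      using assms by blast
  next
    fix M
    assume "\<exists>U' e'. unitary_mat n U' \<and>
       U * mat_diag n (\<lambda>i. complex_of_real (e i)) * mat_adjoint U =
         U' * mat_diag n (\<lambda>i. complex_of_real (e' i)) * mat_adjoint U' \<and>
       M = U' * mat_diag n (\<lambda>i. complex_of_real (f (e' i))) * mat_adjoint U'"
    then show "M = U * mat_diag n (\<lambda>i. complex_of_real (f (e i))) * mat_adjoint U"
      using herm_fun_unique[OF assms] by metis
  qed
qed

lemma linear_map_entry:
  assumes N: "linear_map a b N" and X: "X \<in> carrier_mat a a" and "p < b" "q < b"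
  shows "N X $$ (p, q) = (\<Sum>i<a. \<Sum>j<a. X $$ (i, j) * N (unit_mat a i j) $$ (p, q))"
proof -
  have Nc: "N Y \<in> carrier_mat b b" if "Y \<in> carrier_mat a a" for Y
    using N that by (auto simp: linear_map_def)
  have Na: "N (Y + Z) = N Y + N Z" if "Y \<in> carrier_mat a a" "Z \<in> carrier_mat a a" for Y Z
    using N that by (auto simp: linear_map_def)
  have Ns: "N (c \<cdot>\<^sub>m Y) = c \<cdot>\<^sub>m N Y" if "Y \<in> carrier_mat a a" for c Y
    using N that by (auto simp: linear_map_def)
  have uc [simp]: "unit_mat a i j \<in> carrier_mat a a" for i j
    by (simp add: unit_mat_def)
  define R where "R S = mat a a (\<lambda>ij. if ij \<in> S then X $$ ij else 0)" for S
  have R [simp]: "R S \<in> carrier_mat a a" for S by (simp add: R_def)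
  have main: "N (R S) $$ (p, q) =
      (\<Sum>(i, j)\<in>S. X $$ (i, j) * N (unit_mat a i j) $$ (p, q))" if "finite S" for S
    using that
  proof induction
    case empty
    have "R {} = 0 \<cdot>\<^sub>m R {}" by (rule eq_matI) (auto simp: R_def)
    then have "N (R {}) = 0 \<cdot>\<^sub>m N (R {})" using Ns[of "R {}" 0] by simp
    then have "N (R {}) $$ (p, q) = (0 \<cdot>\<^sub>m N (R {})) $$ (p, q)" by simp
    then show ?case using Nc[of "R {}"] assms by simp
  next
    case (insert x S)
    obtain i j where x: "x = (i, j)" by force
    have "R (insert x S) = X $$ (i, j) \<cdot>\<^sub>m unit_mat a i j + R S"
      using insert by (intro eq_matI) (auto simp: R_def unit_mat_def x)
    then have "N (R (insert x S)) = X $$ (i, j) \<cdot>\<^sub>m N (unit_mat a i j) + N (R S)"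
      by (simp add: Na Ns)
    then show ?case
      using insert Nc[of "R S"] Nc[of "unit_mat a i j"] assms by (simp add: x)
  qed
  have "X = R ({..<a} \<times> {..<a})" using X by (intro eq_matI) (auto simp: R_def)
  then show ?thesis using main[of "{..<a} \<times> {..<a}"] by (simp add: sum.cartesian_product)
qed

lemma tensor_map_kron:
  assumes N1: "linear_map a1 b1 N1" and N2: "linear_map a2 b2 N2"
    and X: "X \<in> carrier_mat a1 a1" and Y: "Y \<in> carrier_mat a2 a2"
  shows "tensor_map a1 b1 N1 a2 b2 N2 (kron X Y) = kron (N1 X) (N2 Y)"
proof -
  have d1: "dim_row (N1 Z) = b1" "dim_col (N1 Z) = b1" if "Z \<in> carrier_mat a1 a1" for Z
    using N1 that by (auto simp: linear_map_def)
  have d2: "dim_row (N2 Z) = b2" "dim_col (N2 Z) = b2" if "Z \<in> carrier_mat a2 a2" for Z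
    using N2 that by (auto simp: linear_map_def)
  have u: "unit_mat n i j \<in> carrier_mat n n" for n i j by (simp add: unit_mat_def)
  have lt: "i * n + k < m * n" if "i < m" "k < n" for i k m n :: nat
  proof -
    have "i * n + k < Suc i * n" using that by simp
    also have "\<dots> \<le> m * n" using that by (intro mult_le_mono1) simp
    finally show ?thesis .
  qed
  show ?thesis
  proof (rule eq_matI)
    fix p q
    assume "p < dim_row (kron (N1 X) (N2 Y))" "q < dim_col (kron (N1 X) (N2 Y))"
    then have pq: "p < b1 * b2" "q < b1 * b2" by (simp_all add: kron_def d1 d2 X Y)
    then have "0 < b2" by (cases b2) auto
    then have pq': "p div b2 < b1" "q div b2 < b1" "p mod b2 < b2" "q mod b2 < b2"
      using pq by (simp_all add: less_mult_imp_div_less)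
    have "tensor_map a1 b1 N1 a2 b2 N2 (kron X Y) $$ (p, q) =
      (\<Sum>i<a1. \<Sum>j<a1. \<Sum>k<a2. \<Sum>l<a2. (X $$ (i, j) * N1 (unit_mat a1 i j) $$ (p div b2, q div b2)) *
         (Y $$ (k, l) * N2 (unit_mat a2 k l) $$ (p mod b2, q mod b2)))"
      using X Y pq by (auto simp: tensor_map_def kron_def d1[OF u] d2[OF u] lt intro!: sum.cong)
    also have "\<dots> = N1 X $$ (p div b2, q div b2) * N2 Y $$ (p mod b2, q mod b2)"
      unfolding linear_map_entry[OF N1 X pq'(1,2)] linear_map_entry[OF N2 Y pq'(3,4)]
      by (simp only: sum_distrib_right) (simp only: sum_distrib_left)
    also have "\<dots> = kron (N1 X) (N2 Y) $$ (p, q)"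
      using pq by (simp add: kron_def d1[OF X] d2[OF Y])
    finally show "tensor_map a1 b1 N1 a2 b2 N2 (kron X Y) $$ (p, q) = kron (N1 X) (N2 Y) $$ (p, q)" .
  qed (simp_all add: tensor_map_def kron_def d1 d2 X Y)
qed

end

theory Submission
  imports Defs "Jordan_Normal_Form.Spectral_Radius"
begin

text \<open>
  Dilate the channel to an isometry into B and an environment E. For a swap-symmetric pure state,
  \<open>I(A\<rangle>B\<top>) = S(B\<top>) - S(E\<bottom>) = S(B\<top>) - S(E\<top>)\<close>. The symmetry constraint can then be dropped:
  \<open>Q_ss\<close> is the supremum, over all pure states on A, \<open>A~\<close>, S, T with arbitrary S and T, of
  \<open>\<onehalf> [S(BS) - S(ES) + S(BT) - S(ET)]\<close>, because the superposition of the state and its swapped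
  copy, taken in \<open>(S \<oplus> T) \<otimes> (S \<oplus> T)\<close>, is symmetric and attains this value. For two channels,
  this quantity splits exactly by \<open>S(B1 B2 S) - S(E1 E2 S) = [S(B1 B2 S) - S(E1 B2 S)] + [S(B2 E1 S) - S(E2 E1 S)]\<close>
  and its analogue for T: the first channel has the side systems \<open>B2 S\<close> and \<open>E2 T\<close>, the second
  \<open>E1 S\<close> and \<open>B1 T\<close>. No entropy inequality is needed. Product states give the converse bound.

  All entropies are those of reductions of one pure state, with systems indexed by arbitrary finite
  sets. They depend only on the power traces \<open>Tr \<rho>\<^sup>k\<close>, \<open>k > 0\<close>: if two families of eigenvalues have equal
  power sums, then they have equal sums of \<open>f\<close> for every \<open>f\<close> with \<open>f 0 = 0\<close>, by interpolating \<open>f\<close>.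
\<close>

section \<open>Spectra of kernels on finite sets\<close>

text \<open>The obstacle is that cutting a two-channel input into single-channel inputs destroys the
  swap symmetry: the side systems \<open>B2 S\<close> and \<open>E2 T\<close> need not even have
  equal dimension. Hence the constraint must be removed before the splitting and restored
  afterwards. The two side systems of one channel must together hold each output of the other
  channel exactly once; so if the telescoping for S passes through \<open>E1 B2 S\<close>, the one
  for T has to pass through \<open>B1 E2 T\<close>, and this fixes the assignment. Symmetrizing
  costs nothing: seen from one side, the superposition is a balanced mixture of two orthogonal
  branches, so its entropy is the mean of the two entropies plus one bit, and the bit cancels in the
  difference. Vectors are functions on products and disjoint sums of index sets, so that regrouping
  tensor factors is a bijection of sets. Power traces fit this setting because cyclicity, tensor
  products and direct sums act on them directly, without moving eigenvectors around.\<close>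

fun kpow :: "'x set \<Rightarrow> ('x \<Rightarrow> 'x \<Rightarrow> complex) \<Rightarrow> nat \<Rightarrow> 'x \<Rightarrow> 'x \<Rightarrow> complex" where
  "kpow X K 0 x y = (if x = y then 1 else 0)"
| "kpow X K (Suc n) x y = (\<Sum>z\<in>X. K x z * kpow X K n z y)"

definition ktrace :: "'x set \<Rightarrow> ('x \<Rightarrow> 'x \<Rightarrow> complex) \<Rightarrow> nat \<Rightarrow> complex" where
  "ktrace X K k = (\<Sum>x\<in>X. kpow X K k x x)"

lemma kpow_cong:
  assumes "\<And>x y. x \<in> X \<Longrightarrow> y \<in> X \<Longrightarrow> K x y = L x y" "x \<in> X" "y \<in> X"
  shows "kpow X K k x y = kpow X L k x y"
  using assms(2) by (induction k arbitrary: x) (auto simp: assms intro!: sum.cong)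

lemma ktrace_cong:
  assumes "\<And>x y. x \<in> X \<Longrightarrow> y \<in> X \<Longrightarrow> K x y = L x y"
  shows "ktrace X K k = ktrace X L k"
  unfolding ktrace_def by (intro sum.cong refl kpow_cong assms)

lemma kpow_reindex:
  assumes "bij_betw f X X'" "x \<in> X" "y \<in> X"
  shows "kpow X (\<lambda>x y. K (f x) (f y)) k x y = kpow X' K k (f x) (f y)"
  using assms(2)
proof (induction k arbitrary: x)
  case 0
  then show ?case using assms by (auto simp: bij_betw_def inj_on_def)
next
  case (Suc k)
  have "kpow X (\<lambda>x y. K (f x) (f y)) (Suc k) x y = (\<Sum>z\<in>X. K (f x) (f z) * kpow X' K k (f z) (f y))"
    using Suc by simp
  also have "\<dots> = (\<Sum>z\<in>X'. K (f x) z * kpow X' K k z (f y))"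
    using sum.reindex_bij_betw[OF assms(1), of "\<lambda>z. K (f x) z * kpow X' K k z (f y)"] .
  finally show ?case by simp
qed

lemma ktrace_reindex:
  assumes "bij_betw f X X'"
  shows "ktrace X (\<lambda>x y. K (f x) (f y)) k = ktrace X' K k"
proof -
  have "ktrace X (\<lambda>x y. K (f x) (f y)) k = (\<Sum>x\<in>X. kpow X' K k (f x) (f x))"
    unfolding ktrace_def by (intro sum.cong refl kpow_reindex[OF assms])
  then show ?thesis
    unfolding ktrace_def using sum.reindex_bij_betw[OF assms, of "\<lambda>x. kpow X' K k x x"] by simp
qed

lemma kpow_Suc_right:
  assumes "finite X" "x \<in> X" "y \<in> X"
  shows "kpow X K (Suc k) x y = (\<Sum>z\<in>X. kpow X K k x z * K z y)"
  using assms(2)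
proof (induction k arbitrary: x)
  case 0
  have "(\<Sum>z\<in>X. K x z * (if z = y then 1 else 0)) = (\<Sum>z\<in>X. if z = y then K x z else 0)"
    by (intro sum.cong) auto
  moreover have "(\<Sum>z\<in>X. (if x = z then 1 else 0) * K z y) = (\<Sum>z\<in>X. if x = z then K z y else 0)"
    by (intro sum.cong) auto
  ultimately show ?case using 0 assms by simp
next
  case (Suc k)
  have "kpow X K (Suc (Suc k)) x y = (\<Sum>w\<in>X. K x w * (\<Sum>z\<in>X. kpow X K k w z * K z y))"
    using Suc.IH by (simp only: kpow.simps(2)[of X K "Suc k"]) (auto intro!: sum.cong)
  also have "\<dots> = (\<Sum>z\<in>X. (\<Sum>w\<in>X. K x w * kpow X K k w z) * K z y)"
    unfolding sum_distrib_left sum_distrib_right by (subst sum.swap) (simp add: mult.assoc)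
  finally show ?case by simp
qed

lemma kpow_transpose:
  assumes "finite X" "x \<in> X" "y \<in> X"
  shows "kpow X (\<lambda>x y. K y x) k x y = kpow X K k y x"
  using assms(2)
proof (induction k arbitrary: x)
  case (Suc k)
  then show ?case
    using kpow_Suc_right[OF assms(1,3) Suc.prems, of K k] by (simp add: mult.commute)
qed auto

text \<open>Cyclicity of the trace for rectangular factors, resting on
  \<open>(M N)^(k+1) = M (N M)^k N\<close>. The case \<open>k = 0\<close> must be excluded, since it
  would compare the cardinalities of \<open>X\<close> and \<open>Y\<close>. This is what makes the
  two reductions of a pure state have the same nonzero spectrum.\<close>

lemma ktrace_commute:
  assumes "finite X" "finite Y" "k > 0"
  shows "ktrace X (\<lambda>x x'. \<Sum>y\<in>Y. M x y * N y x') k = ktrace Y (\<lambda>y y'. \<Sum>x\<in>X. N y x * M x y') k"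
proof -
  let ?K = "\<lambda>x x'. \<Sum>y\<in>Y. M x y * N y x'" and ?L = "\<lambda>y y'. \<Sum>x\<in>X. N y x * M x y'"
  have *: "kpow X ?K (Suc k) x x' = (\<Sum>y\<in>Y. \<Sum>y'\<in>Y. M x y * kpow Y ?L k y y' * N y' x')"
    if "x \<in> X" "x' \<in> X" for k x x'
    using that(1)
  proof (induction k arbitrary: x)
    case 0
    have "kpow X ?K (Suc 0) x x' = ?K x x'"
      using kpow_Suc_right[OF assms(1) 0 that(2), of ?K 0] 0 assms(1)
      by (simp add: if_distrib[of "\<lambda>c. c * _"] cong: if_cong)
    moreover have "(\<Sum>y\<in>Y. \<Sum>y'\<in>Y. M x y * kpow Y ?L 0 y y' * N y' x') =
        (\<Sum>y\<in>Y. \<Sum>y'\<in>Y. if y = y' then M x y * N y' x' else 0)"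
      by (intro sum.cong) auto
    ultimately show ?case using assms by simp
  next
    case (Suc k)
    have "kpow X ?K (Suc (Suc k)) x x' =
        (\<Sum>z\<in>X. (\<Sum>y\<in>Y. M x y * N y z) * (\<Sum>w\<in>Y. \<Sum>y'\<in>Y. M z w * kpow Y ?L k w y' * N y' x'))"
      using Suc.IH by (simp only: kpow.simps(2)[of X ?K "Suc k"]) (auto intro!: sum.cong)
    also have "\<dots> = (\<Sum>z\<in>X. \<Sum>y\<in>Y. \<Sum>w\<in>Y. \<Sum>y'\<in>Y. M x y * N y z * (M z w * kpow Y ?L k w y' * N y' x'))"
      by (simp only: sum_distrib_right) (simp only: sum_distrib_left)
    also have "\<dots> = (\<Sum>y\<in>Y. \<Sum>z\<in>X. \<Sum>w\<in>Y. \<Sum>y'\<in>Y. M x y * N y z * (M z w * kpow Y ?L k w y' * N y' x'))"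
      by (rule sum.swap)
    also have "\<dots> = (\<Sum>y\<in>Y. \<Sum>y'\<in>Y. \<Sum>w\<in>Y. \<Sum>z\<in>X. M x y * N y z * (M z w * kpow Y ?L k w y' * N y' x'))"
      by (intro sum.cong refl, subst sum.swap, subst (2) sum.swap, subst sum.swap) (rule refl)
    also have "\<dots> = (\<Sum>y\<in>Y. \<Sum>y'\<in>Y. M x y * kpow Y ?L (Suc k) y y' * N y' x')"
      by (simp add: sum_distrib_left sum_distrib_right mult_ac)
    finally show ?case .
  qed
  obtain j where k: "k = Suc j" using assms(3) by (cases k) auto
  have "ktrace X ?K k = (\<Sum>x\<in>X. \<Sum>y\<in>Y. \<Sum>y'\<in>Y. M x y * kpow Y ?L j y y' * N y' x)"
    unfolding ktrace_def k by (intro sum.cong refl *)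
  also have "\<dots> = (\<Sum>y\<in>Y. \<Sum>x\<in>X. \<Sum>y'\<in>Y. M x y * kpow Y ?L j y y' * N y' x)"
    by (rule sum.swap)
  also have "\<dots> = (\<Sum>y\<in>Y. \<Sum>y'\<in>Y. \<Sum>x\<in>X. M x y * kpow Y ?L j y y' * N y' x)"
    by (intro sum.cong refl sum.swap)
  also have "\<dots> = (\<Sum>y\<in>Y. \<Sum>y'\<in>Y. kpow Y ?L j y y' * ?L y' y)"
    by (simp add: sum_distrib_left sum_distrib_right mult_ac)
  also have "\<dots> = ktrace Y ?L k"
    unfolding ktrace_def k by (intro sum.cong refl kpow_Suc_right[symmetric] assms)
  finally show ?thesis .
qed

lemma ktrace_transpose:
  assumes "finite X"
  shows "ktrace X (\<lambda>x y. K y x) k = ktrace X K k"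
  unfolding ktrace_def by (intro sum.cong refl kpow_transpose assms)

lemma kpow_tensor:
  "kpow (X \<times> Y) (\<lambda>(x, y) (x', y'). K x x' * L y y') k (x, y) (x', y') = kpow X K k x x' * kpow Y L k y y'"
proof (induction k arbitrary: x y)
  case (Suc k)
  have "kpow (X \<times> Y) (\<lambda>(x, y) (x', y'). K x x' * L y y') (Suc k) (x, y) (x', y') =
     (\<Sum>(z, w)\<in>X \<times> Y. (K x z * kpow X K k z x') * (L y w * kpow Y L k w y'))"
    using Suc by (auto simp: mult_ac intro!: sum.cong)
  then show ?case by (simp add: sum_product sum.cartesian_product)
qed auto

lemma ktrace_tensor:
  "ktrace (X \<times> Y) (\<lambda>(x, y) (x', y'). K x x' * L y y') k = ktrace X K k * ktrace Y L k"
proof -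
  have "ktrace (X \<times> Y) (\<lambda>(x, y) (x', y'). K x x' * L y y') k =
     (\<Sum>(x, y)\<in>X \<times> Y. kpow X K k x x * kpow Y L k y y)"
    unfolding ktrace_def by (intro sum.cong refl) (auto simp only: kpow_tensor)
  then show ?thesis unfolding ktrace_def by (simp add: sum_product sum.cartesian_product)
qed

lemma kpow_scale: "kpow X (\<lambda>x y. c * K x y) k x y = c ^ k * kpow X K k x y"
  by (induction k arbitrary: x) (auto simp: sum_distrib_left mult_ac)

lemma ktrace_scale: "ktrace X (\<lambda>x y. c * K x y) k = c ^ k * ktrace X K k"
  unfolding ktrace_def by (simp add: kpow_scale sum_distrib_left)

lemma ktrace_direct_sum:
  assumes "finite X" "finite Y" and 0: "\<And>x y. K (Inl x) (Inr y) = 0" "\<And>x y. K (Inr y) (Inl x) = 0"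
  shows "ktrace (X <+> Y) K k =
    ktrace X (\<lambda>x x'. K (Inl x) (Inl x')) k + ktrace Y (\<lambda>y y'. K (Inr y) (Inr y')) k"
proof -
  have l: "kpow (X <+> Y) K k (Inl x) (Inl x') = kpow X (\<lambda>x x'. K (Inl x) (Inl x')) k x x'" for x x'
    by (induction k arbitrary: x) (auto simp: sum.Plus assms)
  have r: "kpow (X <+> Y) K k (Inr x) (Inr x') = kpow Y (\<lambda>x x'. K (Inr x) (Inr x')) k x x'" for x x'
    by (induction k arbitrary: x) (auto simp: sum.Plus assms)
  show ?thesis unfolding ktrace_def by (simp add: sum.Plus assms l r)
qed

section \<open>Spectral sums from power sums, and entropy of a kernel\<close>

lemma interpolation_exists:
  fixes f :: "'a::field \<Rightarrow> 'a"
  assumes "finite S"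
  shows "\<exists>p. \<forall>x\<in>S. poly p x = f x"
  using assms
proof induction
  case (insert a S)
  then obtain p where p: "\<forall>x\<in>S. poly p x = f x" by blast
  \<comment> \<open>Newton's step: \<open>q\<close> vanishes on the old nodes and not at
    \<open>a\<close>, so a multiple of it corrects the value at \<open>a\<close> alone.\<close>
  define q where "q = (\<Prod>x\<in>S. [:-x, 1:])"
  have q0: "poly q x = 0" if "x \<in> S" for x
    using that insert(1) by (auto simp: q_def poly_prod)
  have qa: "poly q a \<noteq> 0" using insert by (auto simp: q_def poly_prod)
  have "\<forall>x\<in>insert a S. poly (p + smult ((f a - poly p a) / poly q a) q) x = f x"
    using p q0 qa insert by auto
  then show ?case by blast
qed auto

text \<open>On the finitely many values that occur, \<open>f\<close> coincides with a polynomial,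
  and the sum of a polynomial over the family is a combination of power sums.\<close>

lemma power_sums_determine:
  fixes e :: "'i \<Rightarrow> real" and e' :: "'j \<Rightarrow> real"
  assumes "finite I" "finite J" "f 0 = (0::real)"
    and eq: "\<And>k. k > 0 \<Longrightarrow> (\<Sum>i\<in>I. e i ^ k) = (\<Sum>j\<in>J. e' j ^ k)"
  shows "(\<Sum>i\<in>I. f (e i)) = (\<Sum>j\<in>J. f (e' j))"
proof -
  \<comment> \<open>The extra node 0 forces \<open>p\<close> to have constant coefficient 0, so that
    the power sums for \<open>k = 0\<close>, which count the families, never enter.\<close>
  obtain p where p: "\<forall>x\<in>insert 0 (e ` I \<union> e' ` J). poly p x = f x"
    using interpolation_exists[of "insert 0 (e ` I \<union> e' ` J)" f] assms by auto
  have c0: "coeff p 0 = 0" using p assms by (auto simp: poly_0_coeff_0)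
  have *: "(\<Sum>i\<in>L. f (g i)) = (\<Sum>k\<le>degree p. coeff p k * (\<Sum>i\<in>L. g i ^ k))"
    if "g ` L \<subseteq> e ` I \<union> e' ` J" for L :: "'l set" and g
  proof -
    have "(\<Sum>i\<in>L. f (g i)) = (\<Sum>i\<in>L. poly p (g i))" using that p by (intro sum.cong) auto
    then show ?thesis unfolding poly_altdef sum_distrib_left by (subst sum.swap) simp
  qed
  have "coeff p k * (\<Sum>i\<in>I. e i ^ k) = coeff p k * (\<Sum>j\<in>J. e' j ^ k)" for k
    using c0 eq[of k] by (cases "k = 0") auto
  then have "(\<Sum>k\<le>degree p. coeff p k * (\<Sum>i\<in>I. e i ^ k)) = (\<Sum>k\<le>degree p. coeff p k * (\<Sum>j\<in>J. e' j ^ k))"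
    by (intro sum.cong refl)
  then show ?thesis using *[of e I] *[of e' J] by simp
qed

text \<open>Eigenvalues are recorded through power traces instead of a diagonalization. The index
  set \<open>I\<close> is independent of \<open>X\<close>, so products and disjoint sums of spectra
  can be used as they arise.\<close>

definition has_spectrum :: "'x set \<Rightarrow> ('x \<Rightarrow> 'x \<Rightarrow> complex) \<Rightarrow> 'i set \<Rightarrow> ('i \<Rightarrow> real) \<Rightarrow> bool" where
  "has_spectrum X K I e \<longleftrightarrow> (\<forall>k>0. ktrace X K k = of_real (\<Sum>i\<in>I. e i ^ k))"

definition eta :: "real \<Rightarrow> real" where "eta x = - (x * log 2 x)"

text \<open>Only powers \<open>k > 0\<close> enter, so eigenvalues 0 may be added or dropped freely.\<close>

definition kentropy :: "'x set \<Rightarrow> ('x \<Rightarrow> 'x \<Rightarrow> complex) \<Rightarrow> real" where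
  "kentropy X K = (THE s. \<exists>n::nat. \<exists>e. has_spectrum X K {..<n} e \<and> s = (\<Sum>i<n. eta (e i)))"

text \<open>Well-definedness of the description in \<open>kentropy\<close>: two lists of eigenvalues
  with the same power sums give the same sum of \<open>eta\<close>, by
  \<open>power_sums_determine\<close> and \<open>eta 0 = 0\<close>.\<close>

lemma kentropy_eq:
  assumes I: "finite I" and sp: "has_spectrum X K I e"
  shows "kentropy X K = (\<Sum>i\<in>I. eta (e i))"
proof -
  obtain g where g: "bij_betw g {..<card I} I"
    using ex_bij_betw_nat_finite[OF I] by (auto simp: atLeast0LessThan)
  show ?thesis unfolding kentropy_def
  proof (rule the_equality)
    have "has_spectrum X K {..<card I} (\<lambda>i. e (g i))"
      unfolding has_spectrum_def
    proof (intro allI impI)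
      fix k :: nat assume "k > 0"
      then show "ktrace X K k = of_real (\<Sum>i<card I. e (g i) ^ k)"
        using sp sum.reindex_bij_betw[OF g, of "\<lambda>i. e i ^ k"] unfolding has_spectrum_def by metis
    qed
    moreover have "(\<Sum>i\<in>I. eta (e i)) = (\<Sum>i<card I. eta (e (g i)))"
      using sum.reindex_bij_betw[OF g, of "\<lambda>i. eta (e i)"] by simp
    ultimately show "\<exists>n::nat. \<exists>e'. has_spectrum X K {..<n} e' \<and> (\<Sum>i\<in>I. eta (e i)) = (\<Sum>i<n. eta (e' i))"
      by (intro exI[of _ "card I"] exI[of _ "\<lambda>i. e (g i)"]) auto
  next
    fix s assume "\<exists>n e'. has_spectrum X K {..<n::nat} e' \<and> s = (\<Sum>i<n. eta (e' i))"
    then obtain n e' where e': "has_spectrum X K {..<n::nat} e'" "s = (\<Sum>i<n. eta (e' i))" by blast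
    have "(\<Sum>i\<in>{..<n}. eta (e' i)) = (\<Sum>i\<in>I. eta (e i))"
    proof (rule power_sums_determine[where f = eta and e = e' and e' = e, OF _ I])
      fix k :: nat assume "k > 0"
      then have "complex_of_real (\<Sum>i<n. e' i ^ k) = of_real (\<Sum>i\<in>I. e i ^ k)"
        using sp e'(1) unfolding has_spectrum_def by metis
      then show "(\<Sum>i<n. e' i ^ k) = (\<Sum>i\<in>I. e i ^ k)" by (simp only: of_real_eq_iff)
    qed (auto simp: eta_def)
    then show "s = (\<Sum>i\<in>I. eta (e i))" using e' by simp
  qed
qed

lemma kentropy_ktrace_cong:
  assumes "\<And>k. k > 0 \<Longrightarrow> ktrace X K k = ktrace Y L k"
  shows "kentropy X K = kentropy Y L"
  using assms unfolding kentropy_def has_spectrum_def by simp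

section \<open>Entropies of reductions of a pure state\<close>

text \<open>The reduced density operator on \<open>X\<close> of the vector \<open>\<Psi>\<close> in
  the tensor product of the spaces over \<open>X\<close> and \<open>Y\<close>.\<close>

definition marginal :: "'y set \<Rightarrow> ('x \<Rightarrow> 'y \<Rightarrow> complex) \<Rightarrow> 'x \<Rightarrow> 'x \<Rightarrow> complex" where
  "marginal Y \<Psi> x x' = (\<Sum>y\<in>Y. \<Psi> x y * cnj (\<Psi> x' y))"

definition ent :: "'x set \<Rightarrow> 'y set \<Rightarrow> ('x \<Rightarrow> 'y \<Rightarrow> complex) \<Rightarrow> real" where
  "ent X Y \<Psi> = kentropy X (marginal Y \<Psi>)"

lemma ent_cong_marginal:
  assumes "\<And>x x'. x \<in> X \<Longrightarrow> x' \<in> X \<Longrightarrow> marginal Y \<Psi> x x' = marginal Y' \<Psi>' x x'"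
  shows "ent X Y \<Psi> = ent X Y' \<Psi>'"
  unfolding ent_def by (intro kentropy_ktrace_cong ktrace_cong assms)

lemma marginal_reindex:
  assumes "bij_betw g Y Y'" "\<And>y. y \<in> Y \<Longrightarrow> \<Psi> x y = \<Psi>' z (g y)" "\<And>y. y \<in> Y \<Longrightarrow> \<Psi> x' y = \<Psi>' z' (g y)"
  shows "marginal Y \<Psi> x x' = marginal Y' \<Psi>' z z'"
  using sum.reindex_bij_betw[OF assms(1), of "\<lambda>y. \<Psi>' z y * cnj (\<Psi>' z' y)"] assms(2,3)
  by (simp add: marginal_def)

lemma ent_reindex:
  assumes "bij_betw f X X'" "bij_betw g Y Y'"
    and "\<And>x y. x \<in> X \<Longrightarrow> y \<in> Y \<Longrightarrow> \<Psi> x y = \<Psi>' (f x) (g y)"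
  shows "ent X Y \<Psi> = ent X' Y' \<Psi>'"
  unfolding ent_def
proof (rule kentropy_ktrace_cong)
  fix k
  have "ktrace X (marginal Y \<Psi>) k = ktrace X (\<lambda>x y. marginal Y' \<Psi>' (f x) (f y)) k"
    by (intro ktrace_cong marginal_reindex[OF assms(2)] assms(3))
  then show "ktrace X (marginal Y \<Psi>) k = ktrace X' (marginal Y' \<Psi>') k"
    using ktrace_reindex[OF assms(1)] by simp
qed

text \<open>Read \<open>\<Psi>\<close> as a matrix \<open>M\<close>: one reduction is
  \<open>M M*\<close>, the other is the transpose of \<open>M* M\<close>. Cyclicity and invariance
  under transposition identify their power traces, which replaces the Schmidt decomposition.\<close>

lemma ent_swap:
  assumes "finite X" "finite Y"
  shows "ent X Y \<Psi> = ent Y X (\<lambda>y x. \<Psi> x y)"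
  unfolding ent_def
proof (rule kentropy_ktrace_cong)
  fix k :: nat assume "k > 0"
  have "ktrace X (marginal Y \<Psi>) k = ktrace Y (\<lambda>y y'. \<Sum>x\<in>X. cnj (\<Psi> x y) * \<Psi> x y') k"
    unfolding marginal_def using ktrace_commute[OF assms \<open>k > 0\<close>, of \<Psi> "\<lambda>y x. cnj (\<Psi> x y)"] .
  also have "\<dots> = ktrace Y (\<lambda>y y'. marginal X (\<lambda>y x. \<Psi> x y) y' y) k"
    unfolding marginal_def by (simp add: mult.commute)
  also have "\<dots> = ktrace Y (marginal X (\<lambda>y x. \<Psi> x y)) k" by (rule ktrace_transpose[OF assms(2)])
  finally show "ktrace X (marginal Y \<Psi>) k = ktrace Y (marginal X (\<lambda>y x. \<Psi> x y)) k" .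
qed

section \<open>The spectral theorem\<close>

lemma mat_adjoint_index [simp]:
  assumes "i < dim_col A" "j < dim_row A"
  shows "mat_adjoint A $$ (i, j) = cnj (A $$ (j, i))"
  using assms by (simp add: mat_adjoint_def mat_of_rows_def)

lemma mat_adjoint_dim [simp]:
  "dim_row (mat_adjoint A) = dim_col A" "dim_col (mat_adjoint A) = dim_row A"
  by (simp_all add: mat_adjoint_def)

definition orthonormal_cols :: "nat \<Rightarrow> (nat \<Rightarrow> nat \<Rightarrow> complex) \<Rightarrow> bool" where
  "orthonormal_cols n U \<longleftrightarrow>
     (\<forall>j<n. \<forall>k<n. (\<Sum>i<n. cnj (U i j) * U i k) = (if j = k then 1 else 0))"

lemma unitary_mat_orthonormal_cols:
  assumes "orthonormal_cols n U"
  shows "unitary_mat n (mat n n (\<lambda>(i, j). U i j))" (is "unitary_mat n ?U")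
proof -
  have "mat_adjoint ?U * ?U = 1\<^sub>m n"
    using assms by (intro eq_matI) (auto simp: orthonormal_cols_def scalar_prod_def atLeast0LessThan)
  moreover from this have "?U * mat_adjoint ?U = 1\<^sub>m n"
    by (rule mat_mult_left_right_inverse[rotated 2]) auto
  ultimately show ?thesis by (auto simp: unitary_mat_def)
qed

lemma orthonormal_rows:
  assumes "orthonormal_cols n U" "x < n" "y < n"
  shows "(\<Sum>j<n. U x j * cnj (U y j)) = (if x = y then 1 else 0)"
proof -
  let ?U = "mat n n (\<lambda>(i, j). U i j)"
  have "(\<Sum>j<n. U x j * cnj (U y j)) = (?U * mat_adjoint ?U) $$ (x, y)"
    using assms by (auto simp: scalar_prod_def atLeast0LessThan)
  also have "?U * mat_adjoint ?U = 1\<^sub>m n"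
    using unitary_mat_orthonormal_cols[OF assms(1)] by (simp only: unitary_mat_def)
  finally show ?thesis using assms by simp
qed

text \<open>Completes an eigenvector to a unitary matrix, for the deflation step of the spectral
  theorem. Gram-Schmidt delivers orthogonal columns only, so each is divided by its length; this is
  where the factor \<open>c\<close> comes from.\<close>

lemma orthonormal_completion:
  assumes v: "v \<in> carrier_vec n" "v \<noteq> 0\<^sub>v n"
  shows "\<exists>W c. orthonormal_cols n W \<and> c \<noteq> 0 \<and> (\<forall>i<n. W i 0 = c * v $ i)"
proof -
  interpret cof_vec_space n "TYPE(complex)" .
  define b where "b = basis_completion v"
  define ws where "ws = gram_schmidt n b"
  from basis_completion[OF v, folded b_def]
  have dist_b: "distinct b" and indep: "\<not> lin_dep (set b)" and b: "set b \<subseteq> carrier_vec n"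
    and hdb: "hd b = v" and len_b: "length b = n" by auto
  have "n \<noteq> 0" using v by (metis carrier_vecD eq_vecI index_zero_vec(2) less_nat_zero_code)
  then obtain vs where bv: "b = v # vs" using hdb len_b by (cases b) auto
  from gram_schmidt_result[OF b dist_b indep refl, folded ws_def]
  have ws: "set ws \<subseteq> carrier_vec n" "corthogonal ws" "length ws = n" by (auto simp: len_b)
  have hdws: "ws ! 0 = v"
    using gram_schmidt_hd[OF v(1), of vs, folded bv] \<open>n \<noteq> 0\<close> ws(3) unfolding ws_def
    by (metis hd_conv_nth list.size(3))
  have wc: "ws ! j \<in> carrier_vec n" if "j < n" for j using ws that by auto
  define N where "N j = (\<Sum>i<n. (cmod (ws ! j $ i))\<^sup>2)" for j
  define W where "W i j = of_real (1 / sqrt (N j)) * ws ! j $ i" for i j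
  have ip: "(\<Sum>i<n. cnj (ws ! j $ i) * ws ! k $ i) = ws ! k \<bullet>c ws ! j" if "j < n" "k < n" for j k
    using wc[OF that(1)] wc[OF that(2)] by (simp add: scalar_prod_def atLeast0LessThan mult.commute)
  have NN: "ws ! j \<bullet>c ws ! j = of_real (N j)" if "j < n" for j
    unfolding ip[OF that that, symmetric] N_def
    by (simp only: of_real_sum complex_norm_square) (simp add: mult.commute)
  have Npos: "N j > 0" if "j < n" for j
  proof -
    have "ws ! j \<bullet>c ws ! j \<noteq> 0" using corthogonalD[OF ws(2), of j j] ws(3) that by auto
    then have "N j \<noteq> 0" unfolding NN[OF that] by simp
    moreover have "N j \<ge> 0" unfolding N_def by (intro sum_nonneg) auto
    ultimately show ?thesis by simp
  qed
  have "orthonormal_cols n W" unfolding orthonormal_cols_def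
  proof (intro allI impI)
    fix j k assume jk: "j < n" "k < n"
    have "(\<Sum>i<n. cnj (W i j) * W i k) =
        of_real (1 / sqrt (N j)) * of_real (1 / sqrt (N k)) * (\<Sum>i<n. cnj (ws ! j $ i) * ws ! k $ i)"
      unfolding W_def sum_distrib_left by (intro sum.cong) auto
    also have "\<dots> = of_real (1 / sqrt (N j)) * of_real (1 / sqrt (N k)) * (ws ! k \<bullet>c ws ! j)"
      using ip[OF jk] by simp
    also have "\<dots> = (if j = k then 1 else 0)"
    proof (cases "j = k")
      case True
      have "(1 / sqrt (N j)) * (1 / sqrt (N j)) * N j = 1" using Npos[OF jk(1)] by (simp add: field_simps)
      then show ?thesis using True NN[OF jk(1)] by (simp only: of_real_mult[symmetric]) simp
    next
      case False
      then show ?thesis using corthogonalD[OF ws(2), of k j] jk ws(3) by auto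
    qed
    finally show "(\<Sum>i<n. cnj (W i j) * W i k) = (if j = k then 1 else 0)" .
  qed
  moreover have "complex_of_real (1 / sqrt (N 0)) \<noteq> 0" using Npos[of 0] \<open>n \<noteq> 0\<close> by simp
  moreover have "\<forall>i<n. W i 0 = of_real (1 / sqrt (N 0)) * v $ i" by (simp add: W_def hdws)
  ultimately show ?thesis by blast
qed

text \<open>Induction on the dimension by deflation: in a basis that starts with an eigenvector, a
  Hermitian matrix splits into a 1 x 1 block and a Hermitian block of size \<open>n\<close>.\<close>

lemma hermitian_spectral:
  fixes A :: "nat \<Rightarrow> nat \<Rightarrow> complex"
  assumes "\<And>x y. x < n \<Longrightarrow> y < n \<Longrightarrow> A y x = cnj (A x y)"
  shows "\<exists>U e. orthonormal_cols n U \<and>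
    (\<forall>x<n. \<forall>y<n. A x y = (\<Sum>j<n. of_real (e j) * U x j * cnj (U y j)))"
  using assms
proof (induction n arbitrary: A)
  case 0
  then show ?case by (auto simp: orthonormal_cols_def)
next
  case (Suc n)
  let ?N = "Suc n"
  define M where "M = mat ?N ?N (\<lambda>(x, y). A x y)"
  have M: "M \<in> carrier_mat ?N ?N" by (simp add: M_def)
  obtain l where "l \<in> spectrum M" using spectrum_non_empty[OF M] by auto
  then obtain v where v: "v \<in> carrier_vec ?N" "v \<noteq> 0\<^sub>v ?N" "M *\<^sub>v v = l \<cdot>\<^sub>v v"
    using M by (auto simp: spectrum_def eigenvalue_def eigenvector_def)
  obtain W c where W: "orthonormal_cols ?N W" and c: "c \<noteq> 0" "\<forall>i<?N. W i 0 = c * v $ i"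
    using orthonormal_completion[OF v(1,2)] by blast
  have Wc: "(\<Sum>x<?N. cnj (W x i) * W x j) = (if i = j then 1 else 0)" if "i < ?N" "j < ?N" for i j
    using W that by (simp add: orthonormal_cols_def)
  note Wr = orthonormal_rows[OF W]
  have eig: "(\<Sum>y<?N. A x y * W y 0) = l * W x 0" if x: "x < ?N" for x
  proof -
    have "(\<Sum>y<?N. A x y * v $ y) = (M *\<^sub>v v) $ x"
      using x v(1) by (simp add: M_def scalar_prod_def atLeast0LessThan)
    then have "(\<Sum>y<?N. A x y * v $ y) = l * v $ x" using v x by simp
    then have "c * (\<Sum>y<?N. A x y * v $ y) = c * (l * v $ x)" by simp
    then show ?thesis using c x by (simp add: sum_distrib_left mult_ac del: sum.lessThan_Suc)
  qed
  \<comment> \<open>\<open>B = W* A W\<close>; its first column is \<open>l\<close> times the first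
    basis vector because column 0 of \<open>W\<close> is an eigenvector.\<close>
  define B where "B i j = (\<Sum>x<?N. \<Sum>y<?N. cnj (W x i) * A x y * W y j)" for i j
  have Bh: "B j i = cnj (B i j)" for i j
  proof -
    have "cnj (B i j) = (\<Sum>x<?N. \<Sum>y<?N. cnj (W y j) * A y x * W x i)"
      unfolding B_def cnj_sum
      by (intro sum.cong refl) (simp add: Suc.prems[symmetric] mult_ac del: sum.lessThan_Suc)
    then show ?thesis unfolding B_def by (subst sum.swap) (rule sym)
  qed
  have B0: "B i 0 = (if i = 0 then l else 0)" if "i < ?N" for i
  proof -
    have "B i 0 = (\<Sum>x<?N. cnj (W x i) * (\<Sum>y<?N. A x y * W y 0))"
      unfolding B_def by (simp only: sum_distrib_left mult.assoc)
    also have "\<dots> = (\<Sum>x<?N. cnj (W x i) * (l * W x 0))"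
      by (intro sum.cong refl arg_cong2[where f = "(*)"] eig) auto
    also have "\<dots> = l * (\<Sum>x<?N. cnj (W x i) * W x 0)" by (simp add: sum_distrib_left mult_ac del: sum.lessThan_Suc)
    finally show ?thesis using Wc[OF that, of 0] by simp
  qed
  \<comment> \<open>Hermiticity carries the zeros of the first column over to the first row, so the
    induction hypothesis may be applied to the remaining block.\<close>
  have B0': "B 0 i = (if i = 0 then l else 0)" if "i < ?N" for i
    using Bh[of 0 i] Bh[of 0 0] B0[OF that] B0[of 0] by auto
  have l: "l = of_real (Re l)" using Bh[of 0 0] B0[of 0] by (auto simp: complex_eq_iff)
  obtain U e where U: "orthonormal_cols n U"
    and e: "\<And>i j. i < n \<Longrightarrow> j < n \<Longrightarrow> B (Suc i) (Suc j) = (\<Sum>k<n. of_real (e k) * U i k * cnj (U j k))"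
    using Suc.IH[of "\<lambda>i j. B (Suc i) (Suc j)"] Bh by blast
  have AB: "A x y = (\<Sum>i<?N. \<Sum>j<?N. W x i * B i j * cnj (W y j))" if xy: "x < ?N" "y < ?N" for x y
  proof -
    have "(\<Sum>i<?N. \<Sum>j<?N. W x i * B i j * cnj (W y j)) =
        (\<Sum>i<?N. \<Sum>j<?N. \<Sum>x'<?N. \<Sum>y'<?N. W x i * cnj (W x' i) * (A x' y' * (W y' j * cnj (W y j))))"
      unfolding B_def by (simp only: sum_distrib_left sum_distrib_right mult_ac)
    also have "\<dots> = (\<Sum>i<?N. \<Sum>x'<?N. \<Sum>j<?N. \<Sum>y'<?N. W x i * cnj (W x' i) * (A x' y' * (W y' j * cnj (W y j))))"
      by (intro sum.cong refl sum.swap)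
    also have "\<dots> = (\<Sum>x'<?N. \<Sum>i<?N. \<Sum>j<?N. \<Sum>y'<?N. W x i * cnj (W x' i) * (A x' y' * (W y' j * cnj (W y j))))"
      by (rule sum.swap)
    also have "\<dots> = (\<Sum>x'<?N. \<Sum>i<?N. \<Sum>y'<?N. \<Sum>j<?N. W x i * cnj (W x' i) * (A x' y' * (W y' j * cnj (W y j))))"
      by (intro sum.cong refl sum.swap)
    also have "\<dots> = (\<Sum>x'<?N. (\<Sum>i<?N. W x i * cnj (W x' i)) * (\<Sum>y'<?N. A x' y' * (\<Sum>j<?N. W y' j * cnj (W y j))))"
      by (simp only: sum_distrib_right) (simp only: sum_distrib_left)
    also have "\<dots> = (\<Sum>x'<?N. (if x = x' then 1 else 0) * (\<Sum>y'<?N. A x' y' * (if y' = y then 1 else 0)))"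
      using xy by (intro sum.cong refl arg_cong2[where f = "(*)"]) (auto simp: Wr simp del: sum.lessThan_Suc)
    also have "\<dots> = (\<Sum>x'<?N. if x = x' then \<Sum>y'<?N. if y' = y then A x' y' else 0 else 0)"
      by (intro sum.cong refl) (auto simp: if_distrib[of "\<lambda>c. _ * c"] simp del: sum.lessThan_Suc cong: if_cong)
    also have "\<dots> = A x y" using xy by (simp del: sum.lessThan_Suc)
    finally show ?thesis by (rule sym)
  qed
  \<comment> \<open>\<open>V\<close> is \<open>W\<close> times the block matrix with blocks 1 and
    \<open>U\<close>: the eigenvector is kept and the rest of the basis is rotated by the unitary of
    the smaller problem.\<close>
  define V where "V x k = (case k of 0 \<Rightarrow> W x 0 | Suc k \<Rightarrow> \<Sum>i<n. W x (Suc i) * U i k)" for x k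
  define f where "f k = (case k of 0 \<Rightarrow> Re l | Suc k \<Rightarrow> e k)" for k
  have V0: "(\<Sum>x<?N. cnj (V x 0) * V x (Suc k)) = 0" for k
  proof -
    have "(\<Sum>x<?N. cnj (V x 0) * V x (Suc k)) = (\<Sum>i<n. (\<Sum>x<?N. cnj (W x 0) * W x (Suc i)) * U i k)"
      unfolding V_def by (simp only: nat.case sum_distrib_left sum_distrib_right, subst sum.swap) (simp only: mult.assoc)
    also have "\<dots> = 0" by (intro sum.neutral) (simp add: Wc del: sum.lessThan_Suc)
    finally show ?thesis .
  qed
  have VS: "(\<Sum>x<?N. cnj (V x (Suc j)) * V x (Suc k)) = (if j = k then 1 else 0)" if "j < n" "k < n" for j k
  proof -
    have "(\<Sum>x<?N. cnj (V x (Suc j)) * V x (Suc k)) =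
       (\<Sum>x<?N. \<Sum>i<n. \<Sum>i'<n. cnj (U i j) * (cnj (W x (Suc i)) * W x (Suc i')) * U i' k)"
      unfolding V_def by (simp only: nat.case sum_distrib_left sum_distrib_right cnj_sum complex_cnj_mult, subst (2) sum.swap)
        (simp only: mult_ac)
    also have "\<dots> = (\<Sum>i<n. \<Sum>x<?N. \<Sum>i'<n. cnj (U i j) * (cnj (W x (Suc i)) * W x (Suc i')) * U i' k)"
      by (rule sum.swap)
    also have "\<dots> = (\<Sum>i<n. \<Sum>i'<n. \<Sum>x<?N. cnj (U i j) * (cnj (W x (Suc i)) * W x (Suc i')) * U i' k)"
      by (intro sum.cong refl sum.swap)
    also have "\<dots> = (\<Sum>i<n. \<Sum>i'<n. cnj (U i j) * (\<Sum>x<?N. cnj (W x (Suc i)) * W x (Suc i')) * U i' k)"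
      by (simp only: sum_distrib_left sum_distrib_right)
    also have "\<dots> = (\<Sum>i<n. \<Sum>i'<n. if i = i' then cnj (U i j) * U i' k else 0)"
      by (intro sum.cong refl) (auto simp: Wc simp del: sum.lessThan_Suc)
    also have "\<dots> = (if j = k then 1 else 0)" using U that by (simp add: orthonormal_cols_def)
    finally show ?thesis .
  qed
  have "orthonormal_cols ?N V" unfolding orthonormal_cols_def
  proof (intro allI impI)
    fix j k assume jk: "j < ?N" "k < ?N"
    have V0': "(\<Sum>x<?N. cnj (V x (Suc k)) * V x 0) = 0" for k
      using arg_cong[OF V0[of k], of cnj] by (simp only: cnj_sum complex_cnj_mult complex_cnj_cnj mult.commute complex_cnj_zero)
    have V00: "(\<Sum>x<?N. cnj (V x 0) * V x 0) = 1" using Wc[of 0 0] by (simp add: V_def del: sum.lessThan_Suc)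
    show "(\<Sum>x<?N. cnj (V x j) * V x k) = (if j = k then 1 else 0)"
    proof (cases j)
      case 0
      then show ?thesis using V0 V00 by (cases k) (simp_all del: sum.lessThan_Suc)
    next
      case (Suc j')
      then show ?thesis using V0' VS jk by (cases k) (simp_all del: sum.lessThan_Suc)
    qed
  qed
  moreover have "A x y = (\<Sum>j<?N. of_real (f j) * V x j * cnj (V y j))" if xy: "x < ?N" "y < ?N" for x y
  proof -
    have row0: "(\<Sum>j<?N. W x 0 * B 0 j * cnj (W y j)) = l * W x 0 * cnj (W y 0)"
      by (simp add: sum.lessThan_Suc_shift B0' del: sum.lessThan_Suc)
    have "A x y = l * W x 0 * cnj (W y 0) + (\<Sum>i<n. \<Sum>j<n. W x (Suc i) * B (Suc i) (Suc j) * cnj (W y (Suc j)))"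
      unfolding AB[OF xy] by (subst sum.lessThan_Suc_shift) (simp only: row0, simp add: sum.lessThan_Suc_shift B0 del: sum.lessThan_Suc)
    also have "(\<Sum>i<n. \<Sum>j<n. W x (Suc i) * B (Suc i) (Suc j) * cnj (W y (Suc j))) =
        (\<Sum>i<n. \<Sum>j<n. \<Sum>k<n. of_real (e k) * (W x (Suc i) * U i k) * (cnj (W y (Suc j)) * cnj (U j k)))"
      by (intro sum.cong refl) (simp add: e sum_distrib_left sum_distrib_right mult_ac)
    also have "\<dots> = (\<Sum>i<n. \<Sum>k<n. \<Sum>j<n. of_real (e k) * (W x (Suc i) * U i k) * (cnj (W y (Suc j)) * cnj (U j k)))"
      by (intro sum.cong refl sum.swap)
    also have "\<dots> = (\<Sum>k<n. \<Sum>i<n. \<Sum>j<n. of_real (e k) * (W x (Suc i) * U i k) * (cnj (W y (Suc j)) * cnj (U j k)))"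
      by (rule sum.swap)
    also have "\<dots> = (\<Sum>k<n. of_real (e k) * (V x (Suc k) * cnj (V y (Suc k))))"
      unfolding V_def by (simp only: nat.case cnj_sum complex_cnj_mult sum_distrib_right)
        (simp only: sum_distrib_left mult.assoc)
    also have "l * W x 0 * cnj (W y 0) = of_real (f 0) * V x 0 * cnj (V y 0)"
      using l by (simp add: f_def V_def)
    finally show ?thesis by (subst sum.lessThan_Suc_shift) (simp add: f_def mult.assoc)
  qed
  ultimately show ?case by blast
qed

lemma psd_quadratic_form:
  assumes "psd n A"
  shows "0 \<le> (\<Sum>x<n. \<Sum>y<n. cnj (v x) * A $$ (x, y) * v y)"
proof -
  have A: "A \<in> carrier_mat n n" using assms by (simp add: psd_def)
  have "(A *\<^sub>v vec n v) \<bullet>c vec n v = (\<Sum>x<n. (\<Sum>y<n. A $$ (x, y) * v y) * cnj (v x))"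
    using A by (simp add: scalar_prod_def atLeast0LessThan)
  also have "\<dots> = (\<Sum>x<n. \<Sum>y<n. cnj (v x) * A $$ (x, y) * v y)"
    by (simp add: sum_distrib_left sum_distrib_right mult_ac)
  finally show ?thesis using assms unfolding psd_def by (metis vec_carrier)
qed

text \<open>Polarization: a quadratic form with real values only comes from a Hermitian
  matrix.\<close>

lemma psd_hermitian:
  assumes A: "psd n A" and ij: "i < n" "j < n"
  shows "A $$ (j, i) = cnj (A $$ (i, j))"
proof -
  have d: "Im (A $$ (k, k)) = 0" if "k < n" for k
  proof -
    have "(\<Sum>x<n. \<Sum>y<n. cnj (if x = k then 1 else 0) * A $$ (x, y) * (if y = k then 1 else 0)) =
        (\<Sum>x<n. if x = k then (\<Sum>y<n. if y = k then A $$ (x, y) else 0) else 0)"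
      by (intro sum.cong) (auto simp: if_distrib[of "\<lambda>c. _ * c"] cong: if_cong)
    then show ?thesis using psd_quadratic_form[OF A, of "\<lambda>x. if x = k then 1 else 0"] that
      by (simp add: less_eq_complex_def)
  qed
  show ?thesis
  proof (cases "i = j")
    case True
    then show ?thesis using d[OF ij(1)] by (simp add: complex_eq_iff)
  next
  case False
  \<comment> \<open>Tested on \<open>e_i + c e_j\<close>. With \<open>c = 1\<close> the imaginary
    parts of the two off-diagonal entries are opposite, with \<open>c = \<i>\<close> their real
    parts agree.\<close>
  have q: "Im (A $$ (i, i) + c * A $$ (i, j) + cnj c * A $$ (j, i) + cnj c * c * A $$ (j, j)) = 0" for c
  proof -
    let ?v = "\<lambda>x. if x = i then 1 else if x = j then c else 0"
    have s: "(\<Sum>x<n. f x * ?v x) = f i + f j * c" for f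
    proof -
      have "(\<Sum>x<n. f x * ?v x) = (\<Sum>x<n. (if x = i then f x else 0) + (if x = j then f x * c else 0))"
        using False by (intro sum.cong) auto
      then show ?thesis using ij by (simp add: sum.distrib)
    qed
    have s': "(\<Sum>x<n. cnj (?v x) * f x) = f i + cnj c * f j" for f
    proof -
      have "(\<Sum>x<n. cnj (?v x) * f x) = (\<Sum>x<n. (if x = i then f x else 0) + (if x = j then cnj c * f x else 0))"
        using False by (intro sum.cong) auto
      then show ?thesis using ij by (simp add: sum.distrib)
    qed
    have "(\<Sum>x<n. \<Sum>y<n. cnj (?v x) * A $$ (x, y) * ?v y) = (\<Sum>x<n. cnj (?v x) * (\<Sum>y<n. A $$ (x, y) * ?v y))"
      by (simp only: sum_distrib_left mult.assoc)
    also have "\<dots> = (A $$ (i, i) + A $$ (i, j) * c) + cnj c * (A $$ (j, i) + A $$ (j, j) * c)"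
      unfolding s s' ..
    finally show ?thesis using psd_quadratic_form[OF A, of ?v]
      by (simp add: less_eq_complex_def algebra_simps)
  qed
  show ?thesis using q[of 1] q[of \<i>] d[OF ij(1)] d[OF ij(2)] by (simp add: complex_eq_iff)
  qed
qed

lemma psd_spectral:
  assumes A: "psd n A"
  shows "\<exists>U e. orthonormal_cols n U \<and> (\<forall>j<n. 0 \<le> e j) \<and>
    (\<forall>x<n. \<forall>y<n. A $$ (x, y) = (\<Sum>j<n. of_real (e j) * U x j * cnj (U y j)))"
proof -
  obtain U e where U: "orthonormal_cols n U"
    and eq: "\<forall>x<n. \<forall>y<n. A $$ (x, y) = (\<Sum>j<n. of_real (e j) * U x j * cnj (U y j))"
    using hermitian_spectral[of n "\<lambda>x y. A $$ (x, y)"] psd_hermitian[OF A] by blast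
  \<comment> \<open>The quadratic form evaluated at the k-th eigenvector is the eigenvalue
    itself.\<close>
  have "0 \<le> e k" if k: "k < n" for k
  proof -
    have c: "(\<Sum>x<n. cnj (U x i) * U x j) = (if i = j then 1 else 0)" if "i < n" "j < n" for i j
      using U that by (simp add: orthonormal_cols_def)
    have "(\<Sum>x<n. \<Sum>y<n. cnj (U x k) * A $$ (x, y) * U y k) =
        (\<Sum>x<n. \<Sum>y<n. \<Sum>j<n. of_real (e j) * ((cnj (U x k) * U x j) * (cnj (U y j) * U y k)))"
      by (intro sum.cong refl) (simp add: eq sum_distrib_left sum_distrib_right mult_ac)
    also have "\<dots> = (\<Sum>x<n. \<Sum>j<n. \<Sum>y<n. of_real (e j) * ((cnj (U x k) * U x j) * (cnj (U y j) * U y k)))"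
      by (intro sum.cong refl sum.swap)
    also have "\<dots> = (\<Sum>j<n. \<Sum>x<n. \<Sum>y<n. of_real (e j) * ((cnj (U x k) * U x j) * (cnj (U y j) * U y k)))"
      by (rule sum.swap)
    also have "\<dots> = (\<Sum>j<n. of_real (e j) * ((\<Sum>x<n. cnj (U x k) * U x j) * (\<Sum>y<n. cnj (U y j) * U y k)))"
      by (simp only: sum_distrib_right) (simp only: sum_distrib_left)
    also have "\<dots> = (\<Sum>j<n. if j = k then of_real (e j) else 0)"
      using k by (intro sum.cong refl) (auto simp: c)
    also have "\<dots> = of_real (e k)" using k by simp
    finally show ?thesis using psd_quadratic_form[OF A, of "\<lambda>x. U x k"] by (simp add: less_eq_complex_def)
  qed
  then show ?thesis using U eq by blast
qed

section \<open>Entropy as a function of the spectrum\<close>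

lemma ktrace_spectral:
  assumes U: "orthonormal_cols n U"
    and A: "\<And>x y. x < n \<Longrightarrow> y < n \<Longrightarrow> A x y = (\<Sum>j<n. of_real (e j) * U x j * cnj (U y j))"
  shows "ktrace {..<n} A k = of_real (\<Sum>j<n. e j ^ k)"
proof -
  have c: "(\<Sum>x<n. cnj (U x i) * U x j) = (if i = j then 1 else 0)" if "i < n" "j < n" for i j
    using U that by (simp add: orthonormal_cols_def)
  have *: "kpow {..<n} A k x y = (\<Sum>j<n. of_real (e j ^ k) * (U x j * cnj (U y j)))" if "x < n" "y < n" for x y
    using that(1)
  proof (induction k arbitrary: x)
    case 0
    then show ?case using orthonormal_rows[OF U _ that(2)] by simp
  next
    case (Suc k)
    have "kpow {..<n} A (Suc k) x y =
        (\<Sum>z<n. (\<Sum>j<n. of_real (e j) * U x j * cnj (U z j)) * (\<Sum>l<n. of_real (e l ^ k) * (U z l * cnj (U y l))))"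
      using Suc by (simp add: A)
    also have "\<dots> = (\<Sum>z<n. \<Sum>j<n. \<Sum>l<n. of_real (e j) * of_real (e l ^ k) * (U x j * cnj (U y l)) * (cnj (U z j) * U z l))"
      unfolding sum_product by (simp only: mult_ac)
    also have "\<dots> = (\<Sum>j<n. \<Sum>z<n. \<Sum>l<n. of_real (e j) * of_real (e l ^ k) * (U x j * cnj (U y l)) * (cnj (U z j) * U z l))"
      by (rule sum.swap)
    also have "\<dots> = (\<Sum>j<n. \<Sum>l<n. \<Sum>z<n. of_real (e j) * of_real (e l ^ k) * (U x j * cnj (U y l)) * (cnj (U z j) * U z l))"
      by (intro sum.cong refl sum.swap)
    also have "\<dots> = (\<Sum>j<n. \<Sum>l<n. if j = l then of_real (e j) * of_real (e l ^ k) * (U x j * cnj (U y l)) else 0)"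
      by (intro sum.cong refl) (auto simp: c sum_distrib_left[symmetric])
    also have "\<dots> = (\<Sum>j<n. of_real (e j ^ Suc k) * (U x j * cnj (U y j)))" by simp
    finally show ?case .
  qed
  have "ktrace {..<n} A k = (\<Sum>x<n. \<Sum>j<n. of_real (e j ^ k) * (U x j * cnj (U x j)))"
    unfolding ktrace_def by (intro sum.cong refl *) auto
  also have "\<dots> = (\<Sum>j<n. of_real (e j ^ k) * (\<Sum>x<n. cnj (U x j) * U x j))"
    unfolding sum_distrib_left by (subst sum.swap) (simp only: mult_ac)
  also have "\<dots> = of_real (\<Sum>j<n. e j ^ k)" by (simp add: c)
  finally show ?thesis .
qed

lemma diagonal_conj_index:
  assumes "U \<in> carrier_mat n n" "x < n" "y < n"
  shows "(U * mat_diag n d * mat_adjoint U) $$ (x, y) = (\<Sum>j<n. d j * U $$ (x, j) * cnj (U $$ (y, j)))"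
proof -
  have "U * mat_diag n d = mat n n (\<lambda>(i, j). U $$ (i, j) * d j)"
    using assms by (simp add: mat_diag_mult_right[of _ n n])
  then show ?thesis using assms by (simp add: scalar_prod_def atLeast0LessThan mult_ac)
qed

text \<open>Any eigendecomposition computes \<open>entropy\<close>, because
  \<open>herm_fun_eq\<close> makes the functional calculus independent of the choice.\<close>

lemma entropy_spectral:
  assumes Ac: "A \<in> carrier_mat n n" and U: "orthonormal_cols n U"
    and A: "\<forall>x<n. \<forall>y<n. A $$ (x, y) = (\<Sum>j<n. of_real (e j) * U x j * cnj (U y j))"
  shows "entropy A = (\<Sum>j<n. eta (e j))"
proof -
  define V where "V = mat n n (\<lambda>(i, j). U i j)"
  have uV: "unitary_mat n V" unfolding V_def by (rule unitary_mat_orthonormal_cols[OF U])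
  have V [simp]: "V \<in> carrier_mat n n" "mat_adjoint V \<in> carrier_mat n n" and VV: "mat_adjoint V * V = 1\<^sub>m n"
    using uV by (auto simp: unitary_mat_def)
  let ?D = "\<lambda>g. mat_diag n (\<lambda>i. complex_of_real (g i))"
  have AV: "A = V * ?D e * mat_adjoint V"
  proof (rule eq_matI)
    fix x y assume "x < dim_row (V * ?D e * mat_adjoint V)" "y < dim_col (V * ?D e * mat_adjoint V)"
    then have "x < n" "y < n" using V by auto
    then show "A $$ (x, y) = (V * ?D e * mat_adjoint V) $$ (x, y)"
      using A by (simp add: diagonal_conj_index[OF V(1)]) (simp add: V_def)
  qed (use Ac carrier_matD[OF V(1)] in auto)
  have hf: "herm_fun (log 2) A = V * ?D (\<lambda>i. log 2 (e i)) * mat_adjoint V"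
    unfolding AV by (rule herm_fun_eq[OF uV])
  have "A * herm_fun (log 2) A = V * ?D e * (mat_adjoint V * V) * ?D (\<lambda>i. log 2 (e i)) * mat_adjoint V"
    unfolding hf unfolding AV
    by (simp add: assoc_mult_mat[where n\<^sub>1 = n and n\<^sub>2 = n and n\<^sub>3 = n and n\<^sub>4 = n] mult_carrier_mat[where nr = n and n = n and nc = n])
  also have "\<dots> = V * (?D e * ?D (\<lambda>i. log 2 (e i))) * mat_adjoint V"
    unfolding VV by (simp add: assoc_mult_mat[where n\<^sub>1 = n and n\<^sub>2 = n and n\<^sub>3 = n and n\<^sub>4 = n] mult_carrier_mat[where nr = n and n = n and nc = n]
        left_mult_one_mat[where nr = n and nc = n])
  also have "?D e * ?D (\<lambda>i. log 2 (e i)) = ?D (\<lambda>i. e i * log 2 (e i))"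
    by (simp add: mat_diag_diag)
  finally have eq: "A * herm_fun (log 2) A = V * ?D (\<lambda>i. e i * log 2 (e i)) * mat_adjoint V" .
  have "mat_trace (A * herm_fun (log 2) A) =
      (\<Sum>x<n. (V * ?D (\<lambda>i. e i * log 2 (e i)) * mat_adjoint V) $$ (x, x))"
    unfolding mat_trace_def eq using carrier_matD[OF V(1)] by (simp del: index_mult_mat(1))
  also have "\<dots> = (\<Sum>x<n. \<Sum>j<n. of_real (e j * log 2 (e j)) * U x j * cnj (U x j))"
    by (intro sum.cong refl, subst diagonal_conj_index[OF V(1)]) (auto simp: V_def)
  also have "\<dots> = (\<Sum>j<n. of_real (e j * log 2 (e j)) * (\<Sum>x<n. cnj (U x j) * U x j))"
    unfolding sum_distrib_left by (subst sum.swap) (simp only: mult_ac)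
  also have "\<dots> = (\<Sum>j<n. of_real (e j * log 2 (e j)))"
    using U by (intro sum.cong) (auto simp: orthonormal_cols_def)
  finally show ?thesis by (simp add: entropy_def eta_def sum_negf)
qed

lemma psd_marginal:
  assumes "A \<in> carrier_mat n n" "\<And>x x'. x < n \<Longrightarrow> x' < n \<Longrightarrow> A $$ (x, x') = marginal Y \<Psi> x x'"
  shows "psd n A"
  unfolding psd_def
proof (intro conjI ballI assms(1))
  fix v :: "complex vec" assume v: "v \<in> carrier_vec n"
  have nonneg: "0 \<le> z * cnj z" for z by (simp add: complex_mult_cnj less_eq_complex_def)
  have "(A *\<^sub>v v) \<bullet>c v = (\<Sum>x<n. (\<Sum>x'<n. marginal Y \<Psi> x x' * v $ x') * cnj (v $ x))"
    using assms v by (simp add: scalar_prod_def atLeast0LessThan)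
  also have "\<dots> = (\<Sum>x<n. \<Sum>x'<n. \<Sum>y\<in>Y. (\<Psi> x y * cnj (v $ x)) * cnj (\<Psi> x' y * cnj (v $ x')))"
    unfolding marginal_def by (simp add: sum_distrib_left sum_distrib_right mult_ac)
  also have "\<dots> = (\<Sum>x<n. \<Sum>y\<in>Y. \<Sum>x'<n. (\<Psi> x y * cnj (v $ x)) * cnj (\<Psi> x' y * cnj (v $ x')))"
    by (intro sum.cong refl sum.swap)
  also have "\<dots> = (\<Sum>y\<in>Y. \<Sum>x<n. \<Sum>x'<n. (\<Psi> x y * cnj (v $ x)) * cnj (\<Psi> x' y * cnj (v $ x')))"
    by (rule sum.swap)
  also have "\<dots> = (\<Sum>y\<in>Y. (\<Sum>x<n. \<Psi> x y * cnj (v $ x)) * cnj (\<Sum>x<n. \<Psi> x y * cnj (v $ x)))"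
    by (simp only: sum_product cnj_sum)
  also have "\<dots> \<ge> 0"
    by (intro sum_nonneg nonneg)
  finally show "0 \<le> (A *\<^sub>v v) \<bullet>c v" .
qed

text \<open>Guarantees that \<open>kentropy\<close> of a marginal over a finite set is never an
  unspecified value. Nonnegativity is kept for the product rule of \<open>eta\<close>.\<close>

lemma marginal_has_spectrum:
  assumes "finite X"
  shows "\<exists>e. has_spectrum X (marginal Y \<Psi>) {..<card X} e \<and> (\<forall>i<card X. 0 \<le> e i)"
proof -
  let ?n = "card X"
  obtain g where g: "bij_betw g {..<?n} X"
    using ex_bij_betw_nat_finite[OF assms] by (auto simp: atLeast0LessThan)
  define A where "A = mat ?n ?n (\<lambda>(i, j). marginal Y \<Psi> (g i) (g j))"
  have "psd ?n A"
    by (rule psd_marginal[where Y = Y and \<Psi> = "\<lambda>i. \<Psi> (g i)"]) (auto simp: A_def marginal_def)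
  then obtain U e where U: "orthonormal_cols ?n U" and e: "\<forall>j<?n. 0 \<le> e j"
    and eq: "\<forall>x<?n. \<forall>y<?n. A $$ (x, y) = (\<Sum>j<?n. of_real (e j) * U x j * cnj (U y j))"
    using psd_spectral by blast
  have "ktrace X (marginal Y \<Psi>) k = of_real (\<Sum>j<?n. e j ^ k)" for k
    using ktrace_reindex[OF g, of "marginal Y \<Psi>" k] ktrace_spectral[OF U, of "\<lambda>i j. marginal Y \<Psi> (g i) (g j)" e k] eq
    by (simp add: A_def)
  then show ?thesis using e by (auto simp: has_spectrum_def)
qed

text \<open>The bridge from matrices to kernels: \<open>f\<close> is the encoding of structured
  indices by numbers, and the spectrum does not depend on it.\<close>

lemma entropy_eq_ent:
  assumes A: "A \<in> carrier_mat n n" and f: "bij_betw f X {..<n}"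
    and eq: "\<And>x x'. x \<in> X \<Longrightarrow> x' \<in> X \<Longrightarrow> A $$ (f x, f x') = marginal Y \<Psi> x x'"
  shows "entropy A = ent X Y \<Psi>"
proof -
  define g where "g = the_inv_into X f"
  have g: "bij_betw g {..<n} X" unfolding g_def by (rule bij_betw_the_inv_into[OF f])
  have fg: "f (g i) = i" if "i < n" for i
    unfolding g_def using f that by (simp add: bij_betw_def f_the_inv_into_f)
  have gX: "g i \<in> X" if "i < n" for i using g that by (auto simp: bij_betw_def)
  have Ag: "A $$ (i, j) = marginal Y (\<lambda>i. \<Psi> (g i)) i j" if "i < n" "j < n" for i j
    using eq[OF gX[OF that(1)] gX[OF that(2)]] fg that by (simp add: marginal_def)
  obtain U e where U: "orthonormal_cols n U"
    and eq: "\<forall>x<n. \<forall>y<n. A $$ (x, y) = (\<Sum>j<n. of_real (e j) * U x j * cnj (U y j))"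
    using psd_spectral[OF psd_marginal[OF A Ag]] by blast
  have "has_spectrum {..<n} (marginal Y (\<lambda>i. \<Psi> (g i))) {..<n} e"
    unfolding has_spectrum_def using ktrace_spectral[OF U, of "marginal Y (\<lambda>i. \<Psi> (g i))" e] eq Ag by simp
  then have "ent {..<n} Y (\<lambda>i. \<Psi> (g i)) = (\<Sum>j<n. eta (e j))"
    unfolding ent_def by (intro kentropy_eq) auto
  also have "\<dots> = entropy A" using entropy_spectral[OF A U eq] by simp
  finally show ?thesis using ent_reindex[OF g, of id Y Y "\<lambda>i. \<Psi> (g i)" \<Psi>] by simp
qed

section \<open>Entropies of tensor products and of balanced direct sums\<close>

lemma eta_mult: "0 \<le> x \<Longrightarrow> 0 \<le> y \<Longrightarrow> eta (x * y) = y * eta x + x * eta y"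
  by (cases "x = 0 \<or> y = 0") (auto simp: eta_def log_mult algebra_simps)

lemma ktrace_1: "finite X \<Longrightarrow> ktrace X K (Suc 0) = (\<Sum>x\<in>X. K x x)"
  by (simp add: ktrace_def if_distrib[of "\<lambda>c. _ * c"] cong: if_cong)

definition sqnorm :: "'x set \<Rightarrow> 'y set \<Rightarrow> ('x \<Rightarrow> 'y \<Rightarrow> complex) \<Rightarrow> complex" where
  "sqnorm X Y \<Psi> = (\<Sum>x\<in>X. \<Sum>y\<in>Y. \<Psi> x y * cnj (\<Psi> x y))"

lemma spectrum_sum:
  assumes "finite X" "has_spectrum X (marginal Y \<Psi>) I e" "sqnorm X Y \<Psi> = 1"
  shows "(\<Sum>i\<in>I. e i) = 1"
proof -
  have "complex_of_real (\<Sum>i\<in>I. e i) = ktrace X (marginal Y \<Psi>) (Suc 0)"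
    using assms(2) by (simp add: has_spectrum_def del: of_real_sum)
  also have "\<dots> = 1" using assms(1,3) by (simp add: ktrace_1 marginal_def sqnorm_def)
  finally show ?thesis by (simp only: of_real_eq_1_iff)
qed

text \<open>The eigenvalues of the product are the pairwise products. \<open>eta\<close> obeys a
  Leibniz rule, and normalization sums the spectator eigenvalues in each term to 1.\<close>

lemma ent_tensor:
  assumes fin: "finite X1" "finite X2" and n1: "sqnorm X1 Y1 \<Psi>1 = 1" and n2: "sqnorm X2 Y2 \<Psi>2 = 1"
  shows "ent (X1 \<times> X2) (Y1 \<times> Y2) (\<lambda>(x1, x2) (y1, y2). \<Psi>1 x1 y1 * \<Psi>2 x2 y2) = ent X1 Y1 \<Psi>1 + ent X2 Y2 \<Psi>2"
proof -
  let ?\<Psi> = "\<lambda>(x1, x2) (y1, y2). \<Psi>1 x1 y1 * \<Psi>2 x2 y2"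
  let ?I1 = "{..<card X1}" and ?I2 = "{..<card X2}"
  obtain e1 where e1: "has_spectrum X1 (marginal Y1 \<Psi>1) ?I1 e1" "\<forall>i\<in>?I1. 0 \<le> e1 i"
    using marginal_has_spectrum[OF fin(1)] by blast
  obtain e2 where e2: "has_spectrum X2 (marginal Y2 \<Psi>2) ?I2 e2" "\<forall>i\<in>?I2. 0 \<le> e2 i"
    using marginal_has_spectrum[OF fin(2)] by blast
  have s1: "(\<Sum>i\<in>?I1. e1 i) = 1" and s2: "(\<Sum>i\<in>?I2. e2 i) = 1"
    using spectrum_sum[OF fin(1) e1(1) n1] spectrum_sum[OF fin(2) e2(1) n2] .
  have m: "marginal (Y1 \<times> Y2) ?\<Psi> = (\<lambda>(x, y) (x', y'). marginal Y1 \<Psi>1 x x' * marginal Y2 \<Psi>2 y y')"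
    by (auto simp: fun_eq_iff marginal_def sum_product sum.cartesian_product mult_ac intro!: sum.cong)
  have sp: "has_spectrum (X1 \<times> X2) (marginal (Y1 \<times> Y2) ?\<Psi>) (?I1 \<times> ?I2) (\<lambda>(i, j). e1 i * e2 j)"
    unfolding has_spectrum_def
  proof (intro allI impI)
    fix k :: nat assume "k > 0"
    then have "ktrace (X1 \<times> X2) (marginal (Y1 \<times> Y2) ?\<Psi>) k = of_real (\<Sum>i\<in>?I1. e1 i ^ k) * of_real (\<Sum>i\<in>?I2. e2 i ^ k)"
      unfolding m ktrace_tensor using e1(1) e2(1) by (simp only: has_spectrum_def)
    also have "\<dots> = of_real ((\<Sum>i\<in>?I1. e1 i ^ k) * (\<Sum>i\<in>?I2. e2 i ^ k))" by (simp only: of_real_mult)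
    also have "(\<Sum>i\<in>?I1. e1 i ^ k) * (\<Sum>i\<in>?I2. e2 i ^ k) = (\<Sum>ij\<in>?I1 \<times> ?I2. (case ij of (i, j) \<Rightarrow> e1 i * e2 j) ^ k)"
      by (simp add: sum_product sum.cartesian_product power_mult_distrib case_prod_beta)
    finally show "ktrace (X1 \<times> X2) (marginal (Y1 \<times> Y2) ?\<Psi>) k = of_real (\<Sum>ij\<in>?I1 \<times> ?I2. (case ij of (i, j) \<Rightarrow> e1 i * e2 j) ^ k)" .
  qed
  have "ent (X1 \<times> X2) (Y1 \<times> Y2) ?\<Psi> = (\<Sum>(i, j)\<in>?I1 \<times> ?I2. eta (e1 i * e2 j))"
    unfolding ent_def using kentropy_eq[OF _ sp] by (simp add: case_prod_beta)
  also have "\<dots> = (\<Sum>i\<in>?I1. \<Sum>j\<in>?I2. e2 j * eta (e1 i) + e1 i * eta (e2 j))"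
    unfolding sum.cartesian_product[symmetric] using e1(2) e2(2) by (intro sum.cong refl eta_mult) auto
  also have "\<dots> = (\<Sum>i\<in>?I1. (\<Sum>j\<in>?I2. e2 j) * eta (e1 i) + e1 i * (\<Sum>j\<in>?I2. eta (e2 j)))"
    by (simp add: sum.distrib sum_distrib_left sum_distrib_right)
  also have "\<dots> = (\<Sum>i\<in>?I1. eta (e1 i)) + (\<Sum>i\<in>?I1. e1 i) * (\<Sum>j\<in>?I2. eta (e2 j))"
    by (simp add: s2 sum.distrib sum_distrib_right)
  also have "(\<Sum>i\<in>?I1. eta (e1 i)) = ent X1 Y1 \<Psi>1"
    unfolding ent_def by (rule kentropy_eq[OF _ e1(1), symmetric]) simp
  also have "(\<Sum>j\<in>?I2. eta (e2 j)) = ent X2 Y2 \<Psi>2"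
    unfolding ent_def by (rule kentropy_eq[OF _ e2(1), symmetric]) simp
  finally show ?thesis by (simp add: s1)
qed

text \<open>Since the blocks of \<open>\<Psi>\<close> are disjoint on both sides, its marginal is
  block diagonal with blocks half of each original marginal; the 1 is the entropy of the fair choice
  between them.\<close>

lemma ent_balanced_sum:
  assumes fin: "finite X1" "finite X2" "finite Y1" "finite Y2"
    and n1: "sqnorm X1 Y1 \<Psi>1 = 1" and n2: "sqnorm X2 Y2 \<Psi>2 = 1"
    and \<Psi>: "\<And>x y. \<Psi> (Inl x) (Inl y) = \<Psi>1 x y / sqrt 2" "\<And>x y. \<Psi> (Inr x) (Inr y) = \<Psi>2 x y / sqrt 2"
      "\<And>x y. \<Psi> (Inl x) (Inr y) = 0" "\<And>x y. \<Psi> (Inr x) (Inl y) = 0"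
  shows "ent (X1 <+> X2) (Y1 <+> Y2) \<Psi> = 1 + (ent X1 Y1 \<Psi>1 + ent X2 Y2 \<Psi>2) / 2"
proof -
  let ?I1 = "{..<card X1}" and ?I2 = "{..<card X2}"
  obtain e1 where e1: "has_spectrum X1 (marginal Y1 \<Psi>1) ?I1 e1" "\<forall>i\<in>?I1. 0 \<le> e1 i"
    using marginal_has_spectrum[OF fin(1)] by blast
  obtain e2 where e2: "has_spectrum X2 (marginal Y2 \<Psi>2) ?I2 e2" "\<forall>i\<in>?I2. 0 \<le> e2 i"
    using marginal_has_spectrum[OF fin(2)] by blast
  have s1: "(\<Sum>i\<in>?I1. e1 i) = 1" and s2: "(\<Sum>i\<in>?I2. e2 i) = 1"
    using spectrum_sum[OF fin(1) e1(1) n1] spectrum_sum[OF fin(2) e2(1) n2] .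
  let ?M = "marginal (Y1 <+> Y2) \<Psi>"
  have half: "complex_of_real (sqrt 2) * complex_of_real (sqrt 2) = 2"
    by (simp flip: of_real_mult)
  have m1: "?M (Inl x) (Inl x') = (1 / 2) * marginal Y1 \<Psi>1 x x'" for x x'
    by (simp add: marginal_def sum.Plus fin \<Psi> half sum_divide_distrib)
  have m2: "?M (Inr x) (Inr x') = (1 / 2) * marginal Y2 \<Psi>2 x x'" for x x'
    by (simp add: marginal_def sum.Plus fin \<Psi> half sum_divide_distrib)
  have m0: "?M (Inl x) (Inr y) = 0" "?M (Inr y) (Inl x) = 0" for x y
    by (simp_all add: marginal_def sum.Plus fin \<Psi>)
  let ?e = "\<lambda>i. case i of Inl i \<Rightarrow> e1 i / 2 | Inr i \<Rightarrow> e2 i / 2"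
  have "has_spectrum (X1 <+> X2) ?M (?I1 <+> ?I2) ?e"
    unfolding has_spectrum_def
  proof (intro allI impI)
    fix k :: nat assume "k > 0"
    then have "ktrace (X1 <+> X2) ?M k = (1/2)^k * of_real (\<Sum>i\<in>?I1. e1 i ^ k) + (1/2)^k * of_real (\<Sum>i\<in>?I2. e2 i ^ k)"
      using e1(1) e2(1) by (simp only: ktrace_direct_sum[OF fin(1,2) m0] m1 m2 ktrace_scale has_spectrum_def)
    then show "ktrace (X1 <+> X2) ?M k = of_real (\<Sum>i\<in>?I1 <+> ?I2. ?e i ^ k)"
      by (simp add: sum.Plus power_divide sum_divide_distrib)
  qed
  then have "ent (X1 <+> X2) (Y1 <+> Y2) \<Psi> = (\<Sum>i\<in>?I1. eta (e1 i / 2)) + (\<Sum>i\<in>?I2. eta (e2 i / 2))"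
    unfolding ent_def by (subst kentropy_eq) (auto simp: sum.Plus)
  \<comment> \<open>The term \<open>x / 2\<close> comes from \<open>eta (1/2) = 1/2\<close>; over
    the two normalized spectra these terms add up to 1.\<close>
  moreover have "eta (x / 2) = eta x / 2 + x / 2" if "0 \<le> x" for x
    using eta_mult[OF that, of "1/2"] by (simp add: eta_def log_divide)
  ultimately have "ent (X1 <+> X2) (Y1 <+> Y2) \<Psi> =
      (\<Sum>i\<in>?I1. eta (e1 i) / 2 + e1 i / 2) + (\<Sum>i\<in>?I2. eta (e2 i) / 2 + e2 i / 2)"
    using e1(2) e2(2) by simp
  also have "\<dots> = 1 + ((\<Sum>i\<in>?I1. eta (e1 i)) + (\<Sum>i\<in>?I2. eta (e2 i))) / 2"
    by (simp add: sum.distrib s1 s2 flip: sum_divide_distrib)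
  also have "(\<Sum>i\<in>?I1. eta (e1 i)) = ent X1 Y1 \<Psi>1"
    unfolding ent_def by (rule kentropy_eq[OF _ e1(1), symmetric]) simp
  also have "(\<Sum>j\<in>?I2. eta (e2 j)) = ent X2 Y2 \<Psi>2"
    unfolding ent_def by (rule kentropy_eq[OF _ e2(1), symmetric]) simp
  finally show ?thesis .
qed

section \<open>Kraus representations\<close>

text \<open>\<open>V* V = 1\<close> for the Stinespring map \<open>V\<close> from \<open>Q\<close>
  to \<open>P\<close> and \<open>E\<close> with matrix entries \<open>K e p q\<close>; equivalently,
  the completeness relation of the Kraus operators.\<close>

definition isometry_on :: "'q set \<Rightarrow> 'p set \<Rightarrow> 'e set \<Rightarrow> ('e \<Rightarrow> 'p \<Rightarrow> 'q \<Rightarrow> complex) \<Rightarrow> bool" where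
  "isometry_on Q P E K \<longleftrightarrow>
     (\<forall>q\<in>Q. \<forall>q'\<in>Q. (\<Sum>e\<in>E. \<Sum>p\<in>P. cnj (K e p q) * K e p q') = (if q = q' then 1 else 0))"

text \<open>\<open>N X = \<Sum>\<^sub>e K\<^sub>e X K\<^sub>e\<^sup>*\<close>, stated on matrix units; \<open>K e p q\<close> is the entry (p, q) of \<open>K\<^sub>e\<close>.\<close>

definition kraus :: "nat \<Rightarrow> nat \<Rightarrow> (complex mat \<Rightarrow> complex mat) \<Rightarrow> 'e set \<Rightarrow> ('e \<Rightarrow> nat \<Rightarrow> nat \<Rightarrow> complex) \<Rightarrow> bool" where
  "kraus a b N E K \<longleftrightarrow> finite E \<and> isometry_on {..<a} {..<b} E K \<and>
     (\<forall>q<a. \<forall>q'<a. N (unit_mat a q q') \<in> carrier_mat b b \<and>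
        (\<forall>p<b. \<forall>p'<b. N (unit_mat a q q') $$ (p, p') = (\<Sum>e\<in>E. K e p q * cnj (K e p' q'))))"

lemma unit_mat_carrier [simp]: "unit_mat n i j \<in> carrier_mat n n"
  by (simp add: unit_mat_def)

lemma unit_mat_dim [simp]: "dim_row (unit_mat n i j) = n" "dim_col (unit_mat n i j) = n"
  by (simp_all add: unit_mat_def)

lemma unit_mat_index [simp]:
  "p < n \<Longrightarrow> q < n \<Longrightarrow> unit_mat n i j $$ (p, q) = (if p = i \<and> q = j then 1 else 0)"
  by (simp add: unit_mat_def)

lemma pair_less: "i < m \<Longrightarrow> k < n \<Longrightarrow> i * n + k < m * (n::nat)"
  using mult_le_mono1[of "Suc i" m n] by simp

lemma bij_betw_pair: "bij_betw (\<lambda>(i, k). i * n + k) ({..<m} \<times> {..<n}) {..<m * (n::nat)}"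
proof (rule bij_betw_byWitness[where f' = "\<lambda>x. (x div n, x mod n)"])
  have "0 < n" if "x < m * n" for x using that by (cases n) auto
  then show "(\<lambda>x. (x div n, x mod n)) ` {..<m * n} \<subseteq> {..<m} \<times> {..<n}"
    by (auto simp: less_mult_imp_div_less)
qed (auto simp: pair_less)

lemma sum4_delta:
  assumes "finite A" "finite B" "finite C" "finite D" "i0 \<in> A" "j0 \<in> B" "k0 \<in> C" "l0 \<in> D"
  shows "(\<Sum>i\<in>A. \<Sum>j\<in>B. \<Sum>k\<in>C. \<Sum>l\<in>D. if i = i0 \<and> j = j0 \<and> k = k0 \<and> l = l0 then f i j k l else 0) = f i0 j0 k0 l0"
proof -
  have "(\<Sum>l\<in>D. if i = i0 \<and> j = j0 \<and> k = k0 \<and> l = l0 then f i j k l else 0) =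
      (if k = k0 then if j = j0 then if i = i0 then f i j k l0 else 0 else 0 else 0)" for i j k
    using assms by (auto simp: sum.delta)
  then show ?thesis using assms by (simp add: sum.delta)
qed

lemma sum2_delta:
  assumes "finite A" "finite B" "i0 \<in> A" "j0 \<in> B"
  shows "(\<Sum>i\<in>A. \<Sum>j\<in>B. if i = i0 \<and> j = j0 then f i j else 0) = f i0 j0"
proof -
  have "(\<Sum>j\<in>B. if i = i0 \<and> j = j0 then f i j else 0) = (if i = i0 then f i j0 else 0)" for i
    using assms by (auto simp: sum.delta)
  then show ?thesis using assms by (simp add: sum.delta)
qed

lemma pair_eq_iff: "k < n \<Longrightarrow> k' < n \<Longrightarrow> i * n + k = i' * n + k' \<longleftrightarrow> i = i' \<and> k = (k'::nat)"
  by (metis div_mult_self3 mod_mult_self3 div_less mod_less add.right_neutral add_0 div_mult_self_is_m less_nat_zero_code bot_nat_0.not_eq_extremum mod_mult_self4)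

lemma tensor_map_unit_mat:
  assumes "i < a1" "j < a1" "k < a2" "l < a2" "P < b1 * b2" "P' < b1 * b2"
  shows "tensor_map a1 b1 N1 a2 b2 N2 (unit_mat (a1 * a2) (i * a2 + k) (j * a2 + l)) $$ (P, P') =
    kron (N1 (unit_mat a1 i j)) (N2 (unit_mat a2 k l)) $$ (P, P')"
proof -
  let ?f = "\<lambda>i j k l. kron (N1 (unit_mat a1 i j)) (N2 (unit_mat a2 k l)) $$ (P, P')"
  have "tensor_map a1 b1 N1 a2 b2 N2 (unit_mat (a1 * a2) (i * a2 + k) (j * a2 + l)) $$ (P, P') =
      (\<Sum>i'<a1. \<Sum>j'<a1. \<Sum>k'<a2. \<Sum>l'<a2. if i' = i \<and> j' = j \<and> k' = k \<and> l' = l then ?f i' j' k' l' else 0)"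
    using assms by (auto simp: tensor_map_def pair_less pair_eq_iff intro!: sum.cong)
  also have "\<dots> = ?f i j k l" by (rule sum4_delta) (use assms in auto)
  finally show ?thesis .
qed

lemma kron_index:
  assumes "A \<in> carrier_mat m m" "B \<in> carrier_mat n n" "i < m" "j < m" "k < n" "l < n"
  shows "kron A B $$ (i * n + k, j * n + l) = A $$ (i, j) * B $$ (k, l)"
  using assms by (auto simp: kron_def pair_less)

lemma tensor_map_id_left:
  assumes N: "\<And>k l. k < da \<Longrightarrow> l < da \<Longrightarrow> N (unit_mat da k l) \<in> carrier_mat db db"
    and "\<alpha> < a" "\<alpha>' < a" "p < db" "p' < db"
  shows "tensor_map a a id da db N X $$ (\<alpha> * db + p, \<alpha>' * db + p') =
    (\<Sum>k<da. \<Sum>l<da. X $$ (\<alpha> * da + k, \<alpha>' * da + l) * N (unit_mat da k l) $$ (p, p'))"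
proof -
  have "tensor_map a a id da db N X $$ (\<alpha> * db + p, \<alpha>' * db + p') =
     (\<Sum>i<a. \<Sum>j<a. \<Sum>k<da. \<Sum>l<da. X $$ (i * da + k, j * da + l) *
       (unit_mat a i j $$ (\<alpha>, \<alpha>') * N (unit_mat da k l) $$ (p, p')))"
    using assms by (auto simp: tensor_map_def pair_less kron_index[OF unit_mat_carrier N] intro!: sum.cong)
  also have "\<dots> = (\<Sum>i<a. \<Sum>j<a. if i = \<alpha> \<and> j = \<alpha>' then
      (\<Sum>k<da. \<Sum>l<da. X $$ (i * da + k, j * da + l) * N (unit_mat da k l) $$ (p, p')) else 0)"
    using assms by (intro sum.cong) auto
  also have "\<dots> = (\<Sum>k<da. \<Sum>l<da. X $$ (\<alpha> * da + k, \<alpha>' * da + l) * N (unit_mat da k l) $$ (p, p'))"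
    by (rule sum2_delta) (use assms in auto)
  finally show ?thesis .
qed

text \<open>Since \<open>tensor_map\<close> evaluates its arguments on matrix units only, it
  suffices to control \<open>N\<close> there. Thus the lemma also applies when \<open>N\<close> is
  itself a \<open>tensor_map\<close>, as in \<open>channel_output\<close>.\<close>

lemma tensor_map_id_right:
  assumes N: "\<And>i j. i < m \<Longrightarrow> j < m \<Longrightarrow> N (unit_mat m i j) \<in> carrier_mat n n"
    and "P < n" "P' < n" "s < d" "s' < d"
  shows "tensor_map m n N d d id X $$ (P * d + s, P' * d + s') =
    (\<Sum>i<m. \<Sum>j<m. X $$ (i * d + s, j * d + s') * N (unit_mat m i j) $$ (P, P'))"
proof -
  have "tensor_map m n N d d id X $$ (P * d + s, P' * d + s') =
     (\<Sum>i<m. \<Sum>j<m. \<Sum>k<d. \<Sum>l<d. X $$ (i * d + k, j * d + l) *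
       (N (unit_mat m i j) $$ (P, P') * unit_mat d k l $$ (s, s')))"
    using assms by (auto simp: tensor_map_def pair_less kron_index[OF N unit_mat_carrier] intro!: sum.cong)
  also have "\<dots> = (\<Sum>i<m. \<Sum>j<m. \<Sum>k<d. \<Sum>l<d. if k = s \<and> l = s' then
     X $$ (i * d + k, j * d + l) * N (unit_mat m i j) $$ (P, P') else 0)"
    using assms by (intro sum.cong) auto
  also have "\<dots> = (\<Sum>i<m. \<Sum>j<m. X $$ (i * d + s, j * d + s') * N (unit_mat m i j) $$ (P, P'))"
    using assms by (intro sum.cong refl sum2_delta) auto
  finally show ?thesis .
qed

text \<open>Choi's theorem: complete positivity makes the Choi matrix positive semidefinite, and its
  scaled eigenvectors are the Kraus operators. There are \<open>a * b\<close> of them, the size of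
  that matrix.\<close>

lemma kraus_exists:
  assumes "quantum_channel a b N"
  shows "\<exists>K. kraus a b N {..<a * b} K"
proof -
  have Nc: "N X \<in> carrier_mat b b" if "X \<in> carrier_mat a a" for X
    using assms that by (auto simp: quantum_channel_def linear_map_def)
  \<comment> \<open>The unnormalized maximally entangled projector; its image under the extended
    channel has the blocks \<open>N (unit_mat a q q')\<close>.\<close>
  define X where "X = mat (a * a) (a * a)
    (\<lambda>(i, j). if i div a = i mod a \<and> j div a = j mod a then 1 else (0::complex))"
  have "psd (a * a) X"
    by (rule psd_marginal[where Y = "{()}" and \<Psi> = "\<lambda>i _. if i div a = i mod a then 1 else 0"])
      (auto simp: X_def marginal_def)
  then have "psd (a * b) (tensor_map a a id a b N X)"
    using assms by (auto simp: quantum_channel_def completely_positive_def)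
  then obtain U e where e: "\<forall>j<a * b. 0 \<le> e j"
    and eq: "\<forall>x<a * b. \<forall>y<a * b. tensor_map a a id a b N X $$ (x, y) = (\<Sum>j<a * b. of_real (e j) * U x j * cnj (U y j))"
    using psd_spectral by blast
  \<comment> \<open>Each eigenvector of the Choi matrix is folded into a \<open>b\<close> by
    \<open>a\<close> matrix; the square root distributes its eigenvalue over the two
    factors.\<close>
  define K where "K j p q = of_real (sqrt (e j)) * U (q * b + p) j" for j p q
  have NK: "N (unit_mat a q q') $$ (p, p') = (\<Sum>j<a * b. K j p q * cnj (K j p' q'))"
    if "q < a" "q' < a" "p < b" "p' < b" for q q' p p'
  proof -
    have "tensor_map a a id a b N X $$ (q * b + p, q' * b + p') =
        (\<Sum>k<a. \<Sum>l<a. X $$ (q * a + k, q' * a + l) * N (unit_mat a k l) $$ (p, p'))"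
      by (rule tensor_map_id_left) (use that Nc in auto)
    also have "\<dots> = (\<Sum>k<a. \<Sum>l<a. if k = q \<and> l = q' then N (unit_mat a k l) $$ (p, p') else 0)"
      using that by (intro sum.cong refl) (auto simp: X_def pair_less)
    also have "\<dots> = N (unit_mat a q q') $$ (p, p')"
      by (rule sum2_delta) (use that in auto)
    finally have "N (unit_mat a q q') $$ (p, p') = (\<Sum>j<a * b. of_real (e j) * U (q * b + p) j * cnj (U (q' * b + p') j))"
      using eq that by (simp add: pair_less)
    also have "\<dots> = (\<Sum>j<a * b. K j p q * cnj (K j p' q'))"
    proof (intro sum.cong refl)
      fix j assume "j \<in> {..<a * b}"
      then have "complex_of_real (e j) = of_real (sqrt (e j)) * of_real (sqrt (e j))"
        using e by (simp flip: of_real_mult)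
      then show "of_real (e j) * U (q * b + p) j * cnj (U (q' * b + p') j) = K j p q * cnj (K j p' q')"
        by (simp add: K_def mult_ac)
    qed
    finally show ?thesis .
  qed
  have "isometry_on {..<a} {..<b} {..<a * b} K" unfolding isometry_on_def
  proof (intro ballI)
    fix q q' assume "q \<in> {..<a}" "q' \<in> {..<a}"
    then have q: "q < a" "q' < a" by auto
    \<comment> \<open>Trace preservation on matrix units is exactly the completeness
      relation.\<close>
    have "(\<Sum>j<a * b. \<Sum>p<b. cnj (K j p q) * K j p q') = (\<Sum>p<b. \<Sum>j<a * b. K j p q' * cnj (K j p q))"
      by (subst sum.swap) (simp only: mult.commute)
    also have "\<dots> = mat_trace (N (unit_mat a q' q))"
      using Nc[OF unit_mat_carrier, of q' q] q by (simp add: mat_trace_def NK)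
    also have "\<dots> = mat_trace (unit_mat a q' q)"
      using assms by (simp add: quantum_channel_def trace_preserving_def)
    also have "\<dots> = (\<Sum>i<a. if i = q then (if q = q' then 1 else 0) else 0)"
      unfolding mat_trace_def by (auto intro!: sum.cong)
    finally show "(\<Sum>j<a * b. \<Sum>p<b. cnj (K j p q) * K j p q') = (if q = q' then 1 else 0)" using q by simp
  qed
  then show ?thesis using NK Nc unfolding kraus_def by (intro exI[of _ K]) auto
qed

lemma sum_pair: "(\<Sum>x<m * n. f x) = (\<Sum>i<m. \<Sum>k<n. f (i * n + k))" for n :: nat
  using sum.reindex_bij_betw[OF bij_betw_pair[of n m], of f]
  by (simp add: sum.cartesian_product case_prod_beta)

lemma nat_pair_cases:
  assumes "x < m * (n::nat)"
  obtains i k where "x = i * n + k" "i < m" "k < n"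
proof (rule that)
  have "0 < n" using assms by (cases n) auto
  then show "x div n < m" "x mod n < n" using assms by (simp_all add: less_mult_imp_div_less)
qed simp

lemma kraus_tensor:
  assumes "kraus a1 b1 N1 E1 K1" "kraus a2 b2 N2 E2 K2"
  shows "kraus (a1 * a2) (b1 * b2) (tensor_map a1 b1 N1 a2 b2 N2) (E1 \<times> E2)
    (\<lambda>(e1, e2) p q. K1 e1 (p div b2) (q div a2) * K2 e2 (p mod b2) (q mod a2))"
    (is "kraus _ _ _ _ ?K")
proof -
  have i1: "(\<Sum>e\<in>E1. \<Sum>p<b1. cnj (K1 e p q) * K1 e p q') = (if q = q' then 1 else 0)" if "q < a1" "q' < a1" for q q'
    using assms(1) that by (simp add: kraus_def isometry_on_def)
  have i2: "(\<Sum>e\<in>E2. \<Sum>p<b2. cnj (K2 e p q) * K2 e p q') = (if q = q' then 1 else 0)" if "q < a2" "q' < a2" for q q'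
    using assms(2) that by (simp add: kraus_def isometry_on_def)
  have N1: "N1 (unit_mat a1 q q') \<in> carrier_mat b1 b1"
      "p < b1 \<Longrightarrow> p' < b1 \<Longrightarrow> N1 (unit_mat a1 q q') $$ (p, p') = (\<Sum>e\<in>E1. K1 e p q * cnj (K1 e p' q'))"
    if "q < a1" "q' < a1" for q q' p p'
    using assms(1) that by (auto simp: kraus_def)
  have N2: "N2 (unit_mat a2 q q') \<in> carrier_mat b2 b2"
      "p < b2 \<Longrightarrow> p' < b2 \<Longrightarrow> N2 (unit_mat a2 q q') $$ (p, p') = (\<Sum>e\<in>E2. K2 e p q * cnj (K2 e p' q'))"
    if "q < a2" "q' < a2" for q q' p p'
    using assms(2) that by (auto simp: kraus_def)
  have "isometry_on {..<a1 * a2} {..<b1 * b2} (E1 \<times> E2) ?K" unfolding isometry_on_def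
  proof (intro ballI)
    fix x x' assume "x \<in> {..<a1 * a2}" "x' \<in> {..<a1 * a2}"
    then obtain q1 q2 q1' q2' where x: "x = q1 * a2 + q2" "x' = q1' * a2 + q2'"
      and q: "q1 < a1" "q2 < a2" "q1' < a1" "q2' < a2" by (auto elim!: nat_pair_cases)
    let ?f = "\<lambda>e p. cnj (K1 e p q1) * K1 e p q1'" and ?g = "\<lambda>e p. cnj (K2 e p q2) * K2 e p q2'"
    have "(\<Sum>e\<in>E1 \<times> E2. \<Sum>p<b1 * b2. cnj (?K e p x) * ?K e p x') =
        (\<Sum>e1\<in>E1. \<Sum>e2\<in>E2. \<Sum>p1<b1. \<Sum>p2<b2. ?f e1 p1 * ?g e2 p2)"
      unfolding sum_pair x sum.cartesian_product' using q by (intro sum.cong refl) (simp add: mult_ac)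
    also have "\<dots> = (\<Sum>e1\<in>E1. \<Sum>p1<b1. ?f e1 p1) * (\<Sum>e2\<in>E2. \<Sum>p2<b2. ?g e2 p2)"
      by (simp only: sum_product)
    also have "\<dots> = (if x = x' then 1 else 0)"
      unfolding i1[OF q(1,3)] i2[OF q(2,4)] x using q by (simp add: pair_eq_iff)
    finally show "(\<Sum>e\<in>E1 \<times> E2. \<Sum>p<b1 * b2. cnj (?K e p x) * ?K e p x') = (if x = x' then 1 else 0)" .
  qed
  moreover have "tensor_map a1 b1 N1 a2 b2 N2 (unit_mat (a1 * a2) x x') $$ (p, p') =
      (\<Sum>e\<in>E1 \<times> E2. ?K e p x * cnj (?K e p' x'))"
    if xp: "x < a1 * a2" "x' < a1 * a2" "p < b1 * b2" "p' < b1 * b2" for x x' p p'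
  proof -
    obtain q1 q2 where x: "x = q1 * a2 + q2" and q: "q1 < a1" "q2 < a2"
      using xp by (auto elim!: nat_pair_cases)
    obtain q1' q2' where x': "x' = q1' * a2 + q2'" and q': "q1' < a1" "q2' < a2"
      using xp by (auto elim!: nat_pair_cases)
    obtain p1 p2 where p: "p = p1 * b2 + p2" and pp: "p1 < b1" "p2 < b2"
      using xp by (auto elim!: nat_pair_cases)
    obtain p1' p2' where p': "p' = p1' * b2 + p2'" and pp': "p1' < b1" "p2' < b2"
      using xp by (auto elim!: nat_pair_cases)
    have "tensor_map a1 b1 N1 a2 b2 N2 (unit_mat (a1 * a2) x x') $$ (p, p') =
        N1 (unit_mat a1 q1 q1') $$ (p1, p1') * N2 (unit_mat a2 q2 q2') $$ (p2, p2')"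
      using tensor_map_unit_mat[OF q(1) q'(1) q(2) q'(2) xp(3,4), of N1 N2]
        kron_index[OF N1(1)[OF q(1) q'(1)] N2(1)[OF q(2) q'(2)] pp(1) pp'(1) pp(2) pp'(2)]
      by (simp add: x x' p p')
    also have "\<dots> = (\<Sum>e1\<in>E1. \<Sum>e2\<in>E2. (K1 e1 p1 q1 * cnj (K1 e1 p1' q1')) * (K2 e2 p2 q2 * cnj (K2 e2 p2' q2')))"
      by (simp add: N1 N2 q q' pp pp' sum_product)
    also have "\<dots> = (\<Sum>e\<in>E1 \<times> E2. ?K e p x * cnj (?K e p' x'))"
      unfolding sum.cartesian_product' x x' p p' using q q' pp pp' by (intro sum.cong refl) (simp add: mult_ac)
    finally show ?thesis .
  qed
  ultimately show ?thesis using assms unfolding kraus_def by (auto simp: tensor_map_def)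
qed

section \<open>Pure states\<close>

lemma vec_space_lin_dep_pair:
  fixes w c :: "complex vec"
  assumes "w \<in> carrier_vec n" "c \<in> carrier_vec n"
    and "module.lin_dep class_ring (module_vec TYPE(complex) n) {w, c}"
  shows "\<exists>a b. (a \<noteq> 0 \<or> b \<noteq> 0) \<and> (\<forall>i<n. a * w $ i + b * c $ i = 0)"
proof -
  interpret vec_space "TYPE(complex)" n .
  obtain f v where f: "lincomb f {w, c} = 0\<^sub>v n" "v \<in> {w, c}" "f v \<noteq> 0"
    using finite_lin_dep[of "{w, c}"] assms by auto
  have *: "(\<Sum>x\<in>{w, c}. f x * x $ i) = 0" if "i < n" for i
    using lincomb_index[OF that, of "{w, c}" f] f(1) assms that by simp
  show ?thesis
  proof (cases "w = c")
    case True
    then show ?thesis using * f by (intro exI[of _ "f w"] exI[of _ 0]) auto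
  next
    case False
    then show ?thesis using * f by (intro exI[of _ "f w"] exI[of _ "f c"]) auto
  qed
qed

text \<open>Rank one makes every column proportional to a nonzero column \<open>j0\<close>;
  Hermiticity and idempotence then fix the scale, so that this column, rescaled, is the required
  unit vector.\<close>

lemma pure_state_vector:
  assumes "pure_state n \<phi>"
  shows "\<exists>u. (\<Sum>i<n. u i * cnj (u i)) = 1 \<and> (\<forall>i<n. \<forall>j<n. \<phi> $$ (i, j) = u i * cnj (u j))"
proof -
  interpret vec_space "TYPE(complex)" n .
  have \<phi>: "\<phi> \<in> carrier_mat n n" and adj: "mat_adjoint \<phi> = \<phi>" and idem: "\<phi> * \<phi> = \<phi>" and rk: "rank \<phi> = 1"
    using assms by (auto simp: pure_state_def)
  have herm: "\<phi> $$ (j, i) = cnj (\<phi> $$ (i, j))" if "i < n" "j < n" for i j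
    using arg_cong[OF adj, of "\<lambda>A. A $$ (j, i)"] \<phi> that by simp
  have sq: "(\<Sum>k<n. \<phi> $$ (i, k) * \<phi> $$ (k, j)) = \<phi> $$ (i, j)" if "i < n" "j < n" for i j
    using arg_cong[OF idem, of "\<lambda>A. A $$ (i, j)"] \<phi> that by (simp add: scalar_prod_def atLeast0LessThan)
  have "\<phi> \<noteq> 0\<^sub>m n n" using rk rank_0I[of n] by auto
  then obtain i0 j0 where ij0: "i0 < n" "j0 < n" "\<phi> $$ (i0, j0) \<noteq> 0"
    using eq_matI[of \<phi> "0\<^sub>m n n"] \<phi> by auto
  define c where "c j = col \<phi> j" for j
  have cc: "c j \<in> carrier_vec n" and ccols: "c j \<in> set (cols \<phi>)" if "j < n" for j
    using \<phi> that by (auto simp: c_def cols_def)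
  have c_ij: "c j $ i = \<phi> $$ (i, j)" if "i < n" "j < n" for i j using \<phi> that by (simp add: c_def)
  \<comment> \<open>Rank one in the form of vanishing 2 x 2 minors. Equal columns are treated apart
    because the two-element set on which the rank bound acts would collapse.\<close>
  have minor: "\<phi> $$ (i, j) * \<phi> $$ (k, j0) = \<phi> $$ (i, j0) * \<phi> $$ (k, j)" if ijk: "i < n" "j < n" "k < n" for i j k
  proof (cases "c j0 = c j")
    case True
    then have "\<phi> $$ (i, j) = \<phi> $$ (i, j0)" "\<phi> $$ (k, j) = \<phi> $$ (k, j0)"
      using c_ij[OF that(1,2)] c_ij[OF that(1) ij0(2)] c_ij[OF that(3,2)] c_ij[OF that(3) ij0(2)] by auto
    then show ?thesis by simp
  next
    case False
    have dep: "lin_dep {c j0, c j}"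
      using rank_ge_card_indpt[OF \<phi>, of "{c j0, c j}"] rk False ccols that ij0 by auto
    then obtain a b where ab: "a \<noteq> 0 \<or> b \<noteq> 0" "\<forall>i<n. a * c j0 $ i + b * c j $ i = 0"
      using vec_space_lin_dep_pair[OF cc[OF ij0(2)] cc[OF ijk(2)] dep] by (elim exE conjE)
    have e: "a * \<phi> $$ (i, j0) = - (b * \<phi> $$ (i, j))" if "i < n" for i
      using ab(2) that \<open>j < n\<close> ij0 c_ij by (simp add: eq_neg_iff_add_eq_0)
    have "b \<noteq> 0" using e[OF ij0(1)] ab(1) ij0(3) by auto
    have "b * (\<phi> $$ (i, j) * \<phi> $$ (k, j0)) = b * (\<phi> $$ (i, j0) * \<phi> $$ (k, j))"
    proof -
      have "b * (\<phi> $$ (i, j) * \<phi> $$ (k, j0)) = - (a * \<phi> $$ (i, j0)) * \<phi> $$ (k, j0)"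
        using e[OF that(1)] by simp
      also have "\<dots> = - \<phi> $$ (i, j0) * (a * \<phi> $$ (k, j0))" by simp
      also have "\<dots> = b * (\<phi> $$ (i, j0) * \<phi> $$ (k, j))" using e[OF that(3)] by simp
      finally show ?thesis .
    qed
    then show ?thesis using \<open>b \<noteq> 0\<close> by simp
  qed
  define N where "N = (\<Sum>i<n. (cmod (\<phi> $$ (i, j0)))\<^sup>2)"
  have "(\<Sum>i<n. \<phi> $$ (j0, i) * \<phi> $$ (i, j0)) = (\<Sum>i<n. of_real ((cmod (\<phi> $$ (i, j0)))\<^sup>2))"
    unfolding complex_norm_square
    by (intro sum.cong refl) (simp add: herm[OF _ ij0(2)] mult.commute)
  \<comment> \<open>Idempotence at the entry \<open>(j0, j0)\<close>: the squared length of the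
    column equals its diagonal entry, hence division by \<open>sqrt N\<close> both normalizes the
    vector and reproduces the matrix.\<close>
  then have NN: "\<phi> $$ (j0, j0) = of_real N" using sq[OF ij0(2,2)] by (simp add: N_def)
  have "N > 0"
  proof -
    have "(cmod (\<phi> $$ (i0, j0)))\<^sup>2 \<le> N"
      unfolding N_def using ij0(1) by (intro member_le_sum) auto
    moreover have "(cmod (\<phi> $$ (i0, j0)))\<^sup>2 > 0" using ij0 by simp
    ultimately show ?thesis by linarith
  qed
  define u where "u i = \<phi> $$ (i, j0) / of_real (sqrt N)" for i
  have sqrtN: "complex_of_real (sqrt N) * of_real (sqrt N) = of_real N"
    using \<open>N > 0\<close> by (simp flip: of_real_mult)
  have "\<phi> $$ (i, j) = u i * cnj (u j)" if "i < n" "j < n" for i j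
  proof -
    have "\<phi> $$ (i, j) * of_real N = \<phi> $$ (i, j0) * cnj (\<phi> $$ (j, j0))"
      using minor[OF that ij0(2)] NN herm[OF that(2) ij0(2)] by simp
    moreover have "u i * cnj (u j) = \<phi> $$ (i, j0) * cnj (\<phi> $$ (j, j0)) / of_real N"
      by (simp add: u_def sqrtN)
    ultimately have "\<phi> $$ (i, j) * of_real N = (u i * cnj (u j)) * of_real N"
      using \<open>N > 0\<close> by simp
    then show ?thesis using \<open>N > 0\<close> by simp
  qed
  moreover have "(\<Sum>i<n. u i * cnj (u i)) = 1"
  proof -
    have "(\<Sum>i<n. u i * cnj (u i)) = (\<Sum>i<n. of_real ((cmod (\<phi> $$ (i, j0)))\<^sup>2) / of_real N)"
      unfolding complex_norm_square by (simp add: u_def sqrtN)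
    also have "\<dots> = of_real N / of_real N" by (simp only: sum_divide_distrib[symmetric] N_def of_real_sum)
    finally show ?thesis using \<open>N > 0\<close> by simp
  qed
  ultimately show ?thesis by blast
qed

lemma pure_stateI:
  assumes nu: "(\<Sum>i<n. u i * cnj (u i)) = 1"
  shows "pure_state n (mat n n (\<lambda>(i, j). u i * cnj (u j)))" (is "pure_state n ?\<phi>")
proof -
  interpret vec_space "TYPE(complex)" n .
  have \<phi>: "?\<phi> \<in> carrier_mat n n" by simp
  have "mat_adjoint ?\<phi> = ?\<phi>" by (rule eq_matI) (auto simp: mult.commute)
  moreover have "?\<phi> * ?\<phi> = ?\<phi>"
  proof (rule eq_matI)
    fix i j assume "i < dim_row ?\<phi>" "j < dim_col ?\<phi>"
    then have ij: "i < n" "j < n" by auto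
    have "(?\<phi> * ?\<phi>) $$ (i, j) = (\<Sum>k<n. u i * cnj (u k) * (u k * cnj (u j)))"
      using ij by (simp add: scalar_prod_def atLeast0LessThan)
    also have "\<dots> = u i * cnj (u j) * (\<Sum>k<n. u k * cnj (u k))"
      by (simp add: sum_distrib_left mult_ac)
    finally show "(?\<phi> * ?\<phi>) $$ (i, j) = ?\<phi> $$ (i, j)" using ij nu by simp
  qed auto
  moreover have "rank ?\<phi> \<le> 1"
    by (rule rank_le_1_product_entries[OF \<phi>, of u "\<lambda>j. cnj (u j)"]) auto
  moreover have "rank ?\<phi> \<ge> 1"
  proof -
    obtain j where j: "j < n" "u j \<noteq> 0" using nu sum.neutral[of "{..<n}" "\<lambda>i. u i * cnj (u i)"] by fastforce
    let ?w = "col ?\<phi> j"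
    have w: "?w \<in> carrier_vec n" "?w $ j \<noteq> 0" using j by auto
    have "\<not> lin_dep {?w}"
    proof
      assume "lin_dep {?w}"
      then obtain f v where f: "lincomb f {?w} = 0\<^sub>v n" "v \<in> {?w}" "f v \<noteq> 0"
        using finite_lin_dep[of "{?w}"] w by auto
      then show False using lincomb_index[OF j(1), of "{?w}" f] w j(1) by auto
    qed
    then show ?thesis
      using rank_ge_card_indpt[OF \<phi>, of "{?w}"] j by (auto simp: cols_def)
  qed
  ultimately show ?thesis using \<phi> by (auto simp: pure_state_def)
qed

section \<open>The coherent information in terms of amplitudes\<close>

text \<open>The Stinespring isometry applied to the channel input of \<open>v\<close>. The
  environment index \<open>e\<close> is kept, so the output is again a pure vector.\<close>

definition dilate :: "'q set \<Rightarrow> ('e \<Rightarrow> 'p \<Rightarrow> 'q \<Rightarrow> complex) \<Rightarrow> ('a \<Rightarrow> 'q \<Rightarrow> 's \<Rightarrow> 't \<Rightarrow> complex) \<Rightarrow>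
    'a \<Rightarrow> 'p \<Rightarrow> 'e \<Rightarrow> 's \<Rightarrow> 't \<Rightarrow> complex" where
  "dilate Q K v a p e s t = (\<Sum>q\<in>Q. K e p q * v a q s t)"

text \<open>With \<open>\<Psi>\<close> the pure state on A, B (index p), E, \<open>\<top>\<close>, \<open>\<bottom>\<close>: the difference
  \<open>S(B\<top>) - S(E\<top>)\<close>, which equals \<open>I(A\<rangle>B\<top>) = S(B\<top>) - S(E\<bottom>)\<close> for symmetric \<open>\<Psi>\<close>.\<close>

definition coh :: "'p set \<Rightarrow> 'e set \<Rightarrow> 'a set \<Rightarrow> 's set \<Rightarrow> 't set \<Rightarrow>
    ('a \<Rightarrow> 'p \<Rightarrow> 'e \<Rightarrow> 's \<Rightarrow> 't \<Rightarrow> complex) \<Rightarrow> real" where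
  "coh P E A S T \<Psi> =
     ent (P \<times> S) ((A \<times> E) \<times> T) (\<lambda>(p, s) ((a, e), t). \<Psi> a p e s t) -
     ent (E \<times> S) ((A \<times> P) \<times> T) (\<lambda>(e, s) ((a, p), t). \<Psi> a p e s t)"

definition gain :: "'p set \<Rightarrow> 'e set \<Rightarrow> 'a set \<Rightarrow> 's set \<Rightarrow> 't set \<Rightarrow>
    ('a \<Rightarrow> 'p \<Rightarrow> 'e \<Rightarrow> 's \<Rightarrow> 't \<Rightarrow> complex) \<Rightarrow> real" where
  "gain P E A S T \<Psi> = (coh P E A S T \<Psi> + coh P E A T S (\<lambda>a p e t s. \<Psi> a p e s t)) / 2"

definition normalized :: "'a set \<Rightarrow> 'q set \<Rightarrow> 's set \<Rightarrow> 't set \<Rightarrow> ('a \<Rightarrow> 'q \<Rightarrow> 's \<Rightarrow> 't \<Rightarrow> complex) \<Rightarrow> bool" where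
  "normalized A Q S T v \<longleftrightarrow> (\<Sum>a\<in>A. \<Sum>q\<in>Q. \<Sum>s\<in>S. \<Sum>t\<in>T. v a q s t * cnj (v a q s t)) = 1"

lemma isometry_norm:
  assumes "isometry_on Q P E K" "finite Q"
  shows "(\<Sum>e\<in>E. \<Sum>p\<in>P. (\<Sum>q\<in>Q. K e p q * x q) * cnj (\<Sum>q\<in>Q. K e p q * x q)) = (\<Sum>q\<in>Q. x q * cnj (x q))"
proof -
  let ?f = "\<lambda>e p q q'. cnj (K e p q') * K e p q * (x q * cnj (x q'))"
  have "(\<Sum>e\<in>E. \<Sum>p\<in>P. (\<Sum>q\<in>Q. K e p q * x q) * cnj (\<Sum>q\<in>Q. K e p q * x q)) =
      (\<Sum>e\<in>E. \<Sum>p\<in>P. \<Sum>q\<in>Q. \<Sum>q'\<in>Q. ?f e p q q')"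
    by (simp add: sum_product cnj_sum mult_ac)
  also have "\<dots> = (\<Sum>e\<in>E. \<Sum>q\<in>Q. \<Sum>p\<in>P. \<Sum>q'\<in>Q. ?f e p q q')"
    by (intro sum.cong refl sum.swap)
  also have "\<dots> = (\<Sum>q\<in>Q. \<Sum>e\<in>E. \<Sum>p\<in>P. \<Sum>q'\<in>Q. ?f e p q q')"
    by (rule sum.swap)
  also have "\<dots> = (\<Sum>q\<in>Q. \<Sum>e\<in>E. \<Sum>q'\<in>Q. \<Sum>p\<in>P. ?f e p q q')"
    by (intro sum.cong refl sum.swap)
  also have "\<dots> = (\<Sum>q\<in>Q. \<Sum>q'\<in>Q. \<Sum>e\<in>E. \<Sum>p\<in>P. ?f e p q q')"
    by (intro sum.cong refl sum.swap)
  also have "\<dots> = (\<Sum>q\<in>Q. \<Sum>q'\<in>Q. if q' = q then x q * cnj (x q') else 0)"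
    using assms(1) by (intro sum.cong refl) (auto simp: isometry_on_def sum_distrib_right[symmetric])
  also have "\<dots> = (\<Sum>q\<in>Q. x q * cnj (x q))" using assms(2) by (simp add: sum.delta)
  finally show ?thesis .
qed

text \<open>The squared norm as a single sum over tuples, so that all groupings of the five systems
  are compared by reindexing.\<close>

definition total :: "'a set \<Rightarrow> 'p set \<Rightarrow> 'e set \<Rightarrow> 's set \<Rightarrow> 't set \<Rightarrow>
    ('a \<Rightarrow> 'p \<Rightarrow> 'e \<Rightarrow> 's \<Rightarrow> 't \<Rightarrow> complex) \<Rightarrow> complex" where
  "total A P E S T \<Psi> = (\<Sum>(a, p, e, s, t)\<in>A \<times> P \<times> E \<times> S \<times> T. \<Psi> a p e s t * cnj (\<Psi> a p e s t))"

lemma total_dilate: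
  assumes K: "isometry_on Q P E K" "finite Q" and v: "normalized A Q S T v"
  shows "total A P E S T (dilate Q K v) = 1"
proof -
  let ?\<Psi> = "dilate Q K v"
  \<comment> \<open>The environment and output sums are moved innermost, where
    \<open>isometry_norm\<close> contracts them.\<close>
  have "total A P E S T ?\<Psi> = (\<Sum>(a, s, t, e, p)\<in>A \<times> S \<times> T \<times> E \<times> P. ?\<Psi> a p e s t * cnj (?\<Psi> a p e s t))"
    unfolding total_def
    by (rule sum.reindex_bij_witness[where i = "\<lambda>(a, s, t, e, p). (a, p, e, s, t)" and j = "\<lambda>(a, p, e, s, t). (a, s, t, e, p)"]) auto
  also have "\<dots> = (\<Sum>a\<in>A. \<Sum>s\<in>S. \<Sum>t\<in>T. \<Sum>e\<in>E. \<Sum>p\<in>P. ?\<Psi> a p e s t * cnj (?\<Psi> a p e s t))"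
    by (simp add: sum.cartesian_product')
  also have "\<dots> = (\<Sum>a\<in>A. \<Sum>s\<in>S. \<Sum>t\<in>T. \<Sum>q\<in>Q. v a q s t * cnj (v a q s t))"
    unfolding dilate_def by (intro sum.cong refl isometry_norm K)
  also have "\<dots> = (\<Sum>(a, s, t, q)\<in>A \<times> S \<times> T \<times> Q. v a q s t * cnj (v a q s t))"
    by (simp add: sum.cartesian_product')
  also have "\<dots> = (\<Sum>(a, q, s, t)\<in>A \<times> Q \<times> S \<times> T. v a q s t * cnj (v a q s t))"
    by (rule sum.reindex_bij_witness[where j = "\<lambda>(a, s, t, q). (a, q, s, t)" and i = "\<lambda>(a, q, s, t). (a, s, t, q)"]) auto
  also have "\<dots> = 1" using v by (simp add: normalized_def sum.cartesian_product')
  finally show ?thesis .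
qed

lemma total_swap: "total A P E T S (\<lambda>a p e t s. \<Psi> a p e s t) = total A P E S T \<Psi>"
  unfolding total_def
  by (rule sum.reindex_bij_witness[where i = "\<lambda>(a, p, e, s, t). (a, p, e, t, s)" and j = "\<lambda>(a, p, e, s, t). (a, p, e, t, s)"]) auto

lemma sqnorm_total:
  "sqnorm (P \<times> S) ((A \<times> E) \<times> T) (\<lambda>(p, s) ((a, e), t). \<Psi> a p e s t) = total A P E S T \<Psi>"
  "sqnorm (E \<times> S) ((A \<times> P) \<times> T) (\<lambda>(e, s) ((a, p), t). \<Psi> a p e s t) = total A P E S T \<Psi>"
proof -
  show "sqnorm (P \<times> S) ((A \<times> E) \<times> T) (\<lambda>(p, s) ((a, e), t). \<Psi> a p e s t) = total A P E S T \<Psi>"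
    unfolding total_def sqnorm_def sum.cartesian_product
    by (rule sum.reindex_bij_witness[where i = "\<lambda>(a, p, e, s, t). ((p, s), ((a, e), t))" and j = "\<lambda>((p, s), ((a, e), t)). (a, p, e, s, t)"]) auto
  show "sqnorm (E \<times> S) ((A \<times> P) \<times> T) (\<lambda>(e, s) ((a, p), t). \<Psi> a p e s t) = total A P E S T \<Psi>"
    unfolding total_def sqnorm_def sum.cartesian_product
    by (rule sum.reindex_bij_witness[where i = "\<lambda>(a, p, e, s, t). ((e, s), ((a, p), t))" and j = "\<lambda>((e, s), ((a, p), t)). (a, p, e, s, t)"]) auto
qed

section \<open>Relabelling of systems and symmetrization\<close>

lemma bij_betw_map_prod:
  assumes "bij_betw f A B" "bij_betw g C D"
  shows "bij_betw (map_prod f g) (A \<times> C) (B \<times> D)"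
  using assms by (simp add: bij_betw_def map_prod_inj_on map_prod_surj_on)

lemma coh_reindex:
  assumes "bij_betw fP P P'" "bij_betw fE E E'" "bij_betw fA A A'" "bij_betw fS S S'" "bij_betw fT T T'"
    and "\<And>a p e s t. a \<in> A \<Longrightarrow> p \<in> P \<Longrightarrow> e \<in> E \<Longrightarrow> s \<in> S \<Longrightarrow> t \<in> T \<Longrightarrow>
      \<Psi> a p e s t = \<Psi>' (fA a) (fP p) (fE e) (fS s) (fT t)"
  shows "coh P E A S T \<Psi> = coh P' E' A' S' T' \<Psi>'"
  unfolding coh_def
  by (intro arg_cong2[where f = "(-)"] ent_reindex[OF bij_betw_map_prod[OF _ bij_betw_map_prod] bij_betw_map_prod[OF bij_betw_map_prod]]
      ent_reindex[OF bij_betw_map_prod bij_betw_map_prod[OF bij_betw_map_prod]] assms) (auto simp: assms)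

lemma gain_reindex:
  assumes "bij_betw fP P P'" "bij_betw fE E E'" "bij_betw fA A A'" "bij_betw fS S S'" "bij_betw fT T T'"
    and "\<And>a p e s t. a \<in> A \<Longrightarrow> p \<in> P \<Longrightarrow> e \<in> E \<Longrightarrow> s \<in> S \<Longrightarrow> t \<in> T \<Longrightarrow>
      \<Psi> a p e s t = \<Psi>' (fA a) (fP p) (fE e) (fS s) (fT t)"
  shows "gain P E A S T \<Psi> = gain P' E' A' S' T' \<Psi>'"
proof -
  have "coh P E A S T \<Psi> = coh P' E' A' S' T' \<Psi>'"
    by (rule coh_reindex[OF assms(1-5)]) (rule assms(6))
  moreover have "coh P E A T S (\<lambda>a p e t s. \<Psi> a p e s t) = coh P' E' A' T' S' (\<lambda>a p e t s. \<Psi>' a p e s t)"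
    by (rule coh_reindex[OF assms(1,2,3,5,4)]) (rule assms(6))
  ultimately show ?thesis by (simp add: gain_def)
qed

text \<open>The swap-symmetric superposition \<open>(v\<^sub>S\<^sub>T + v\<^sub>T\<^sub>S) / \<surd>2\<close>, where both \<open>\<top>\<close> and \<open>\<bottom>\<close> are
  \<open>S \<oplus> T\<close>. Tracing out either of them makes the two branches incoherent.\<close>

fun symmetrize :: "('s \<Rightarrow> 't \<Rightarrow> complex) \<Rightarrow> 's + 't \<Rightarrow> 's + 't \<Rightarrow> complex" where
  "symmetrize f (Inl s) (Inr t) = f s t / sqrt 2"
| "symmetrize f (Inr t) (Inl s) = f s t / sqrt 2"
| "symmetrize f (Inl s) (Inl s') = 0"
| "symmetrize f (Inr t) (Inr t') = 0"

lemma symmetrize_commute: "symmetrize f x y = symmetrize f y x"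
  by (cases x; cases y) auto

lemma ent_symmetrize:
  assumes fin: "finite P" "finite R" "finite S" "finite T"
    and n: "sqnorm (P \<times> S) (R \<times> T) (\<lambda>(p, s) (r, t). \<Theta> p r s t) = 1"
      "sqnorm (P \<times> T) (R \<times> S) (\<lambda>(p, t) (r, s). \<Theta> p r s t) = 1"
  shows "ent (P \<times> (S <+> T)) (R \<times> (S <+> T)) (\<lambda>(p, x) (r, y). symmetrize (\<Theta> p r) x y) =
    1 + (ent (P \<times> S) (R \<times> T) (\<lambda>(p, s) (r, t). \<Theta> p r s t) + ent (P \<times> T) (R \<times> S) (\<lambda>(p, t) (r, s). \<Theta> p r s t)) / 2"
proof -
  let ?f = "\<lambda>x. case x of Inl (p, s) \<Rightarrow> (p, Inl s) | Inr (p, t) \<Rightarrow> (p, Inr t)"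
  \<comment> \<open>The branches cross: when the kept system is in its S branch, the traced one is
    in its T branch. So \<open>P\<close> with S is paired with \<open>R\<close> with T, which brings
    the vector into block form.\<close>
  let ?g = "\<lambda>x. case x of Inl (r, t) \<Rightarrow> (r, Inr t) | Inr (r, s) \<Rightarrow> (r, Inl s)"
  let ?\<Psi> = "\<lambda>(p, x) (r, y). symmetrize (\<Theta> p r) x y"
  have "bij_betw ?f (P \<times> S <+> P \<times> T) (P \<times> (S <+> T))"
    by (rule bij_betw_byWitness[where f' = "\<lambda>(p, x). case x of Inl s \<Rightarrow> Inl (p, s) | Inr t \<Rightarrow> Inr (p, t)"]) auto
  moreover have "bij_betw ?g (R \<times> T <+> R \<times> S) (R \<times> (S <+> T))"
    by (rule bij_betw_byWitness[where f' = "\<lambda>(p, x). case x of Inr s \<Rightarrow> Inl (p, s) | Inl t \<Rightarrow> Inr (p, t)"]) auto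
  ultimately have "ent (P \<times> (S <+> T)) (R \<times> (S <+> T)) ?\<Psi> =
      ent (P \<times> S <+> P \<times> T) (R \<times> T <+> R \<times> S) (\<lambda>x y. ?\<Psi> (?f x) (?g y))"
    by (rule ent_reindex[symmetric]) auto
  also have "\<dots> = 1 + (ent (P \<times> S) (R \<times> T) (\<lambda>(p, s) (r, t). \<Theta> p r s t) + ent (P \<times> T) (R \<times> S) (\<lambda>(p, t) (r, s). \<Theta> p r s t)) / 2"
    by (rule ent_balanced_sum[OF _ _ _ _ n]) (auto simp: fin)
  finally show ?thesis .
qed

lemma case_prod_nested:
  "(\<lambda>(p, z) ((a, e), z'). f a p e z z') = (\<lambda>(p, z) (ae, z'). f (fst ae) p (snd ae) z z')"
  "(\<lambda>(e, z) ((a, p), z'). f a p e z z') = (\<lambda>(e, z) (ap, z'). f (fst ap) (snd ap) e z z')"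
  by (auto simp: fun_eq_iff)

text \<open>Both entropies in \<open>coh\<close> become the mean over the two branches plus one bit;
  in the difference the bit cancels and the mean of the two orders of S and T remains.\<close>

lemma coh_symmetrize:
  assumes fin: "finite P" "finite E" "finite A" "finite S" "finite T" and n: "total A P E S T \<Psi> = 1"
  shows "coh P E A (S <+> T) (S <+> T) (\<lambda>a p e. symmetrize (\<Psi> a p e)) = gain P E A S T \<Psi>"
proof -
  have n': "total A P E T S (\<lambda>a p e t s. \<Psi> a p e s t) = 1" using n total_swap[where \<Psi> = \<Psi>] by simp
  let ?\<Phi> = "\<lambda>a p e t s. \<Psi> a p e s t"
  define \<Theta> where "\<Theta> p ae = \<Psi> (fst ae) p (snd ae)" for p ae
  define \<Theta>' where "\<Theta>' e ap = \<Psi> (fst ap) (snd ap) e" for e ap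
  note eq = case_prod_nested
  note sq = sqnorm_total(1)[where P = P and S = S and A = A and E = E and T = T and \<Psi> = \<Psi>, unfolded eq n]
    sqnorm_total(2)[where P = P and S = S and A = A and E = E and T = T and \<Psi> = \<Psi>, unfolded eq n]
    sqnorm_total(1)[where P = P and S = T and A = A and E = E and T = S and \<Psi> = ?\<Phi>, unfolded eq n']
    sqnorm_total(2)[where P = P and S = T and A = A and E = E and T = S and \<Psi> = ?\<Phi>, unfolded eq n']
  note 1 = ent_symmetrize[of P "A \<times> E" S T \<Theta>, unfolded \<Theta>_def,
      OF fin(1) finite_cartesian_product[OF fin(3,2)] fin(4,5) sq(1) sq(3)]
  note 2 = ent_symmetrize[of E "A \<times> P" S T \<Theta>', unfolded \<Theta>'_def,
      OF fin(2) finite_cartesian_product[OF fin(3,1)] fin(4,5) sq(2) sq(4)]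
  show ?thesis unfolding coh_def gain_def eq 1 2 by (simp add: field_simps)
qed

text \<open>The isometry acts on the channel input alone and is linear, so it commutes with forming
  the superposition.\<close>

lemma dilate_symmetrize:
  "dilate Q K (\<lambda>a q. symmetrize (v a q)) a p e x y = symmetrize (dilate Q K v a p e) x y"
  by (cases x; cases y) (auto simp: dilate_def sum_divide_distrib)

section \<open>The quantity \<open>Q_ss\<close> as an unconstrained supremum\<close>

lemma channel_output_index:
  assumes K: "kraus da db N E K"
    and idx: "a < A" "a' < A" "p < db" "p' < db" "r < d * d" "r' < d * d"
  shows "channel_output A da db N d \<phi> $$ ((a * db + p) * (d * d) + r, (a' * db + p') * (d * d) + r') =
    (\<Sum>e\<in>E. \<Sum>q<da. \<Sum>q'<da. K e p q * cnj (K e p' q') *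
      \<phi> $$ ((a * da + q) * (d * d) + r, (a' * da + q') * (d * d) + r'))"
proof -
  have Nc: "N (unit_mat da q q') \<in> carrier_mat db db"
    and NK: "N (unit_mat da q q') $$ (p, p') = (\<Sum>e\<in>E. K e p q * cnj (K e p' q'))" if "q < da" "q' < da" for q q'
    using K that idx by (auto simp: kraus_def)
  let ?T = "tensor_map A A id da db N"
  let ?\<phi> = "\<lambda>x q x' q'. \<phi> $$ ((x * da + q) * (d * d) + r, (x' * da + q') * (d * d) + r')"
  have T: "?T (unit_mat (A * da) (x * da + q) (x' * da + q')) $$ (a * db + p, a' * db + p') =
      (if x = a \<and> x' = a' then N (unit_mat da q q') $$ (p, p') else 0)"
    if "x < A" "x' < A" "q < da" "q' < da" for x x' q q'
    using tensor_map_unit_mat[OF that, of "a * db + p" A db "a' * db + p'" id N]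
      kron_index[OF unit_mat_carrier Nc[OF that(3,4)] idx(1-4)] that idx
    by (simp add: pair_less)
  have "channel_output A da db N d \<phi> $$ ((a * db + p) * (d * d) + r, (a' * db + p') * (d * d) + r') =
      (\<Sum>i<A * da. \<Sum>j<A * da. \<phi> $$ (i * (d * d) + r, j * (d * d) + r') *
         ?T (unit_mat (A * da) i j) $$ (a * db + p, a' * db + p'))"
    unfolding channel_output_def
    by (rule tensor_map_id_right) (use idx in \<open>auto simp: pair_less tensor_map_def\<close>)
  also have "\<dots> = (\<Sum>x<A. \<Sum>q<da. \<Sum>x'<A. \<Sum>q'<da. if x = a \<and> x' = a' then ?\<phi> x q x' q' * N (unit_mat da q q') $$ (p, p') else 0)"
    unfolding sum_pair by (intro sum.cong refl) (simp add: T)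
  also have "\<dots> = (\<Sum>x<A. \<Sum>x'<A. \<Sum>q<da. \<Sum>q'<da. if x = a \<and> x' = a' then ?\<phi> x q x' q' * N (unit_mat da q q') $$ (p, p') else 0)"
    by (intro sum.cong refl sum.swap)
  also have "\<dots> = (\<Sum>x<A. \<Sum>x'<A. if x = a \<and> x' = a' then \<Sum>q<da. \<Sum>q'<da. ?\<phi> x q x' q' * N (unit_mat da q q') $$ (p, p') else 0)"
    by (intro sum.cong refl) auto
  also have "\<dots> = (\<Sum>q<da. \<Sum>q'<da. ?\<phi> a q a' q' * N (unit_mat da q q') $$ (p, p'))"
    by (rule sum2_delta) (use idx in auto)
  also have "\<dots> = (\<Sum>q<da. \<Sum>q'<da. \<Sum>e\<in>E. K e p q * cnj (K e p' q') * ?\<phi> a q a' q')"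
    by (intro sum.cong refl) (simp add: NK sum_distrib_left sum_distrib_right mult_ac)
  also have "\<dots> = (\<Sum>q<da. \<Sum>e\<in>E. \<Sum>q'<da. K e p q * cnj (K e p' q') * ?\<phi> a q a' q')"
    by (intro sum.cong refl sum.swap)
  also have "\<dots> = (\<Sum>e\<in>E. \<Sum>q<da. \<Sum>q'<da. K e p q * cnj (K e p' q') * ?\<phi> a q a' q')"
    by (rule sum.swap)
  finally show ?thesis .
qed

text \<open>Invariance of the projector determines the vector only up to a phase, so antisymmetric
  vectors qualify as well. Hence the condition is on products \<open>v * cnj v\<close>.\<close>

definition swap_sym :: "'a set \<Rightarrow> 'q set \<Rightarrow> 's set \<Rightarrow> ('a \<Rightarrow> 'q \<Rightarrow> 's \<Rightarrow> 's \<Rightarrow> complex) \<Rightarrow> bool" where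
  "swap_sym A Q S v \<longleftrightarrow> (\<forall>a\<in>A. \<forall>q\<in>Q. \<forall>s\<in>S. \<forall>t\<in>S. \<forall>a'\<in>A. \<forall>q'\<in>Q. \<forall>s'\<in>S. \<forall>t'\<in>S.
     v a q s t * cnj (v a' q' s' t') = v a q t s * cnj (v a' q' t' s'))"

lemma swap_sym_dilate:
  assumes "swap_sym A Q S v" "a \<in> A" "a' \<in> A" "s \<in> S" "t \<in> S" "s' \<in> S" "t' \<in> S"
  shows "dilate Q K v a p e s t * cnj (dilate Q K v a' p' e' s' t') =
    dilate Q K v a p e t s * cnj (dilate Q K v a' p' e' t' s')"
proof -
  have *: "dilate Q K v a p e s t * cnj (dilate Q K v a' p' e' s' t') =
      (\<Sum>q\<in>Q. \<Sum>q'\<in>Q. K e p q * cnj (K e' p' q') * (v a q s t * cnj (v a' q' s' t')))" for s t s' t'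
    unfolding dilate_def by (simp add: sum_product cnj_sum mult_ac)
  show ?thesis unfolding *
    by (intro sum.cong refl arg_cong[where f = "(*) _"]) (use assms in \<open>unfold swap_sym_def, blast\<close>)
qed

text \<open>Marginals see the vector only through products with its conjugate, for which
  \<open>swap_sym\<close> gives exact invariance.\<close>

lemma ent_swap_sym:
  assumes "swap_sym A Q S v"
  shows "ent (P \<times> S) ((A \<times> E) \<times> S) (\<lambda>(p, t) ((a, e), s). dilate Q K v a p e s t) =
      ent (P \<times> S) ((A \<times> E) \<times> S) (\<lambda>(p, s) ((a, e), t). dilate Q K v a p e s t)"
    and "ent (E \<times> S) ((A \<times> P) \<times> S) (\<lambda>(e, t) ((a, p), s). dilate Q K v a p e s t) =
      ent (E \<times> S) ((A \<times> P) \<times> S) (\<lambda>(e, s) ((a, p), t). dilate Q K v a p e s t)"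
proof -
  show "ent (P \<times> S) ((A \<times> E) \<times> S) (\<lambda>(p, t) ((a, e), s). dilate Q K v a p e s t) =
      ent (P \<times> S) ((A \<times> E) \<times> S) (\<lambda>(p, s) ((a, e), t). dilate Q K v a p e s t)"
    by (rule ent_cong_marginal)
      (auto simp: marginal_def intro!: sum.cong swap_sym_dilate[OF assms])
  show "ent (E \<times> S) ((A \<times> P) \<times> S) (\<lambda>(e, t) ((a, p), s). dilate Q K v a p e s t) =
      ent (E \<times> S) ((A \<times> P) \<times> S) (\<lambda>(e, s) ((a, p), t). dilate Q K v a p e s t)"
    by (rule ent_cong_marginal)
      (auto simp: marginal_def intro!: sum.cong swap_sym_dilate[OF assms])
qed

definition enc :: "nat \<Rightarrow> nat \<Rightarrow> nat \<Rightarrow> nat \<Rightarrow> nat \<Rightarrow> nat \<Rightarrow> nat" where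
  "enc da d a q s t = (a * da + q) * (d * d) + (s * d + t)"

lemma enc_less: "a < A \<Longrightarrow> q < da \<Longrightarrow> s < d \<Longrightarrow> t < d \<Longrightarrow> enc da d a q s t < A * da * (d * d)"
  unfolding enc_def by (intro pair_less)

lemma enc_cases:
  assumes "i < A * da * (d * d)"
  obtains a q s t where "i = enc da d a q s t" "a < A" "q < da" "s < d" "t < d"
proof -
  obtain x y where i: "i = x * (d * d) + y" and xy: "x < A * da" "y < d * d" using assms by (rule nat_pair_cases)
  obtain a q where x: "x = a * da + q" "a < A" "q < da" using xy(1) by (rule nat_pair_cases)
  obtain s t where y: "y = s * d + t" "s < d" "t < d" using xy(2) by (rule nat_pair_cases)
  show thesis using that[of a q s t] i x y by (simp add: enc_def)
qed

text \<open>The passage from the matrix definition to amplitudes, and the place where swap symmetry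
  is turned into an equality of entropies.\<close>

lemma coherent_info_eq_coh:
  assumes K: "kraus da db N E K"
    and \<phi>: "\<And>a q s t a' q' s' t'. a < A \<Longrightarrow> a' < A \<Longrightarrow> q < da \<Longrightarrow> q' < da \<Longrightarrow> s < d \<Longrightarrow> s' < d \<Longrightarrow> t < d \<Longrightarrow> t' < d \<Longrightarrow>
      \<phi> $$ (enc da d a q s t, enc da d a' q' s' t') = v a q s t * cnj (v a' q' s' t')"
    and sym: "swap_sym {..<A} {..<da} {..<d} v"
  shows "coherent_info A (db * d) (ptrace_right (A * db * d) d (channel_output A da db N d \<phi>)) =
    coh {..<db} E {..<A} {..<d} {..<d} (dilate {..<da} K v)"
proof -
  let ?\<Psi> = "dilate {..<da} K v"
  have finE: "finite E" using K by (simp add: kraus_def)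
  define \<rho> where "\<rho> = ptrace_right (A * db * d) d (channel_output A da db N d \<phi>)"
  have \<omega>: "channel_output A da db N d \<phi> $$ (((a * db + p) * d + s) * d + t, ((a' * db + p') * d + s') * d + t') =
      (\<Sum>e\<in>E. ?\<Psi> a p e s t * cnj (?\<Psi> a' p' e s' t'))"
    if "a < A" "a' < A" "p < db" "p' < db" "s < d" "s' < d" "t < d" "t' < d" for a a' p p' s s' t t'
  proof -
    \<comment> \<open>The channel output treats the two swapped systems as one factor of size
      \<open>d * d\<close>, whereas the partial trace removes only the last factor of size
      \<open>d\<close>.\<close>
    have i: "((x * d + s) * d + t) = x * (d * d) + (s * d + t)" for x s t by (simp add: algebra_simps)
    have "channel_output A da db N d \<phi> $$ (((a * db + p) * d + s) * d + t, ((a' * db + p') * d + s') * d + t') =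
        (\<Sum>e\<in>E. \<Sum>q<da. \<Sum>q'<da. K e p q * cnj (K e p' q') * \<phi> $$ (enc da d a q s t, enc da d a' q' s' t'))"
      unfolding i enc_def by (rule channel_output_index[OF K]) (use that in \<open>auto simp: pair_less\<close>)
    also have "\<dots> = (\<Sum>e\<in>E. \<Sum>q<da. \<Sum>q'<da. (K e p q * v a q s t) * cnj (K e p' q' * v a' q' s' t'))"
      using that by (intro sum.cong refl) (simp add: \<phi> mult_ac)
    finally show ?thesis by (simp add: dilate_def sum_product cnj_sum)
  qed
  have \<rho>: "\<rho> $$ ((a * db + p) * d + s, (a' * db + p') * d + s') =
      (\<Sum>t<d. \<Sum>e\<in>E. ?\<Psi> a p e s t * cnj (?\<Psi> a' p' e s' t))"
    if "a < A" "a' < A" "p < db" "p' < db" "s < d" "s' < d" for a a' p p' s s'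
    using that unfolding \<rho>_def ptrace_right_def by (simp add: pair_less \<omega>)
  have "entropy \<rho> = ent (({..<A} \<times> {..<db}) \<times> {..<d}) (E \<times> {..<d}) (\<lambda>((a, p), s) (e, t). ?\<Psi> a p e s t)"
  proof (rule entropy_eq_ent)
    show "\<rho> \<in> carrier_mat (A * db * d) (A * db * d)" by (simp add: \<rho>_def ptrace_right_def)
    show "bij_betw ((\<lambda>(i, k). i * d + k) \<circ> map_prod (\<lambda>(i, k). i * db + k) id) (({..<A} \<times> {..<db}) \<times> {..<d}) {..<A * db * d}"
      by (rule bij_betw_trans[OF bij_betw_map_prod[OF bij_betw_pair bij_betw_id] bij_betw_pair])
  qed (auto simp: \<rho> marginal_def sum.cartesian_product' intro: sum.swap)
  \<comment> \<open>Purity replaces the joint output by its complement, the environment with the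
    traced swap system; the next step uses symmetry to exchange that system for the kept
    one.\<close>
  also have "\<dots> = ent (E \<times> {..<d}) (({..<A} \<times> {..<db}) \<times> {..<d}) (\<lambda>(e, t) ((a, p), s). ?\<Psi> a p e s t)"
    using finE by (subst ent_swap) (auto simp: case_prod_unfold)
  also have "\<dots> = ent (E \<times> {..<d}) (({..<A} \<times> {..<db}) \<times> {..<d}) (\<lambda>(e, s) ((a, p), t). ?\<Psi> a p e s t)"
    by (rule ent_swap_sym(2)[OF sym])
  finally have 1: "entropy \<rho> = \<dots>" .
  have 2: "entropy (ptrace_left A (db * d) \<rho>) =
      ent ({..<db} \<times> {..<d}) (({..<A} \<times> E) \<times> {..<d}) (\<lambda>(p, s) ((a, e), t). ?\<Psi> a p e s t)"
  proof (rule entropy_eq_ent[OF _ bij_betw_pair])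
    show "ptrace_left A (db * d) \<rho> \<in> carrier_mat (db * d) (db * d)" by (simp add: ptrace_left_def)
    fix x x' assume "x \<in> {..<db} \<times> {..<d}" "x' \<in> {..<db} \<times> {..<d}"
    then obtain p s p' s' where x: "x = (p, s)" "x' = (p', s')" and ps: "p < db" "p' < db" "s < d" "s' < d" by auto
    have i: "a * (db * d) + (p * d + s) = (a * db + p) * d + s" for a p s by (simp add: algebra_simps)
    have "ptrace_left A (db * d) \<rho> $$ (p * d + s, p' * d + s') =
        (\<Sum>a<A. \<Sum>t<d. \<Sum>e\<in>E. ?\<Psi> a p e s t * cnj (?\<Psi> a p' e s' t))"
      using ps by (simp add: ptrace_left_def pair_less i \<rho>)
    also have "\<dots> = (\<Sum>a<A. \<Sum>e\<in>E. \<Sum>t<d. ?\<Psi> a p e s t * cnj (?\<Psi> a p' e s' t))"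
      by (intro sum.cong refl sum.swap)
    finally show "ptrace_left A (db * d) \<rho> $$ ((case x of (i, k) \<Rightarrow> i * d + k), (case x' of (i, k) \<Rightarrow> i * d + k)) =
        marginal (({..<A} \<times> E) \<times> {..<d}) (\<lambda>(p, s) ((a, e), t). ?\<Psi> a p e s t) x x'"
      by (simp add: x marginal_def sum.cartesian_product')
  qed
  show ?thesis unfolding coherent_info_def \<rho>_def[symmetric] 1 2 coh_def ..
qed

text \<open>\<open>W\<close> is the permutation matrix exchanging \<open>s\<close> and
  \<open>t\<close>, so each sum in the conjugation has a single nonzero term.\<close>

lemma swap_conj_index:
  assumes \<phi>: "\<phi> \<in> carrier_mat (m * (d * d)) (m * (d * d))"
    and idx: "x < m" "x' < m" "s < d" "s' < d" "t < d" "t' < d"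
  defines "W \<equiv> kron (1\<^sub>m m) (swap_mat d)"
  shows "(W * \<phi> * mat_adjoint W) $$ (x * (d * d) + (s * d + t), x' * (d * d) + (s' * d + t')) =
    \<phi> $$ (x * (d * d) + (t * d + s), x' * (d * d) + (t' * d + s'))"
proof -
  let ?D = "m * (d * d)"
  have sw: "swap_mat d \<in> carrier_mat (d * d) (d * d)" by (simp add: swap_mat_def)
  have W: "W \<in> carrier_mat ?D ?D" using sw by (auto simp: W_def kron_def)
  have We: "W $$ (x * (d * d) + (s * d + t), k) = (if k = x * (d * d) + (t * d + s) then 1 else 0)"
    if kD: "k < ?D" and "x < m" "s < d" "t < d" for k x s t
  proof -
    obtain y z where k: "k = y * (d * d) + z" and y: "y < m" and z: "z < d * d" using kD by (rule nat_pair_cases)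
    obtain s' t' where z': "z = s' * d + t'" "s' < d" "t' < d" using z by (rule nat_pair_cases)
    have "W $$ (x * (d * d) + (s * d + t), k) = 1\<^sub>m m $$ (x, y) * swap_mat d $$ (s * d + t, z)"
      unfolding W_def k by (rule kron_index[OF one_carrier_mat sw]) (use that y z in \<open>auto simp: pair_less\<close>)
    also have "\<dots> = (if k = x * (d * d) + (t * d + s) then 1 else 0)"
      using that y z z' unfolding k by (auto simp: swap_mat_def pair_less pair_eq_iff)
    finally show ?thesis .
  qed
  have less: "x * (d * d) + (s * d + t) < ?D" if "x < m" "s < d" "t < d" for x s t
    using that by (simp add: pair_less)
  note l = less[OF idx(1,3,5)] less[OF idx(2,4,6)] less[OF idx(1,5,3)] less[OF idx(2,6,4)]
  have 1: "(W * \<phi>) $$ (x * (d * d) + (s * d + t), k) = \<phi> $$ (x * (d * d) + (t * d + s), k)" if "k < ?D" for k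
  proof -
    have "(W * \<phi>) $$ (x * (d * d) + (s * d + t), k) =
        (\<Sum>j<?D. W $$ (x * (d * d) + (s * d + t), j) * \<phi> $$ (j, k))"
      using W \<phi> that l by (simp add: scalar_prod_def atLeast0LessThan)
    also have "\<dots> = (\<Sum>j<?D. if j = x * (d * d) + (t * d + s) then \<phi> $$ (j, k) else 0)"
      using idx by (intro sum.cong refl) (auto simp: We)
    finally show ?thesis using l by simp
  qed
  have "(W * \<phi> * mat_adjoint W) $$ (x * (d * d) + (s * d + t), x' * (d * d) + (s' * d + t')) =
      (\<Sum>k<?D. (W * \<phi>) $$ (x * (d * d) + (s * d + t), k) * mat_adjoint W $$ (k, x' * (d * d) + (s' * d + t')))"
    using W \<phi> l by (simp add: scalar_prod_def atLeast0LessThan)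
  also have "\<dots> = (\<Sum>k<?D. if k = x' * (d * d) + (t' * d + s') then \<phi> $$ (x * (d * d) + (t * d + s), k) else 0)"
    using W l idx by (intro sum.cong refl) (auto simp: 1 We simp del: index_mult_mat(1))
  finally show ?thesis using l by simp
qed

lemma sum_enc:
  "(\<Sum>i<A * da * (d * d). f i) = (\<Sum>a<A. \<Sum>q<da. \<Sum>s<d. \<Sum>t<d. f (enc da d a q s t))"
  unfolding sum_pair[of f "A * da"] sum_pair[of _ A da] sum_pair[of _ d d] enc_def ..

lemma sym_input_amplitude:
  assumes "sym_input A da d \<phi>"
  obtains v where "normalized {..<A} {..<da} {..<d} {..<d} v" "swap_sym {..<A} {..<da} {..<d} v"
    "\<And>a q s t a' q' s' t'. a < A \<Longrightarrow> a' < A \<Longrightarrow> q < da \<Longrightarrow> q' < da \<Longrightarrow> s < d \<Longrightarrow> s' < d \<Longrightarrow> t < d \<Longrightarrow> t' < d \<Longrightarrow>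
      \<phi> $$ (enc da d a q s t, enc da d a' q' s' t') = v a q s t * cnj (v a' q' s' t')"
proof -
  have ps: "pure_state (A * da * (d * d)) \<phi>"
    and W: "kron (1\<^sub>m (A * da)) (swap_mat d) * \<phi> * mat_adjoint (kron (1\<^sub>m (A * da)) (swap_mat d)) = \<phi>"
    using assms by (auto simp: sym_input_def Let_def)
  have \<phi>: "\<phi> \<in> carrier_mat (A * da * (d * d)) (A * da * (d * d))" using ps by (simp add: pure_state_def)
  obtain u where u: "(\<Sum>i<A * da * (d * d). u i * cnj (u i)) = 1"
    and \<phi>u: "\<forall>i<A * da * (d * d). \<forall>j<A * da * (d * d). \<phi> $$ (i, j) = u i * cnj (u j)"
    using pure_state_vector[OF ps] by blast
  define v where "v a q s t = u (enc da d a q s t)" for a q s t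
  have \<phi>v: "\<phi> $$ (enc da d a q s t, enc da d a' q' s' t') = v a q s t * cnj (v a' q' s' t')"
    if "a < A" "a' < A" "q < da" "q' < da" "s < d" "s' < d" "t < d" "t' < d" for a q s t a' q' s' t'
    using \<phi>u enc_less that by (simp add: v_def)
  have "normalized {..<A} {..<da} {..<d} {..<d} v"
    using u unfolding normalized_def sum_enc v_def .
  moreover have "swap_sym {..<A} {..<da} {..<d} v" unfolding swap_sym_def
  proof (intro ballI, unfold lessThan_iff)
    fix a q s t a' q' s' t'
    assume i: "a < A" "q < da" "s < d" "t < d" "a' < A" "q' < da" "s' < d" "t' < d"
    have "\<phi> $$ (enc da d a q s t, enc da d a' q' s' t') = \<phi> $$ (enc da d a q t s, enc da d a' q' t' s')"
      unfolding enc_def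
      using swap_conj_index[OF \<phi> pair_less[OF i(1,2)] pair_less[OF i(5,6)] i(3,7,4,8)] unfolding W .
    then show "v a q s t * cnj (v a' q' s' t') = v a q t s * cnj (v a' q' t' s')"
      using i by (simp add: \<phi>v)
  qed
  ultimately show thesis using \<phi>v by (rule that) 
qed

text \<open>For upper bounds it is enough to control \<open>gain\<close> on side systems of equal
  size: on symmetric inputs its two summands agree, so it coincides with the coherent
  information.\<close>

lemma Q_ss_le:
  assumes K: "kraus da db N E K"
    and le: "\<And>A d v. normalized {..<A::nat} {..<da} {..<d::nat} {..<d} v \<Longrightarrow>
      ereal (gain {..<db} E {..<A} {..<d} {..<d} (dilate {..<da} K v)) \<le> c"
  shows "Q_ss da db N \<le> c"
  unfolding Q_ss_def
proof (rule Sup_least, clarify)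
  fix A d \<phi> assume "sym_input A da d \<phi>"
  then obtain v where v: "normalized {..<A} {..<da} {..<d} {..<d} v" and sym: "swap_sym {..<A} {..<da} {..<d} v"
    and \<phi>: "\<And>a q s t a' q' s' t'. a < A \<Longrightarrow> a' < A \<Longrightarrow> q < da \<Longrightarrow> q' < da \<Longrightarrow> s < d \<Longrightarrow> s' < d \<Longrightarrow> t < d \<Longrightarrow> t' < d \<Longrightarrow>
      \<phi> $$ (enc da d a q s t, enc da d a' q' s' t') = v a q s t * cnj (v a' q' s' t')"
    by (rule sym_input_amplitude) blast
  have "coh {..<db} E {..<A} {..<d} {..<d} (dilate {..<da} K v) = gain {..<db} E {..<A} {..<d} {..<d} (dilate {..<da} K v)"
    unfolding gain_def coh_def ent_swap_sym[OF sym] by simp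
  then show "ereal (coherent_info A (db * d) (ptrace_right (A * db * d) d (channel_output A da db N d \<phi>))) \<le> c"
    using le[OF v] coherent_info_eq_coh[OF K \<phi> sym] by simp
qed

lemma normalized_imp_nonempty:
  assumes "normalized A Q S T v"
  shows "A \<noteq> {}" "S \<noteq> {}"
  using assms by (auto simp: normalized_def)

text \<open>Exact symmetry of the vector is asked for here instead of \<open>swap_sym\<close>;
  vectors built by \<open>symmetrize\<close> satisfy it.\<close>

lemma coh_le_Q_ss:
  assumes K: "kraus da db N E K" and n: "normalized {..<A::nat} {..<da} {..<d::nat} {..<d} v"
    and sym: "\<And>a q s t. v a q s t = v a q t s"
  shows "ereal (coh {..<db} E {..<A} {..<d} {..<d} (dilate {..<da} K v)) \<le> Q_ss da db N"
proof -
  let ?D = "A * da * (d * d)"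
  define u where "u i = v (i div (d * d) div da) (i div (d * d) mod da) (i mod (d * d) div d) (i mod (d * d) mod d)" for i
  define \<phi> where "\<phi> = mat ?D ?D (\<lambda>(i, j). u i * cnj (u j))"
  have u: "u (enc da d a q s t) = v a q s t" if "q < da" "s < d" "t < d" for a q s t
    using that pair_less[OF that(2,3)] by (simp add: u_def enc_def)
  have \<phi>: "\<phi> $$ (enc da d a q s t, enc da d a' q' s' t') = v a q s t * cnj (v a' q' s' t')"
    if "a < A" "a' < A" "q < da" "q' < da" "s < d" "s' < d" "t < d" "t' < d" for a q s t a' q' s' t'
    using that by (simp add: \<phi>_def enc_less u)
  have \<phi>c: "\<phi> \<in> carrier_mat ?D ?D" by (simp add: \<phi>_def)
  have "(\<Sum>i<?D. u i * cnj (u i)) = 1"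
    using n unfolding sum_enc normalized_def by (simp add: u)
  then have "pure_state ?D \<phi>" unfolding \<phi>_def by (rule pure_stateI)
  moreover have "kron (1\<^sub>m (A * da)) (swap_mat d) * \<phi> * mat_adjoint (kron (1\<^sub>m (A * da)) (swap_mat d)) = \<phi>" (is "?L = \<phi>")
  proof (rule eq_matI)
    fix i j assume "i < dim_row \<phi>" "j < dim_col \<phi>"
    then have "i < ?D" "j < ?D" by (auto simp: \<phi>_def)
    then obtain a q s t a' q' s' t' where i: "i = enc da d a q s t" "j = enc da d a' q' s' t'"
      and l: "a < A" "q < da" "s < d" "t < d" "a' < A" "q' < da" "s' < d" "t' < d"
      by (metis enc_cases)
    have "?L $$ (i, j) = \<phi> $$ (enc da d a q t s, enc da d a' q' t' s')"
      unfolding i enc_def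
      by (rule swap_conj_index[OF \<phi>c pair_less[OF l(1,2)] pair_less[OF l(5,6)] l(3,7,4,8)])
    also have "\<dots> = \<phi> $$ (i, j)" using l sym by (simp add: i \<phi>)
    finally show "?L $$ (i, j) = \<phi> $$ (i, j)" .
  qed (auto simp: \<phi>_def kron_def swap_mat_def)
  ultimately have si: "sym_input A da d \<phi>" by (simp add: sym_input_def)
  have ss: "swap_sym {..<A} {..<da} {..<d} v" unfolding swap_sym_def using sym by metis
  have "coherent_info A (db * d) (ptrace_right (A * db * d) d (channel_output A da db N d \<phi>)) =
      coh {..<db} E {..<A} {..<d} {..<d} (dilate {..<da} K v)"
    by (rule coherent_info_eq_coh[OF K \<phi> ss])
  \<comment> \<open>The supremum in \<open>Q_ss\<close> admits positive dimensions only; a sum equal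
    to 1 cannot range over an empty set.\<close>
  moreover have "0 < A" "0 < d" using normalized_imp_nonempty[OF n] by (auto simp: lessThan_empty_iff)
  ultimately show ?thesis unfolding Q_ss_def using si by (intro Sup_upper CollectI) metis
qed

lemma normalized_symmetrize:
  assumes "normalized A Q S T v" "finite S" "finite T"
  shows "normalized A Q (S <+> T) (S <+> T) (\<lambda>a q. symmetrize (v a q))"
proof -
  have half: "complex_of_real (sqrt 2) * complex_of_real (sqrt 2) = 2" by (simp flip: of_real_mult)
  have "(\<Sum>x\<in>S <+> T. \<Sum>y\<in>S <+> T. symmetrize f x y * cnj (symmetrize f x y)) = (\<Sum>s\<in>S. \<Sum>t\<in>T. f s t * cnj (f s t))"
    for f :: "'c \<Rightarrow> 'd \<Rightarrow> complex"
  proof -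
    have "(\<Sum>x\<in>S <+> T. \<Sum>y\<in>S <+> T. symmetrize f x y * cnj (symmetrize f x y)) =
        (\<Sum>s\<in>S. \<Sum>t\<in>T. f s t * cnj (f s t) / 2) + (\<Sum>t\<in>T. \<Sum>s\<in>S. f s t * cnj (f s t) / 2)"
      by (simp add: sum.Plus assms half)
    also have "(\<Sum>t\<in>T. \<Sum>s\<in>S. f s t * cnj (f s t) / 2) = (\<Sum>s\<in>S. \<Sum>t\<in>T. f s t * cnj (f s t) / 2)"
      by (rule sum.swap)
    finally show ?thesis by (simp add: sum_divide_distrib[symmetric])
  qed
  then show ?thesis using assms(1) by (simp add: normalized_def)
qed

lemma normalized_reindex:
  assumes "bij_betw f A A'" "bij_betw g S S'" "bij_betw h T T'"
    and "normalized A Q S T (\<lambda>a q s t. v (f a) q (g s) (h t))"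
  shows "normalized A' Q S' T' v"
proof -
  have "(\<Sum>a\<in>A'. \<Sum>q\<in>Q. \<Sum>s\<in>S'. \<Sum>t\<in>T'. v a q s t * cnj (v a q s t)) =
      (\<Sum>a\<in>A. \<Sum>q\<in>Q. \<Sum>s\<in>S. \<Sum>t\<in>T. v (f a) q (g s) (h t) * cnj (v (f a) q (g s) (h t)))"
    by (simp only: sum.reindex_bij_betw[OF assms(1), symmetric] sum.reindex_bij_betw[OF assms(2), symmetric] sum.reindex_bij_betw[OF assms(3), symmetric])
  then show ?thesis using assms(4) by (simp add: normalized_def)
qed

text \<open>Removal of the symmetry constraint: the symmetrized input is admissible and attains
  \<open>gain\<close>. Arbitrary finite sets are allowed because the splitting produces products of
  unequal sizes as side systems.\<close>

lemma gain_le_Q_ss: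
  assumes K: "kraus da db N E K" and v: "normalized A {..<da} S T v"
    and fin: "finite A" "finite S" "finite T"
  shows "ereal (gain {..<db} E A S T (dilate {..<da} K v)) \<le> Q_ss da db N"
proof -
  let ?Z = "S <+> T"
  have finE: "finite E" and iso: "isometry_on {..<da} {..<db} E K" using K by (auto simp: kraus_def)
  obtain f where f: "bij_betw f {..<card A} A"
    using ex_bij_betw_nat_finite[OF fin(1)] by (auto simp: atLeast0LessThan)
  obtain g where g: "bij_betw g {..<card ?Z} ?Z"
    using ex_bij_betw_nat_finite[of ?Z] fin by (auto simp: atLeast0LessThan)
  define f' where "f' = the_inv_into {..<card A} f"
  define g' where "g' = the_inv_into {..<card ?Z} g"
  have f': "bij_betw f' A {..<card A}" unfolding f'_def by (rule bij_betw_the_inv_into[OF f])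
  have g': "bij_betw g' ?Z {..<card ?Z}" unfolding g'_def by (rule bij_betw_the_inv_into[OF g])
  have ff: "f (f' a) = a" if "a \<in> A" for a
    unfolding f'_def using f that by (simp add: bij_betw_def f_the_inv_into_f)
  have gg: "g (g' a) = a" if "a \<in> ?Z" for a
    unfolding g'_def using g that by (auto simp: bij_betw_def f_the_inv_into_f)
  \<comment> \<open>The symmetrized vector transported to initial segments of the naturals, which is
    the form of input that \<open>Q_ss\<close> ranges over.\<close>
  define w where "w a q x y = symmetrize (v (f a) q) (g x) (g y)" for a q x y
  have "normalized {..<card A} {..<da} {..<card ?Z} {..<card ?Z} w"
  proof (rule normalized_reindex[OF f' g' g'])
    have "normalized A {..<da} ?Z ?Z (\<lambda>a q. symmetrize (v a q))"
      by (rule normalized_symmetrize[OF v fin(2,3)])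
    then show "normalized A {..<da} ?Z ?Z (\<lambda>a q s t. w (f' a) q (g' s) (g' t))"
      by (simp add: w_def normalized_def ff gg)
  qed
  then have "ereal (coh {..<db} E {..<card A} {..<card ?Z} {..<card ?Z} (dilate {..<da} K w)) \<le> Q_ss da db N"
    by (rule coh_le_Q_ss[OF K]) (simp add: w_def symmetrize_commute)
  also have "coh {..<db} E {..<card A} {..<card ?Z} {..<card ?Z} (dilate {..<da} K w) =
      coh {..<db} E A ?Z ?Z (\<lambda>a p e. symmetrize (dilate {..<da} K v a p e))"
    by (rule coh_reindex[OF bij_betw_id bij_betw_id f g g])
      (simp add: dilate_symmetrize[symmetric], simp add: dilate_def w_def)
  also have "\<dots> = gain {..<db} E A S T (dilate {..<da} K v)"
    using finE fin by (intro coh_symmetrize total_dilate[OF iso _ v]) auto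
  finally show ?thesis .
qed

section \<open>Additivity\<close>

lemma ent_assoc:
  "ent ((X1 \<times> X2) \<times> S) ((A \<times> Y1 \<times> Y2) \<times> T) (\<lambda>((x1, x2), s) ((a, y1, y2), t). f a x1 x2 y1 y2 s t) =
   ent (X1 \<times> X2 \<times> S) ((A \<times> Y1) \<times> Y2 \<times> T) (\<lambda>(x1, x2, s) ((a, y1), y2, t). f a x1 x2 y1 y2 s t)"
proof (rule ent_reindex)
  show "bij_betw (\<lambda>((x1, x2), s). (x1, x2, s)) ((X1 \<times> X2) \<times> S) (X1 \<times> X2 \<times> S)"
    by (rule bij_betw_byWitness[where f' = "\<lambda>(x1, x2, s). ((x1, x2), s)"]) auto
  show "bij_betw (\<lambda>((a, y1, y2), t). ((a, y1), y2, t)) ((A \<times> Y1 \<times> Y2) \<times> T) ((A \<times> Y1) \<times> Y2 \<times> T)"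
    by (rule bij_betw_byWitness[where f' = "\<lambda>((a, y1), y2, t). ((a, y1, y2), t)"]) auto
qed auto

lemma ent_left_commute:
  "ent (X1 \<times> X2 \<times> S) ((A \<times> Y1) \<times> Y2 \<times> T) (\<lambda>(x1, x2, s) ((a, y1), y2, t). f a x1 x2 y1 y2 s t) =
   ent (X2 \<times> X1 \<times> S) ((A \<times> Y2) \<times> Y1 \<times> T) (\<lambda>(x2, x1, s) ((a, y2), y1, t). f a x1 x2 y1 y2 s t)"
proof (rule ent_reindex)
  show "bij_betw (\<lambda>(x1, x2, s). (x2, x1, s)) (X1 \<times> X2 \<times> S) (X2 \<times> X1 \<times> S)"
    by (rule bij_betw_byWitness[where f' = "\<lambda>(x1, x2, s). (x2, x1, s)"]) auto
  show "bij_betw (\<lambda>((a, y1), y2, t). ((a, y2), y1, t)) ((A \<times> Y1) \<times> Y2 \<times> T) ((A \<times> Y2) \<times> Y1 \<times> T)"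
    by (rule bij_betw_byWitness[where f' = "\<lambda>((a, y1), y2, t). ((a, y2), y1, t)"]) auto
qed auto

text \<open>A purely algebraic identity, valid for every \<open>\<Psi>\<close>: the two
  single-channel terms share two hybrid entropies with opposite signs.\<close>

lemma gain_split:
  "gain (P1 \<times> P2) (E1 \<times> E2) A S T (\<lambda>a (p1, p2) (e1, e2) s t. \<Psi> a p1 p2 e1 e2 s t) =
   gain P1 E1 A (P2 \<times> S) (E2 \<times> T) (\<lambda>a p1 e1 (p2, s) (e2, t). \<Psi> a p1 p2 e1 e2 s t) +
   gain P2 E2 A (E1 \<times> S) (P1 \<times> T) (\<lambda>a p2 e2 (e1, s) (p1, t). \<Psi> a p1 p2 e1 e2 s t)"
proof -
  let ?PS = "ent (P1 \<times> P2 \<times> S) ((A \<times> E1) \<times> E2 \<times> T) (\<lambda>(p1, p2, s) ((a, e1), e2, t). \<Psi> a p1 p2 e1 e2 s t)"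
  let ?ES = "ent (E1 \<times> E2 \<times> S) ((A \<times> P1) \<times> P2 \<times> T) (\<lambda>(e1, e2, s) ((a, p1), p2, t). \<Psi> a p1 p2 e1 e2 s t)"
  let ?PT = "ent (P1 \<times> P2 \<times> T) ((A \<times> E1) \<times> E2 \<times> S) (\<lambda>(p1, p2, t) ((a, e1), e2, s). \<Psi> a p1 p2 e1 e2 s t)"
  let ?ET = "ent (E1 \<times> E2 \<times> T) ((A \<times> P1) \<times> P2 \<times> S) (\<lambda>(e1, e2, t) ((a, p1), p2, s). \<Psi> a p1 p2 e1 e2 s t)"
  \<comment> \<open>The hybrids, in which one channel contributes its output and the other its
    environment; \<open>?MS\<close> and \<open>?MT\<close> cancel in the sum.\<close>
  let ?MS = "ent (E1 \<times> P2 \<times> S) ((A \<times> P1) \<times> E2 \<times> T) (\<lambda>(e1, p2, s) ((a, p1), e2, t). \<Psi> a p1 p2 e1 e2 s t)"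
  let ?MT = "ent (P1 \<times> E2 \<times> T) ((A \<times> E1) \<times> P2 \<times> S) (\<lambda>(p1, e2, t) ((a, e1), p2, s). \<Psi> a p1 p2 e1 e2 s t)"
  have "gain (P1 \<times> P2) (E1 \<times> E2) A S T (\<lambda>a (p1, p2) (e1, e2) s t. \<Psi> a p1 p2 e1 e2 s t) =
      (?PS - ?ES + (?PT - ?ET)) / 2"
    unfolding gain_def coh_def ent_assoc[symmetric] by (simp add: case_prod_unfold)
  moreover have "gain P1 E1 A (P2 \<times> S) (E2 \<times> T) (\<lambda>a p1 e1 (p2, s) (e2, t). \<Psi> a p1 p2 e1 e2 s t) =
      (?PS - ?MS + (?MT - ?ET)) / 2"
    unfolding gain_def coh_def by (simp add: case_prod_unfold)
  moreover have "gain P2 E2 A (E1 \<times> S) (P1 \<times> T) (\<lambda>a p2 e2 (e1, s) (p1, t). \<Psi> a p1 p2 e1 e2 s t) =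
      (?MS - ?ES + (?PT - ?MT)) / 2"
    using ent_left_commute[of E1 P2 S A P1 E2 T "\<lambda>a e1 p2 p1 e2 s t. \<Psi> a p1 p2 e1 e2 s t"]
      ent_left_commute[of E1 E2 S A P1 P2 T "\<lambda>a e1 e2 p1 p2 s t. \<Psi> a p1 p2 e1 e2 s t"]
      ent_left_commute[of P1 P2 T A E1 E2 S "\<lambda>a p1 p2 e1 e2 t s. \<Psi> a p1 p2 e1 e2 s t"]
      ent_left_commute[of P1 E2 T A E1 P2 S "\<lambda>a p1 e2 e1 p2 t s. \<Psi> a p1 p2 e1 e2 s t"]
    unfolding gain_def coh_def by (simp add: case_prod_unfold)
  ultimately show ?thesis by (simp add: field_simps)
qed

section \<open>Product inputs\<close>

lemma ent_tensor_shuffle: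
  assumes "finite P1" "finite P2" "finite S1" "finite S2"
    and "sqnorm (P1 \<times> S1) ((A1 \<times> E1) \<times> T1) (\<lambda>(p, s) ((a, e), t). f a p e s t) = 1"
    and "sqnorm (P2 \<times> S2) ((A2 \<times> E2) \<times> T2) (\<lambda>(p, s) ((a, e), t). g a p e s t) = 1"
  shows "ent ((P1 \<times> P2) \<times> S1 \<times> S2) (((A1 \<times> A2) \<times> E1 \<times> E2) \<times> T1 \<times> T2)
      (\<lambda>((p1, p2), s1, s2) (((a1, a2), e1, e2), t1, t2). f a1 p1 e1 s1 t1 * g a2 p2 e2 s2 t2) =
    ent (P1 \<times> S1) ((A1 \<times> E1) \<times> T1) (\<lambda>(p, s) ((a, e), t). f a p e s t) +
    ent (P2 \<times> S2) ((A2 \<times> E2) \<times> T2) (\<lambda>(p, s) ((a, e), t). g a p e s t)"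
proof -
  let ?f = "\<lambda>(p, s) ((a, e), t). f a p e s t" and ?g = "\<lambda>(p, s) ((a, e), t). g a p e s t"
  have "ent ((P1 \<times> P2) \<times> S1 \<times> S2) (((A1 \<times> A2) \<times> E1 \<times> E2) \<times> T1 \<times> T2)
      (\<lambda>((p1, p2), s1, s2) (((a1, a2), e1, e2), t1, t2). f a1 p1 e1 s1 t1 * g a2 p2 e2 s2 t2) =
    ent ((P1 \<times> S1) \<times> (P2 \<times> S2)) (((A1 \<times> E1) \<times> T1) \<times> ((A2 \<times> E2) \<times> T2)) (\<lambda>(x1, x2) (y1, y2). ?f x1 y1 * ?g x2 y2)"
  proof (rule ent_reindex)
    show "bij_betw (\<lambda>((p1, p2), s1, s2). ((p1, s1), (p2, s2))) ((P1 \<times> P2) \<times> S1 \<times> S2) ((P1 \<times> S1) \<times> (P2 \<times> S2))"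
      by (rule bij_betw_byWitness[where f' = "\<lambda>((p1, s1), (p2, s2)). ((p1, p2), s1, s2)"]) auto
    show "bij_betw (\<lambda>(((a1, a2), e1, e2), t1, t2). (((a1, e1), t1), ((a2, e2), t2)))
        (((A1 \<times> A2) \<times> E1 \<times> E2) \<times> T1 \<times> T2) (((A1 \<times> E1) \<times> T1) \<times> ((A2 \<times> E2) \<times> T2))"
      by (rule bij_betw_byWitness[where f' = "\<lambda>(((a1, e1), t1), ((a2, e2), t2)). (((a1, a2), e1, e2), t1, t2)"]) auto
  qed auto
  also have "\<dots> = ent (P1 \<times> S1) ((A1 \<times> E1) \<times> T1) ?f + ent (P2 \<times> S2) ((A2 \<times> E2) \<times> T2) ?g"
    by (rule ent_tensor) (use assms in auto)
  finally show ?thesis .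
qed

lemma coh_tensor:
  assumes "finite P1" "finite P2" "finite S1" "finite S2" "finite E1" "finite E2"
    and n: "total A1 P1 E1 S1 T1 \<Psi>1 = 1" "total A2 P2 E2 S2 T2 \<Psi>2 = 1"
  shows "coh (P1 \<times> P2) (E1 \<times> E2) (A1 \<times> A2) (S1 \<times> S2) (T1 \<times> T2)
      (\<lambda>(a1, a2) (p1, p2) (e1, e2) (s1, s2) (t1, t2). \<Psi>1 a1 p1 e1 s1 t1 * \<Psi>2 a2 p2 e2 s2 t2) =
    coh P1 E1 A1 S1 T1 \<Psi>1 + coh P2 E2 A2 S2 T2 \<Psi>2"
  using ent_tensor_shuffle[OF assms(1-4) sqnorm_total(1)[of P1 S1 A1 E1 T1 \<Psi>1, unfolded n] sqnorm_total(1)[of P2 S2 A2 E2 T2 \<Psi>2, unfolded n]]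
    ent_tensor_shuffle[OF assms(5,6,3,4) sqnorm_total(2)[of E1 S1 A1 P1 T1 \<Psi>1, unfolded n] sqnorm_total(2)[of E2 S2 A2 P2 T2 \<Psi>2, unfolded n]]
  unfolding coh_def by (simp add: case_prod_unfold)

lemma gain_tensor:
  assumes fin: "finite P1" "finite P2" "finite E1" "finite E2" "finite S1" "finite S2" "finite T1" "finite T2"
    and n: "total A1 P1 E1 S1 T1 \<Psi>1 = 1" "total A2 P2 E2 S2 T2 \<Psi>2 = 1"
  shows "gain (P1 \<times> P2) (E1 \<times> E2) (A1 \<times> A2) (S1 \<times> S2) (T1 \<times> T2)
      (\<lambda>(a1, a2) (p1, p2) (e1, e2) (s1, s2) (t1, t2). \<Psi>1 a1 p1 e1 s1 t1 * \<Psi>2 a2 p2 e2 s2 t2) =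
    gain P1 E1 A1 S1 T1 \<Psi>1 + gain P2 E2 A2 S2 T2 \<Psi>2"
proof -
  have "total A1 P1 E1 T1 S1 (\<lambda>a p e t s. \<Psi>1 a p e s t) = 1" "total A2 P2 E2 T2 S2 (\<lambda>a p e t s. \<Psi>2 a p e s t) = 1"
    using n total_swap[where \<Psi> = \<Psi>1] total_swap[where \<Psi> = \<Psi>2] by simp_all
  from coh_tensor[OF fin(1,2,7,8,3,4) this] coh_tensor[OF fin(1,2,5,6,3,4) n] show ?thesis
    unfolding gain_def by (simp add: case_prod_unfold field_simps)
qed

text \<open>One channel is dilated and its output and environment are absorbed into the side
  systems. Two versions occur, since the output joins S for one channel and T for the other.\<close>

lemma normalized_partial_dilate:
  assumes K: "isometry_on Q P E K" "finite Q"
    and v: "(\<Sum>(a, r, s, t)\<in>A \<times> R \<times> S \<times> T. \<Sum>q\<in>Q. v a r q s t * cnj (v a r q s t)) = 1"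
  shows "normalized A R (P \<times> S) (E \<times> T) (\<lambda>a r (p, s) (e, t). \<Sum>q\<in>Q. K e p q * v a r q s t)"
    and "normalized A R (E \<times> S) (P \<times> T) (\<lambda>a r (e, s) (p, t). \<Sum>q\<in>Q. K e p q * v a r q s t)"
proof -
  let ?f = "\<lambda>a r p s e t. (\<Sum>q\<in>Q. K e p q * v a r q s t) * cnj (\<Sum>q\<in>Q. K e p q * v a r q s t)"
  have 1: "(\<Sum>(a, r, s, t, e, p)\<in>A \<times> R \<times> S \<times> T \<times> E \<times> P. ?f a r p s e t) = 1"
    using v by (simp only: sum.cartesian_product' prod.case isometry_norm[OF K])
  have "(\<Sum>(a, r, (p, s), (e, t))\<in>A \<times> R \<times> (P \<times> S) \<times> (E \<times> T). ?f a r p s e t) =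
      (\<Sum>(a, r, s, t, e, p)\<in>A \<times> R \<times> S \<times> T \<times> E \<times> P. ?f a r p s e t)"
    by (rule sum.reindex_bij_witness[where j = "\<lambda>(a, r, (p, s), (e, t)). (a, r, s, t, e, p)" and i = "\<lambda>(a, r, s, t, e, p). (a, r, (p, s), (e, t))"]) auto
  then show "normalized A R (P \<times> S) (E \<times> T) (\<lambda>a r (p, s) (e, t). \<Sum>q\<in>Q. K e p q * v a r q s t)"
    unfolding normalized_def 1 by (simp only: sum.cartesian_product' prod.case)
  have "(\<Sum>(a, r, (e, s), (p, t))\<in>A \<times> R \<times> (E \<times> S) \<times> (P \<times> T). ?f a r p s e t) =
      (\<Sum>(a, r, s, t, e, p)\<in>A \<times> R \<times> S \<times> T \<times> E \<times> P. ?f a r p s e t)"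
    by (rule sum.reindex_bij_witness[where j = "\<lambda>(a, r, (e, s), (p, t)). (a, r, s, t, e, p)" and i = "\<lambda>(a, r, s, t, e, p). (a, r, (e, s), (p, t))"]) auto
  then show "normalized A R (E \<times> S) (P \<times> T) (\<lambda>a r (e, s) (p, t). \<Sum>q\<in>Q. K e p q * v a r q s t)"
    unfolding normalized_def 1 by (simp only: sum.cartesian_product' prod.case)
qed

lemma Q_ss_tensor_le:
  assumes K1: "kraus a1 b1 N1 E1 K1" and K2: "kraus a2 b2 N2 E2 K2"
  shows "Q_ss (a1 * a2) (b1 * b2) (tensor_map a1 b1 N1 a2 b2 N2) \<le> Q_ss a1 b1 N1 + Q_ss a2 b2 N2"
proof (rule Q_ss_le[OF kraus_tensor[OF K1 K2]])
  fix A d :: nat and v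
  assume v: "normalized {..<A} {..<a1 * a2} {..<d} {..<d} v"
  have i1: "isometry_on {..<a1} {..<b1} E1 K1" and i2: "isometry_on {..<a2} {..<b2} E2 K2"
    and fin: "finite E1" "finite E2" using K1 K2 by (auto simp: kraus_def)
  let ?A = "{..<A}" and ?S = "{..<d}"
  let ?K = "\<lambda>(e1, e2) p q. K1 e1 (p div b2) (q div a2) * K2 e2 (p mod b2) (q mod a2)"
  \<comment> \<open>In \<open>?v1\<close> the second channel has already acted, in
    \<open>?v2\<close> the first one. Dilating the remaining channel gives the same amplitudes
    \<open>\<Psi>\<close> in both cases, up to grouping.\<close>
  let ?v1 = "\<lambda>a q1 (p2, s) (e2, t). \<Sum>q2<a2. K2 e2 p2 q2 * v a (q1 * a2 + q2) s t"
  let ?v2 = "\<lambda>a q2 (e1, s) (p1, t). \<Sum>q1<a1. K1 e1 p1 q1 * v a (q1 * a2 + q2) s t"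
  define \<Psi> where "\<Psi> a p1 p2 e1 e2 s t = (\<Sum>q1<a1. \<Sum>q2<a2. K1 e1 p1 q1 * K2 e2 p2 q2 * v a (q1 * a2 + q2) s t)"
    for a p1 p2 e1 e2 s t
  have n: "(\<Sum>(a, q1, q2, s, t)\<in>?A \<times> {..<a1} \<times> {..<a2} \<times> ?S \<times> ?S.
      v a (q1 * a2 + q2) s t * cnj (v a (q1 * a2 + q2) s t)) = 1"
    using v unfolding normalized_def sum_pair by (simp only: sum.cartesian_product' prod.case)
  have "(\<Sum>(a, q1, s, t, q2)\<in>?A \<times> {..<a1} \<times> ?S \<times> ?S \<times> {..<a2}.
      v a (q1 * a2 + q2) s t * cnj (v a (q1 * a2 + q2) s t)) = 1"
    unfolding n[symmetric]
    by (rule sum.reindex_bij_witness[where j = "\<lambda>(a, q1, s, t, q2). (a, q1, q2, s, t)" and i = "\<lambda>(a, q1, q2, s, t). (a, q1, s, t, q2)"]) auto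
  then have n1: "normalized ?A {..<a1} ({..<b2} \<times> ?S) (E2 \<times> ?S) ?v1"
    by (intro normalized_partial_dilate(1)[OF i2, where v = "\<lambda>a q1 q2. v a (q1 * a2 + q2)"])
      (simp_all only: sum.cartesian_product' prod.case finite_lessThan)
  have "(\<Sum>(a, q2, s, t, q1)\<in>?A \<times> {..<a2} \<times> ?S \<times> ?S \<times> {..<a1}.
      v a (q1 * a2 + q2) s t * cnj (v a (q1 * a2 + q2) s t)) = 1"
    unfolding n[symmetric]
    by (rule sum.reindex_bij_witness[where j = "\<lambda>(a, q2, s, t, q1). (a, q1, q2, s, t)" and i = "\<lambda>(a, q1, q2, s, t). (a, q2, s, t, q1)"]) auto
  then have n2: "normalized ?A {..<a2} (E1 \<times> ?S) ({..<b1} \<times> ?S) ?v2"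
    by (intro normalized_partial_dilate(2)[OF i1, where v = "\<lambda>a q2 q1. v a (q1 * a2 + q2)"])
      (simp_all only: sum.cartesian_product' prod.case finite_lessThan)
  have d1: "dilate {..<a1} K1 ?v1 = (\<lambda>a p1 e1 (p2, s) (e2, t). \<Psi> a p1 p2 e1 e2 s t)"
    by (auto simp: fun_eq_iff dilate_def \<Psi>_def sum_distrib_left mult_ac)
  have d2: "dilate {..<a2} K2 ?v2 = (\<lambda>a p2 e2 (e1, s) (p1, t). \<Psi> a p1 p2 e1 e2 s t)"
    unfolding \<Psi>_def by (subst sum.swap) (auto simp: fun_eq_iff dilate_def sum_distrib_left mult_ac)
  have "gain {..<b1 * b2} (E1 \<times> E2) ?A ?S ?S (dilate {..<a1 * a2} ?K v) =
      gain ({..<b1} \<times> {..<b2}) (E1 \<times> E2) ?A ?S ?S (\<lambda>a (p1, p2) (e1, e2) s t. \<Psi> a p1 p2 e1 e2 s t)"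
    by (rule gain_reindex[OF bij_betw_pair bij_betw_id bij_betw_id bij_betw_id bij_betw_id, symmetric])
      (auto simp: dilate_def sum_pair \<Psi>_def intro!: sum.cong)
  also have "\<dots> = gain {..<b1} E1 ?A ({..<b2} \<times> ?S) (E2 \<times> ?S) (dilate {..<a1} K1 ?v1) +
      gain {..<b2} E2 ?A (E1 \<times> ?S) ({..<b1} \<times> ?S) (dilate {..<a2} K2 ?v2)"
    unfolding d1 d2 by (rule gain_split)
  also have "ereal \<dots> \<le> Q_ss a1 b1 N1 + Q_ss a2 b2 N2"
    unfolding plus_ereal.simps(1)[symmetric]
    by (intro add_mono gain_le_Q_ss[OF K1 n1] gain_le_Q_ss[OF K2 n2]) (auto simp: fin)
  finally show "ereal (gain {..<b1 * b2} (E1 \<times> E2) ?A ?S ?S (dilate {..<a1 * a2} ?K v)) \<le> Q_ss a1 b1 N1 + Q_ss a2 b2 N2" .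
qed

text \<open>The product of the two inputs is used directly, with product side systems; no symmetry
  of \<open>v1\<close> or \<open>v2\<close> is required, because \<open>gain_le_Q_ss\<close>
  symmetrizes the product.\<close>

lemma gain_add_le_Q_ss_tensor:
  fixes A1 d1 A2 d2 :: nat
  assumes K1: "kraus a1 b1 N1 E1 K1" and K2: "kraus a2 b2 N2 E2 K2"
    and v1: "normalized {..<A1} {..<a1} {..<d1} {..<d1} v1"
    and v2: "normalized {..<A2} {..<a2} {..<d2} {..<d2} v2"
  shows "ereal (gain {..<b1} E1 {..<A1} {..<d1} {..<d1} (dilate {..<a1} K1 v1)) +
      ereal (gain {..<b2} E2 {..<A2} {..<d2} {..<d2} (dilate {..<a2} K2 v2)) \<le>
    Q_ss (a1 * a2) (b1 * b2) (tensor_map a1 b1 N1 a2 b2 N2)"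
proof -
  have i1: "isometry_on {..<a1} {..<b1} E1 K1" and i2: "isometry_on {..<a2} {..<b2} E2 K2"
    and fin: "finite E1" "finite E2" using K1 K2 by (auto simp: kraus_def)
  let ?A = "{..<A1} \<times> {..<A2}" and ?S = "{..<d1} \<times> {..<d2}"
  let ?K = "\<lambda>(e1, e2) p q. K1 e1 (p div b2) (q div a2) * K2 e2 (p mod b2) (q mod a2)"
  let ?v = "\<lambda>(x1, x2) q (s1, s2) (t1, t2). v1 x1 (q div a2) s1 t1 * v2 x2 (q mod a2) s2 t2"
  let ?\<Psi>1 = "dilate {..<a1} K1 v1" and ?\<Psi>2 = "dilate {..<a2} K2 v2"
  let ?f = "\<lambda>a q s t. v1 a q s t * cnj (v1 a q s t)" and ?g = "\<lambda>a q s t. v2 a q s t * cnj (v2 a q s t)"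
  have "(\<Sum>a\<in>?A. \<Sum>q<a1 * a2. \<Sum>s\<in>?S. \<Sum>t\<in>?S. ?v a q s t * cnj (?v a q s t)) =
      (\<Sum>((x1, x2), (q1, q2), (s1, s2), (t1, t2))\<in>?A \<times> ({..<a1} \<times> {..<a2}) \<times> ?S \<times> ?S. ?f x1 q1 s1 t1 * ?g x2 q2 s2 t2)"
    unfolding sum_pair sum.cartesian_product' prod.case by (intro sum.cong refl) (simp add: mult_ac)
  also have "\<dots> = (\<Sum>((x1, q1, s1, t1), (x2, q2, s2, t2))\<in>({..<A1} \<times> {..<a1} \<times> {..<d1} \<times> {..<d1}) \<times> ({..<A2} \<times> {..<a2} \<times> {..<d2} \<times> {..<d2}).
      ?f x1 q1 s1 t1 * ?g x2 q2 s2 t2)"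
    by (rule sum.reindex_bij_witness[where j = "\<lambda>((x1, x2), (q1, q2), (s1, s2), (t1, t2)). ((x1, q1, s1, t1), (x2, q2, s2, t2))"
          and i = "\<lambda>((x1, q1, s1, t1), (x2, q2, s2, t2)). ((x1, x2), (q1, q2), (s1, s2), (t1, t2))"]) auto
  also have "\<dots> = (\<Sum>(x1, q1, s1, t1)\<in>{..<A1} \<times> {..<a1} \<times> {..<d1} \<times> {..<d1}. ?f x1 q1 s1 t1) *
      (\<Sum>(x2, q2, s2, t2)\<in>{..<A2} \<times> {..<a2} \<times> {..<d2} \<times> {..<d2}. ?g x2 q2 s2 t2)"
    unfolding sum_product sum.cartesian_product by (intro sum.cong refl) auto
  also have "\<dots> = 1"
    using v1 v2 unfolding normalized_def by (simp only: sum.cartesian_product' prod.case mult_1)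
  finally have "normalized ?A {..<a1 * a2} ?S ?S ?v" unfolding normalized_def .
  then have "ereal (gain {..<b1 * b2} (E1 \<times> E2) ?A ?S ?S (dilate {..<a1 * a2} ?K ?v)) \<le>
      Q_ss (a1 * a2) (b1 * b2) (tensor_map a1 b1 N1 a2 b2 N2)"
    by (intro gain_le_Q_ss[OF kraus_tensor[OF K1 K2]]) auto
  also have "gain {..<b1 * b2} (E1 \<times> E2) ?A ?S ?S (dilate {..<a1 * a2} ?K ?v) =
      gain ({..<b1} \<times> {..<b2}) (E1 \<times> E2) ?A ?S ?S
        (\<lambda>(x1, x2) (p1, p2) (e1, e2) (s1, s2) (t1, t2). ?\<Psi>1 x1 p1 e1 s1 t1 * ?\<Psi>2 x2 p2 e2 s2 t2)"
    by (rule gain_reindex[OF bij_betw_pair bij_betw_id bij_betw_id bij_betw_id bij_betw_id, symmetric])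
      (auto simp: dilate_def sum_pair sum_product mult_ac intro!: sum.cong)
  also have "\<dots> = gain {..<b1} E1 {..<A1} {..<d1} {..<d1} ?\<Psi>1 + gain {..<b2} E2 {..<A2} {..<d2} {..<d2} ?\<Psi>2"
    by (rule gain_tensor) (auto simp: fin total_dilate[OF i1 _ v1] total_dilate[OF i2 _ v2])
  finally show ?thesis by simp
qed

text \<open>Supplies one input per channel, used for the infinite values of the supremum.\<close>

lemma normalized_exists:
  assumes "0 < a"
  shows "\<exists>v. normalized {..<1::nat} {..<a::nat} {..<1::nat} {..<1::nat} v"
proof
  have "(\<Sum>q<a. (if q = 0 then 1 else 0) * cnj (if q = 0 then 1 else 0)) = (\<Sum>q<a. if q = 0 then 1 else 0)"
    by (intro sum.cong) auto
  then show "normalized {..<1::nat} {..<a} {..<1::nat} {..<1::nat} (\<lambda>_ q _ _. if q = 0 then 1 else 0)"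
    using assms by (simp add: normalized_def)
qed

theorem lemma3:
  fixes a1 b1 a2 b2 :: nat
    and N1 N2 :: "complex mat \<Rightarrow> complex mat"
  assumes "quantum_channel a1 b1 N1"
    and "quantum_channel a2 b2 N2"
  shows "Q_ss (a1 * a2) (b1 * b2) (tensor_map a1 b1 N1 a2 b2 N2) = Q_ss a1 b1 N1 + Q_ss a2 b2 N2"
proof (rule antisym)
  obtain K1 K2 where K1: "kraus a1 b1 N1 {..<a1 * b1} K1" and K2: "kraus a2 b2 N2 {..<a2 * b2} K2"
    using kraus_exists assms by metis
  let ?Q = "Q_ss (a1 * a2) (b1 * b2) (tensor_map a1 b1 N1 a2 b2 N2)"
  let ?Q1 = "Q_ss a1 b1 N1" and ?Q2 = "Q_ss a2 b2 N2"
  show "?Q \<le> ?Q1 + ?Q2" by (rule Q_ss_tensor_le[OF K1 K2])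
  let ?g1 = "\<lambda>A d v. ereal (gain {..<b1} {..<a1 * b1} {..<A::nat} {..<d::nat} {..<d} (dilate {..<a1} K1 v))"
  let ?g2 = "\<lambda>A d v. ereal (gain {..<b2} {..<a2 * b2} {..<A::nat} {..<d::nat} {..<d} (dilate {..<a2} K2 v))"
  have *: "?g1 A d v + ?Q2 \<le> ?Q" if "normalized {..<A} {..<a1} {..<d} {..<d} v" for A d v
  proof -
    \<comment> \<open>With the first input fixed, the supremum over the second is taken after moving
      \<open>?g1\<close> to the other side, which is legitimate because it is a finite
      value.\<close>
    have "?Q2 \<le> ?Q - ?g1 A d v"
      by (rule Q_ss_le[OF K2])
        (use gain_add_le_Q_ss_tensor[OF K1 K2 that] in \<open>simp add: ereal_le_minus add.commute\<close>)
    then show ?thesis by (simp add: ereal_le_minus add.commute)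
  qed
  obtain v1 where v1: "normalized {..<1::nat} {..<a1} {..<1::nat} {..<1::nat} v1"
    using normalized_exists assms(1) by (auto simp: quantum_channel_def)
  obtain v2 where v2: "normalized {..<1::nat} {..<a2} {..<1::nat} {..<1::nat} v2"
    using normalized_exists assms(2) by (auto simp: quantum_channel_def)
  have fin2: "?g2 1 1 v2 \<le> ?Q2" by (rule gain_le_Q_ss[OF K2 v2]) auto
  show "?Q1 + ?Q2 \<le> ?Q"
  \<comment> \<open>The supremum over the first input needs \<open>?Q2\<close> to be subtractable.
    If \<open>?Q2\<close> is infinite, the single input \<open>v1\<close> already forces
    \<open>?Q\<close> to be infinite; minus infinity is excluded by \<open>v2\<close>.\<close>
  proof (cases ?Q2)
    case (real r)
    have "?Q1 \<le> ?Q - ?Q2"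
      by (rule Q_ss_le[OF K1]) (use * real in \<open>simp add: ereal_le_minus\<close>)
    then show ?thesis using real by (simp add: ereal_le_minus)
  next
    case PInf
    then show ?thesis using *[OF v1] by simp
  next
    case MInf
    then show ?thesis using fin2 by simp
  qed
qed

end
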